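(* Let $M_\phi=Gr(k,n)=SU(n)/S(U(k)\times U(n-k))$, $1\le k\le n-1$. The Nijenhuis tensor $N_\phi=\pi_0\circ\Omega_{kks}$ on $Gr(k,n)$ is of maximal rank, and its eigenvalues are written in terms of the (non constant) Gelfand-Tsetlin variables $\tilde\lambda^{(s)}_j$ as $$\lambda^{(s)}_j=-2\Big(\tilde\lambda^{(s)}_j-\frac{n-k}{n}\Big).$$ The bihamiltonian polytope coincides with the Gelfand-Tsetlin polytope $$\mathcal C_{GC}(\underbrace{0,\ldots,0}_{k},\underbrace{2,\ldots,2}_{n-k}).$$
   Context: **Setting.** $G=SU(n)$, $\mathfrak g=\mathfrak{su}(n)$, $\mathfrak g_{\mathbb C}=\mathfrak{sl}(n,\mathbb C)$, $\mathfrak t$ = diagonal matrices in $\mathfrak g$, positive roots = those with strictly upper triangular root vectors, $\phi=\alpha_k$ the $k$-th simple root, $H_\phi=S(U(k)\times U(n-k))$ (block diagonal), $\rho_\phi=\frac in{\rm diag}((n-k)1_k,-k1_{n-k})$. Identify $\mathfrak g^*\cong\mathfrak g$ by the trace form. $M_\phi=G/H_\phi$ is the adjoint orbit of $\rho_\phi$ via $\mu(gH_\phi)=g\rho_\phi g^{-1}$; put $\mu(X)={\rm Tr}(\mu X)$. The KKS Poisson bivector $\Omega^{-1}_{kks}$ is determined by $\{\mu(X),\mu(Y)\}_{kks}=\mu([X,Y])$. A bivector $\pi$ is viewed as a map $T^*M\to TM$ by $\langle\pi(\alpha),\beta\rangle=\langle\pi,\alpha\wedge\beta\rangle$, and $\Omega_{kks}:TM_\phi\to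 T^*M_\phi$ is the inverse of the map $\Omega_{kks}^{-1}$. **Bruhat-Poisson structure.** $J:\mathfrak g_{\mathbb C}\to\mathfrak g_{\mathbb C}$ is linear, zero on diagonal matrices, multiplication by $i$ (resp. $-i$) on strictly upper (resp. lower) triangular ones; $C_\pm=i\pm J$; $\mathfrak b_\pm=C_\pm(\mathfrak g)$. $\mathfrak g_{\mathbb C}=\mathfrak g\oplus\mathfrak b_-$ with projections ${\rm pr}_{\mathfrak g,-}$, ${\rm pr}_{\mathfrak b_-}$, and $\langle A,B\rangle={\rm Im}\,{\rm Tr}(AB)$. The standard Poisson-Lie structure $\pi_G$ is, for $\xi,\eta\in\mathfrak g\cong\mathfrak g^*$, $$\langle r_{g^{-1}}\pi_G(g),\xi\wedge\eta\rangle=\langle {\rm pr}_{\mathfrak g,-}({\rm Ad}_{g^{-1}}C_-(\xi)),\,{\rm pr}_{\mathfrak b_-}({\rm Ad}_{g^{-1}}C_-(\eta))\rangle ,$$ where $r_{g^{-1}}$ is right translation to the identity. $\pi_0$ is the unique Poisson structure on $M_\phi$ making $(G,\pi_G)\to (M_\phi,\pi_0)$ a Poisson map. **Rank and polytope.** Each eigenspace of $N_\phi$ has dimension at least $2$, so $N_\phi$ has at most $\frac12\dim M_\phi$ distinct eigenvalues at each point; $N_\phi$ is of maximal rank if it has exactly $\frac12\dim M_\phi$ distinct eigenvalues on a dense open set. The bihamiltonian moment map $J_N:M_\phi\to\mathbb R^{\frac12\dim M_\phi}$ sends a point to the list of the eigenvalues of $N_\phi$ (with a fixed enumeration); its image is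 the bihamiltonian polytope. **Gelfand-Tsetlin variables.** For $0\le s\le n-1$, let $\mu^{(s)}$ be the upper left $(n-s)\times(n-s)$ submatrix of $\mu$ (the moment map of $\mathfrak u(n-s)$ in the chain $\mathfrak u(n)\supset\mathfrak u(n-1)\supset\dots\supset\mathfrak u(1)$ of upper left corners), with eigenvalues $i\tilde\lambda^{(s)}_1,\dots,i\tilde\lambda^{(s)}_{n-s}$, $\tilde\lambda^{(s)}_1\le\dots\le\tilde\lambda^{(s)}_{n-s}$. The Gelfand-Tsetlin variables are those $\tilde\lambda_j^{(s)}$, $s\ge1$, that are not constant on $M_\phi$. For $x_1\le\dots\le x_n$, the Gelfand-Tsetlin polytope $\mathcal C_{GC}(x_1,\dots,x_n)$ is the set of solutions $(x^{(s)}_i)_{1\le s\le n-1,\,1\le i\le n-s}$ of $x_i^{(s)}\le x_i^{(s+1)}\le x_{i+1}^{(s)}$ with $x^{(0)}_i=x_i$, where the coordinates forced to be constant by these inequalities are dropped. In the comparison with the bihamiltonian polytope the eigenvalues at each level $s$ are enumerated in nondecreasing order, $x_i^{(s)}=\lambda^{(s)}_{n-s+1-i}$. *)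

theory Defs
  imports "Jordan_Normal_Form.Char_Poly" "HOL-Analysis.Analysis"
begin

no_notation Matrix.vec_index (infixl "$" 100)

section \<open>The group, its Lie algebra and the orbit\<close>

text \<open>
  Matrices are of type \<open>'n cmat\<close>, that is \<open>complex^'n^'n\<close>, with \<open>'n\<close> finite and
  linearly ordered and \<open>n = CARD('n)\<close>.
  The linear order gives a meaning to upper and lower triangular and to upper left corners.
\<close>

type_synonym 'n cmat = "((complex, 'n) vec, 'n) vec"

definition cadj :: "complex^'n^'m \<Rightarrow> complex^'m^'n" where
  "cadj A = (\<chi> i j. cnj (A $ j $ i))"

definition SU :: "('n::finite) cmat set" where
  "SU = {g. cadj g ** g = mat 1 \<and> det g = 1}"

definition su :: "('n::finite) cmat set" where
  "su = {X. cadj X = - X \<and> trace X = 0}"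

definition lie_bracket :: "('n::finite) cmat \<Rightarrow> 'n cmat \<Rightarrow> 'n cmat" where
  "lie_bracket X Y = X ** Y - Y ** X"

text \<open>Position of an index in the linear order, counted from 0.\<close>

definition pos :: "'n::{finite,linorder} \<Rightarrow> nat" where
  "pos i = card {j. j < i}"

definition rho :: "nat \<Rightarrow> ('n::{finite,linorder}) cmat" where
  "rho k = (\<chi> i j. if i = j
     then \<i> / of_nat CARD('n) * (if pos i < k then of_nat (CARD('n) - k) else - of_nat k) else 0)"

text \<open>
  On \<open>SU\<close> the inverse of \<open>g\<close> is \<open>cadj g\<close>; this is how \<open>g\<inverse>\<close> is written throughout.
  \<open>orbit_map k\<close> is the projection \<open>G \<rightarrow> G/H\<close> followed by the identification \<open>\<mu>\<close> of \<open>G/H\<close>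
  with the adjoint orbit of \<open>rho k\<close>; the subgroup \<open>H = S(U(k) \<times> U(n-k))\<close> is the
  stabilizer of \<open>rho k\<close> (lemma \<open>stabilizer_rho\<close> below).
  In this model a point of \<open>Gr k\<close> is its own moment map value.
\<close>

definition orbit_map :: "nat \<Rightarrow> ('n::{finite,linorder}) cmat \<Rightarrow> 'n cmat" where
  "orbit_map k g = g ** rho k ** cadj g"

definition Gr :: "nat \<Rightarrow> ('n::{finite,linorder}) cmat set" where
  "Gr k = orbit_map k ` SU"

text \<open>
  Tangent spaces of \<open>SU\<close> and of an adjoint orbit, as spaces of velocities at \<open>t = 0\<close> of
  \<open>exp(tX) g\<close> and \<open>exp(tX) x exp(-tX)\<close>.
\<close>

definition tangent_group :: "('n::finite) cmat \<Rightarrow> 'n cmat set" where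
  "tangent_group g = (\<lambda>X. X ** g) ` su"

definition tangent_orbit :: "('n::finite) cmat \<Rightarrow> 'n cmat set" where
  "tangent_orbit x = (\<lambda>X. lie_bracket X x) ` su"

section \<open>Bivectors\<close>

text \<open>
  Covectors at a point of a submanifold of a normed space \<open>V\<close> with tangent space \<open>T\<close> are represented
  by linear functionals on \<open>V\<close>, two of them being the same covector iff they agree on \<open>T\<close>.
  A bivector \<open>P\<close> at that point is the alternating form \<open>P \<alpha> \<beta> = \<langle>P, \<alpha> \<and> \<beta>\<rangle>\<close> on covectors.
  The convention for \<open>\<langle>P, \<alpha> \<and> \<beta>\<rangle>\<close> is the one for which the Poisson bracket is
  \<open>{f,h} = \<langle>P, df \<and> dh\<rangle>\<close>.
\<close>

type_synonym 'v bivector = "('v \<Rightarrow>\<^sub>L real) \<Rightarrow> ('v \<Rightarrow>\<^sub>L real) \<Rightarrow> real"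

definition bivector_on :: "'v::real_normed_vector set \<Rightarrow> 'v bivector \<Rightarrow> bool" where
  "bivector_on T P \<longleftrightarrow> bilinear P \<and> (\<forall>\<alpha>. P \<alpha> \<alpha> = 0) \<and>
     (\<forall>\<alpha> \<beta>. (\<forall>v\<in>T. blinfun_apply \<alpha> v = 0) \<longrightarrow> P \<alpha> \<beta> = 0)"

definition push :: "('v::real_normed_vector \<Rightarrow>\<^sub>L 'w::real_normed_vector) \<Rightarrow> 'v bivector \<Rightarrow> 'w bivector" where
  "push A P = (\<lambda>\<alpha> \<beta>. P (\<alpha> o\<^sub>L A) (\<beta> o\<^sub>L A))"

text \<open>The map from covectors to vectors given by \<open>\<langle>\<beta>, P(\<alpha>)\<rangle> = \<langle>P, \<alpha> \<and> \<beta>\<rangle>\<close>.\<close>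

definition sharp :: "'v::real_normed_vector bivector \<Rightarrow> ('v \<Rightarrow>\<^sub>L real) \<Rightarrow> 'v" where
  "sharp P \<alpha> = (THE v. \<forall>\<beta>. blinfun_apply \<beta> v = P \<alpha> \<beta>)"

text \<open>
  The inverse of \<open>sharp P\<close>, for \<open>P\<close> nondegenerate; only the class of the chosen functional modulo
  the annihilator of the tangent space matters.
\<close>

definition flat :: "'v::real_normed_vector bivector \<Rightarrow> 'v \<Rightarrow> ('v \<Rightarrow>\<^sub>L real)" where
  "flat P v = (SOME \<alpha>. sharp P \<alpha> = v)"

text \<open>
  The trace form identification of \<open>su\<close> with its dual. It is real valued on \<open>su\<close>, so that \<open>Re\<close>
  only extends it to all matrices. On an orbit, \<open>trace_form X\<close> is the differential of \<open>\<mu>(X)\<close>.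
\<close>

definition trace_form :: "('n::finite) cmat \<Rightarrow> ('n cmat \<Rightarrow>\<^sub>L real)" where
  "trace_form X = Blinfun (\<lambda>Y. Re (trace (X ** Y)))"

definition kks :: "('n::finite) cmat \<Rightarrow> 'n cmat bivector" where
  "kks x = (THE P. bivector_on (tangent_orbit x) P \<and>
     (\<forall>X\<in>su. \<forall>Y\<in>su. P (trace_form X) (trace_form Y) = Re (trace (x ** lie_bracket X Y))))"

section \<open>The Bruhat-Poisson structure\<close>

definition J_op :: "('n::{finite,linorder}) cmat \<Rightarrow> 'n cmat" where
  "J_op Z = (\<chi> i j. if i < j then \<i> * Z $ i $ j else if j < i then - \<i> * Z $ i $ j else 0)"

definition C_minus :: "('n::{finite,linorder}) cmat \<Rightarrow> 'n cmat" where
  "C_minus Z = (\<chi> i j. \<i> * Z $ i $ j) - J_op Z"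

definition b_minus :: "('n::{finite,linorder}) cmat set" where
  "b_minus = C_minus ` su"

definition pr_g :: "('n::{finite,linorder}) cmat \<Rightarrow> 'n cmat" where
  "pr_g Z = (THE X. X \<in> su \<and> (\<exists>B\<in>b_minus. Z = X + B))"

definition pr_b :: "('n::{finite,linorder}) cmat \<Rightarrow> 'n cmat" where
  "pr_b Z = (THE B. B \<in> b_minus \<and> (\<exists>X\<in>su. Z = X + B))"

definition right_translation :: "('n::finite) cmat \<Rightarrow> ('n cmat \<Rightarrow>\<^sub>L 'n cmat)" where
  "right_translation h = Blinfun (\<lambda>A. A ** h)"

definition std_poisson_lie :: "('n::{finite,linorder}) cmat \<Rightarrow> 'n cmat bivector" where
  "std_poisson_lie g = (THE P. bivector_on (tangent_group g) P \<and>
     (\<forall>\<xi>\<in>su. \<forall>\<eta>\<in>su. push (right_translation (cadj g)) P (trace_form \<xi>) (trace_form \<eta>) =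
        Im (trace (pr_g (cadj g ** C_minus \<xi> ** g) ** pr_b (cadj g ** C_minus \<eta> ** g)))))"

definition orbit_differential ::
    "nat \<Rightarrow> ('n::{finite,linorder}) cmat \<Rightarrow> ('n cmat \<Rightarrow>\<^sub>L 'n cmat)" where
  "orbit_differential k g = Blinfun (frechet_derivative (orbit_map k) (at g))"

text \<open>
  The value at \<open>x\<close> of the unique bivector field on \<open>Gr k\<close> for which \<open>orbit_map k\<close> is a Poisson map.
  It is a Poisson structure because \<open>std_poisson_lie\<close> is one and \<open>orbit_map k\<close> is a submersion onto
  \<open>Gr k\<close>.
\<close>

definition bruhat_poisson :: "nat \<Rightarrow> ('n::{finite,linorder}) cmat \<Rightarrow> 'n cmat bivector" where
  "bruhat_poisson k x = (THE P. bivector_on (tangent_orbit x) P \<and>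
     (\<forall>g\<in>SU. orbit_map k g = x \<longrightarrow> push (orbit_differential k g) (std_poisson_lie g) = P))"

definition nijenhuis :: "nat \<Rightarrow> ('n::{finite,linorder}) cmat \<Rightarrow> 'n cmat \<Rightarrow> 'n cmat" where
  "nijenhuis k x = sharp (bruhat_poisson k x) \<circ> flat (kks x)"

section \<open>Maximal rank and the bihamiltonian moment map\<close>

text \<open>
  Below \<open>M\<close> is a manifold, \<open>T x\<close> its tangent space at \<open>x\<close>, and \<open>N x\<close> an endomorphism of \<open>T x\<close>.
\<close>

definition eigenvalues_on :: "'v::real_vector set \<Rightarrow> ('v \<Rightarrow> 'v) \<Rightarrow> real set" where
  "eigenvalues_on T f = {c. \<exists>v\<in>T. v \<noteq> 0 \<and> f v = c *\<^sub>R v}"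

definition generalized_eigenspace :: "'v::real_vector set \<Rightarrow> ('v \<Rightarrow> 'v) \<Rightarrow> real \<Rightarrow> 'v set" where
  "generalized_eigenspace T f c = {v\<in>T. \<exists>m. ((\<lambda>w. f w - c *\<^sub>R w) ^^ m) v = 0}"

definition maximal_rank ::
    "'v::euclidean_space set \<Rightarrow> ('v \<Rightarrow> 'v set) \<Rightarrow> ('v \<Rightarrow> 'v \<Rightarrow> 'v) \<Rightarrow> bool" where
  "maximal_rank M T N \<longleftrightarrow> (\<exists>U. openin (top_of_set M) U \<and> M \<subseteq> closure U \<and>
     (\<forall>x\<in>U. finite (eigenvalues_on (T x) (N x)) \<and>
        2 * card (eigenvalues_on (T x) (N x)) = dim (T x)))"

text \<open>
  \<open>F x i\<close>, \<open>i \<in> I\<close>, lists the eigenvalues of \<open>N x\<close>. The list has half as many entries as the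
  dimension of the manifold, so each eigenvalue occurs half as often as its algebraic multiplicity
  (once, where there are \<open>card I\<close> distinct ones).
\<close>

definition bihamiltonian_moment_map ::
    "'v::euclidean_space set \<Rightarrow> ('v \<Rightarrow> 'v set) \<Rightarrow> ('v \<Rightarrow> 'v \<Rightarrow> 'v) \<Rightarrow> 'i set \<Rightarrow> ('v \<Rightarrow> 'i \<Rightarrow> real) \<Rightarrow> bool" where
  "bihamiltonian_moment_map M T N I F \<longleftrightarrow> finite I \<and>
     (\<forall>x\<in>M. 2 * card I = dim (T x) \<and> F x ` I = eigenvalues_on (T x) (N x) \<and>
        (\<forall>c. dim (generalized_eigenspace (T x) (N x) c) = 2 * card {i\<in>I. F x i = c}))"

section \<open>Gelfand-Tsetlin variables and polytope\<close>

definition corner :: "nat \<Rightarrow> ('n::{finite,linorder}) cmat \<Rightarrow> complex Matrix.mat" where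
  "corner m x = Matrix.mat m m (\<lambda>(i,j).
     x $ (sorted_list_of_set UNIV ! i) $ (sorted_list_of_set UNIV ! j))"

text \<open>
  The eigenvalues of the upper left corner of size \<open>n-s\<close> are \<open>\<i>\<close> times the entries of this list,
  with multiplicity. \<open>gt s j x\<close> is the \<open>j\<close>-th smallest entry, \<open>j\<close> counted from 1.
\<close>

definition gt_list :: "nat \<Rightarrow> ('n::{finite,linorder}) cmat \<Rightarrow> real list" where
  "gt_list s x = (THE ls. sorted ls \<and>
     char_poly (corner (CARD('n) - s) x) = (\<Prod>l\<leftarrow>ls. [: - (\<i> * complex_of_real l), 1 :]))"

definition gt :: "nat \<Rightarrow> nat \<Rightarrow> ('n::{finite,linorder}) cmat \<Rightarrow> real" where
  "gt s j x = gt_list s x ! (j - 1)"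

definition levels :: "nat \<Rightarrow> (nat \<times> nat) set" where
  "levels n = {(s,i). 1 \<le> s \<and> s \<le> n - 1 \<and> 1 \<le> i \<and> i \<le> n - s}"

definition gt_index :: "('n::{finite,linorder}) cmat set \<Rightarrow> (nat \<times> nat) set" where
  "gt_index M = {(s,j) \<in> levels CARD('n). \<not> gt s j constant_on M}"

text \<open>
  The map \<open>x\<^sub>i\<^sup>(\<^sup>s\<^sup>) = \<lambda>\<^sup>(\<^sup>s\<^sup>)\<^bsub>n-s+1-i\<^esub>\<close> with values in \<open>\<real>\<^bsup>I\<^esup>\<close>, where \<open>I = increasing_index M\<close>.
  Points of \<open>\<real>\<^bsup>I\<^esup>\<close> are functions that are \<open>undefined\<close> outside \<open>I\<close>.
\<close>

definition increasing_index :: "('n::{finite,linorder}) cmat set \<Rightarrow> (nat \<times> nat) set" where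
  "increasing_index M = {(s,i) \<in> levels CARD('n). (s, CARD('n) - s + 1 - i) \<in> gt_index M}"

definition increasing_enumeration ::
    "('n::{finite,linorder}) cmat set \<Rightarrow> (nat \<Rightarrow> nat \<Rightarrow> 'n cmat \<Rightarrow> real) \<Rightarrow>
     'n cmat \<Rightarrow> nat \<times> nat \<Rightarrow> real" where
  "increasing_enumeration M lam x =
     restrict (\<lambda>(s,i). lam s (CARD('n) - s + 1 - i) x) (increasing_index M)"

definition gc_patterns :: "nat \<Rightarrow> (nat \<Rightarrow> real) \<Rightarrow> (nat \<times> nat \<Rightarrow> real) set" where
  "gc_patterns n x = {y. (\<forall>i\<in>{1..n}. y (0,i) = x i) \<and>
     (\<forall>s i. (Suc s, i) \<in> levels n \<longrightarrow> y (s,i) \<le> y (Suc s, i) \<and> y (Suc s, i) \<le> y (s, i + 1))}"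

definition gc_free :: "nat \<Rightarrow> (nat \<Rightarrow> real) \<Rightarrow> (nat \<times> nat) set" where
  "gc_free n x = {p \<in> levels n. \<not> (\<lambda>y. y p) constant_on gc_patterns n x}"

definition gc_polytope :: "nat \<Rightarrow> (nat \<Rightarrow> real) \<Rightarrow> (nat \<times> nat \<Rightarrow> real) set" where
  "gc_polytope n x = (\<lambda>y. restrict y (gc_free n x)) ` gc_patterns n x"

section \<open>Consistency of the model\<close>

lemma bounded_linear_trace_form: "bounded_linear (\<lambda>Y. Re (trace ((X::('n::finite) cmat) ** Y)))"
proof -
  have "linear (\<lambda>Y. Re (trace (X ** Y)))"
    by (rule linearI)
      (simp_all add: trace_def matrix_matrix_mult_def sum.distrib algebra_simps sum_distrib_left)
  then show ?thesis by (rule linear_conv_bounded_linear[THEN iffD1])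
qed

lemma bounded_linear_right_translation: "bounded_linear (\<lambda>A. (A::('n::finite) cmat) ** h)"
proof -
  have "linear (\<lambda>A. A ** h)"
    by (rule linearI)
      (simp_all add: vec_eq_iff matrix_matrix_mult_def sum.distrib algebra_simps scaleR_sum_right)
  then show ?thesis by (rule linear_conv_bounded_linear[THEN iffD1])
qed

lemma SU_right_inverse:
  assumes "g \<in> SU" shows "g ** cadj g = mat 1"
  using assms matrix_left_right_inverse[of "cadj g" g] by (simp add: SU_def)

lemma stabilizer_rho:
  fixes g :: "('n::{finite,linorder}) cmat"
  assumes "g \<in> SU"
  shows "orbit_map k g = rho k \<longleftrightarrow> (\<forall>i j. (pos i < k) \<noteq> (pos j < k) \<longrightarrow> g $ i $ j = 0)"
proof -
  define d :: "'n \<Rightarrow> complex" where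
    "d i = \<i> / of_nat CARD('n) * (if pos i < k then of_nat (CARD('n) - k) else - of_nat k)" for i
  have rho: "rho k = (\<chi> i j. if i = j then d i else 0)"
    unfolding rho_def d_def by (simp add: vec_eq_iff)
  have ne: "of_nat (CARD('n) - k) \<noteq> (- of_nat k :: complex)"
  proof
    assume "of_nat (CARD('n) - k) = (- of_nat k :: complex)"
    then have "of_nat (CARD('n) - k + k) = (of_nat 0 :: complex)"
      by (simp add: eq_neg_iff_add_eq_0)
    then have "CARD('n) - k + k = 0" unfolding of_nat_eq_iff .
    moreover have "CARD('n) > 0" by (simp add: card_gt_0_iff)
    ultimately show False by linarith
  qed
  then have d: "d i = d j \<longleftrightarrow> (pos i < k) = (pos j < k)" for i j
    using ne[symmetric] by (auto simp: d_def)
  have l: "(g ** rho k) $ i $ j = g $ i $ j * d j" for i j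
    by (simp add: rho matrix_matrix_mult_def if_distrib if_distribR cong: if_cong)
  have r: "(rho k ** g) $ i $ j = d i * g $ i $ j" for i j
    by (simp add: rho matrix_matrix_mult_def if_distrib if_distribR cong: if_cong)
  have "orbit_map k g = rho k \<longleftrightarrow> g ** rho k = rho k ** g"
  proof
    assume "orbit_map k g = rho k"
    then have "g ** rho k ** cadj g ** g = rho k ** g" by (simp add: orbit_map_def)
    then show "g ** rho k = rho k ** g"
      using assms by (simp add: SU_def flip: matrix_mul_assoc)
  next
    assume "g ** rho k = rho k ** g"
    then show "orbit_map k g = rho k"
      using SU_right_inverse[OF assms] by (simp add: orbit_map_def flip: matrix_mul_assoc)
  qed
  also have "\<dots> \<longleftrightarrow> (\<forall>i j. g $ i $ j * d j = d i * g $ i $ j)"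
    by (simp add: vec_eq_iff l r)
  also have "\<dots> \<longleftrightarrow> (\<forall>i j. d i \<noteq> d j \<longrightarrow> g $ i $ j = 0)"
  proof -
    have "g $ i $ j * d j = d i * g $ i $ j \<longleftrightarrow> (d i \<noteq> d j \<longrightarrow> g $ i $ j = 0)" for i j
      unfolding mult.commute[of "d i" "g $ i $ j"] mult_cancel_left by auto
    then show ?thesis by blast
  qed
  finally show ?thesis by (simp add: d)
qed

lemma orbit_map_has_derivative:
  fixes g :: "('n::{finite,linorder}) cmat"
  shows "(orbit_map k has_derivative (\<lambda>A. A ** rho k ** cadj g + g ** rho k ** cadj A)) (at g)"
proof -
  have "linear (\<lambda>A::'n cmat. cadj A)"
    by (rule linearI) (simp_all add: cadj_def vec_eq_iff)
  then have c: "bounded_linear (\<lambda>A::'n cmat. cadj A)"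
    by (rule linear_conv_bounded_linear[THEN iffD1])
  have "bilinear (\<lambda>A B :: 'n cmat. A ** B)"
    unfolding bilinear_def
    by (auto intro!: linearI simp: vec_eq_iff matrix_matrix_mult_def sum.distrib algebra_simps
        scaleR_sum_right)
  then have m: "bounded_bilinear (\<lambda>A B :: 'n cmat. A ** B)"
    by (simp add: bilinear_conv_bounded_bilinear)
  have 1: "((\<lambda>g. g ** rho k) has_derivative (\<lambda>A. A ** rho k)) (at g)"
    by (rule bounded_linear_imp_has_derivative[OF bounded_linear_right_translation])
  have 2: "(cadj has_derivative cadj) (at g)"
    by (rule bounded_linear_imp_has_derivative[OF c])
  show ?thesis
    using bounded_bilinear.FDERIV[OF m 1 2] by (simp add: orbit_map_def[abs_def] add.commute)
qed

lemma orbit_differential_translate: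
  fixes g :: "('n::{finite,linorder}) cmat"
  assumes "g \<in> SU" "X \<in> su"
  shows "blinfun_apply (orbit_differential k g) (X ** g) = lie_bracket X (orbit_map k g)"
proof -
  let ?D = "\<lambda>A. A ** rho k ** cadj g + g ** rho k ** cadj A"
  have D: "frechet_derivative (orbit_map k) (at g) = ?D"
    by (rule frechet_derivative_at[OF orbit_map_has_derivative, symmetric])
  have "bounded_linear ?D"
    using orbit_map_has_derivative by (rule has_derivative_bounded_linear)
  then have "blinfun_apply (orbit_differential k g) (X ** g) = ?D (X ** g)"
    by (simp add: orbit_differential_def D bounded_linear_Blinfun_apply)
  also have "cadj (X ** g) = cadj g ** cadj X"
    by (simp add: cadj_def vec_eq_iff matrix_matrix_mult_def mult.commute)
  also have "cadj X = - X" using assms by (simp add: su_def)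
  also have "g ** rho k ** (cadj g ** - X) = - (orbit_map k g ** X)"
  proof -
    have "A ** - B = - (A ** B)" for A B :: "'n cmat"
      by (simp add: vec_eq_iff matrix_matrix_mult_def sum_negf)
    then show ?thesis by (simp only: orbit_map_def matrix_mul_assoc)
  qed
  also have "X ** g ** rho k ** cadj g = X ** orbit_map k g"
    by (simp only: orbit_map_def matrix_mul_assoc)
  finally show ?thesis by (simp add: lie_bracket_def)
qed

end

(*
  In the model a point of the Grassmannian is x = i (P - k/n) with P an orthogonal projection, and on
  tangent vectors v the Nijenhuis tensor is N v = v + [x, J v]. Its extension nij_op P to all
  skew-Hermitian matrices is compatible with cutting to upper left corners, because J preserves
  triangularity. Passing from the corner of size m to that of size m + 1 adds a last column; on it the
  operator is, after a choice of phases of the eigenvectors, the sum of real forms of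
  2 (1 - P^(m)) and 2 (1 - P^(m+1)), where P^(m) is the corner of P. Summing over m and removing
  the block diagonal matrices, on which N would be 0 or 2, gives all algebraic multiplicities at every
  point: an eigenvalue p of a proper corner contributes 2 to the multiplicity of 2 (1 - p), apart from
  the constant ones.

  The image of the moment map consists of interlacing patterns by Cauchy; strict patterns are realized
  by bordering a matrix corner by corner, the others by a limit. Generic points are dense because any
  two points of the Grassmannian lie on a curve that is rational in t, along which the Hankel
  determinant of the power sums of the nonconstant eigenvalues is rational.
*)
theory Submission
  imports Defs
begin

no_notation Matrix.scalar_prod (infix "\<bullet>" 70)

section \<open>Dimensions of generalized eigenspaces\<close>

text \<open>The constants come from \<open>x = \<i> (P - k/n)\<close>: an eigenvalue p of a corner
  of P is a Gelfand-Tsetlin variable plus k/n, so -2 times the variable shifted by (n-k)/n is 2 (1 -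
  p). The sign reverses the order, hence the backward enumeration of each level, and the spectrum
  {0, 1} of P becomes the top row 0, ..., 0, 2, ..., 2. A corner of P is in general no projection,
  so cutting does not lead from tangent vectors to tangent vectors of a smaller Grassmannian;
  skew-Hermitian matrices, in contrast, are stable under cutting. The passages between corners are
  extensions without a chosen invariant complement. Dimensions of ordinary eigenspaces do not add in
  extensions, those of generalized eigenspaces do, so all counts use the latter. For density, single
  eigenvalues of corners need not be rational along a curve, but their power sums are traces. The
  constant eigenvalues are subtracted because repetitions among them would hide whether the others
  are distinct.\<close>

lemma dim_kernel_image:
  fixes f :: "'a::euclidean_space \<Rightarrow> 'b::euclidean_space"
  assumes f: "linear f" and T: "subspace T"
  shows "dim T = dim (T \<inter> {v. f v = 0}) + dim (f ` T)"
proof -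
  let ?K = "T \<inter> {v. f v = 0}"
  \<comment> \<open>Orthogonal complement of the kernel inside \<open>T\<close>: \<open>f\<close> is
    injective on it, and it has the same image as \<open>T\<close>.\<close>
  define C where "C = {y \<in> T. \<forall>x\<in>?K. orthogonal x y}"
  have K: "subspace ?K"
    using T f by (auto simp: subspace_def linear_0 linear_add linear_cmul)
  have "dim C + dim ?K = dim T"
    unfolding C_def by (rule dim_subspace_orthogonal_to_vectors[OF K T]) auto
  moreover have C: "subspace C"
    using T by (auto simp: C_def subspace_def orthogonal_clauses)
  have "inj_on f C"
  proof (rule inj_onI)
    fix x y assume "x \<in> C" "y \<in> C" "f x = f y"
    then have "x - y \<in> C" "f (x - y) = 0"
      using C f by (auto simp: subspace_diff linear_diff)
    then have "orthogonal (x - y) (x - y)" by (auto simp: C_def)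
    then show "x = y" by (simp add: orthogonal_def)
  qed
  then have "dim (f ` C) = dim C"
    using dim_image_eq[OF f, of C] C by (simp add: span_eq_iff[THEN iffD2])
  moreover have "f ` C = f ` T"
  proof
    show "f ` T \<subseteq> f ` C"
    proof
      fix w assume "w \<in> f ` T"
      then obtain v where v: "v \<in> T" "w = f v" by auto
      obtain y z where yz: "y \<in> span ?K" "\<And>w. w \<in> span ?K \<Longrightarrow> orthogonal z w" "v = y + z"
        using orthogonal_subspace_decomp_exists[of ?K v] by metis
      have y: "y \<in> ?K" using yz(1) K by (metis span_eq_iff)
      have "z = v - y" using yz by simp
      then have "z \<in> T" "f z = w" using y v T f by (auto simp: subspace_diff linear_diff)
      moreover have "\<forall>x\<in>?K. orthogonal x z" using yz(2) by (auto simp: orthogonal_commute span_base)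
      ultimately show "w \<in> f ` C" by (auto simp: C_def)
    qed
  qed (auto simp: C_def)
  ultimately show ?thesis by simp
qed

lemma linear_funpow: "linear (h::'a::real_vector \<Rightarrow> 'a) \<Longrightarrow> linear (h ^^ m)"
  by (induction m) (auto simp: linear_compose id_def[symmetric] linear_id intro: linear_compose)

lemma funpow_invariant: "h ` T \<subseteq> T \<Longrightarrow> v \<in> T \<Longrightarrow> (h ^^ m) v \<in> T"
  by (induction m) auto

text \<open>Fitting's lemma in the form needed for lifting generalized eigenvectors. The images of
  \<open>S\<close> under the powers of \<open>h\<close> shrink until they are stationary; from then
  on \<open>(h ^^ M) s\<close> is also the value of \<open>h ^^ M\<close> at some
  \<open>(h ^^ m) b\<close>, and the difference of the two arguments is the nilpotent part.\<close>

lemma fitting_decomposition: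
  fixes h :: "'a::euclidean_space \<Rightarrow> 'a"
  assumes h: "linear h" and S: "subspace S" and inv: "h ` S \<subseteq> S" and s: "s \<in> S"
  obtains a b M where "a \<in> S" "b \<in> S" "(h ^^ M) a = 0" "s = a + (h ^^ m) b"
proof -
  \<comment> \<open>An exponent at which the dimension of the image is minimal; all later images are
    equal to this one.\<close>
  obtain M where M: "\<And>M'. dim ((h ^^ M) ` S) \<le> dim ((h ^^ M') ` S)"
    using ex_has_least_nat[of "\<lambda>_. True" 0 "\<lambda>M. dim ((h ^^ M) ` S)"] by auto
  have sub: "subspace ((h ^^ j) ` S)" for j
    by (rule linear_subspace_image[OF linear_funpow[OF h] S])
  have eq: "(h ^^ (M + j)) ` S = (h ^^ M) ` S" for j
  proof (rule subspace_dim_equal[OF sub sub _ M])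
    show "(h ^^ (M + j)) ` S \<subseteq> (h ^^ M) ` S"
      using funpow_invariant[OF inv] by (auto simp: funpow_add)
  qed
  have "(h ^^ M) s \<in> (h ^^ (M + (M + m))) ` S" using eq s by blast
  then obtain b0 where b0: "b0 \<in> S" "(h ^^ M) s = (h ^^ (M + (m + M))) b0" by (auto simp: ac_simps)
  define b where "b = (h ^^ M) b0"
  have b: "b \<in> S" using b0 funpow_invariant[OF inv] by (simp add: b_def)
  have "(h ^^ M) s = (h ^^ M) ((h ^^ m) b)" using b0 by (simp add: b_def funpow_add)
  then have "(h ^^ M) (s - (h ^^ m) b) = 0" using linear_funpow[OF h, of M] by (simp add: linear_diff)
  moreover have "s - (h ^^ m) b \<in> S" using s b S funpow_invariant[OF inv] by (simp add: subspace_diff)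
  ultimately show thesis using that[of "s - (h ^^ m) b" b M] b by simp
qed

lemma linear_shift: "linear f \<Longrightarrow> linear (\<lambda>w. f w - c *\<^sub>R w)"
  by (rule linearI) (simp_all add: linear_add linear_cmul algebra_simps)

lemma funpow_kernel_mono:
  fixes h :: "'a::real_vector \<Rightarrow> 'a"
  assumes "linear h" "(h ^^ m) v = 0" "m \<le> m'"
  shows "(h ^^ m') v = 0"
proof -
  have "(h ^^ m') v = (h ^^ (m' - m)) ((h ^^ m) v)"
    using assms(3) by (metis comp_apply funpow_add le_add_diff_inverse2)
  then show ?thesis using assms linear_0[OF linear_funpow] by metis
qed

lemma subspace_generalized_eigenspace:
  assumes f: "linear f" and T: "subspace T"
  shows "subspace (generalized_eigenspace T f c)"
proof -
  let ?h = "\<lambda>w. f w - c *\<^sub>R w"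
  note h = linear_shift[OF f, of c]
  note pow = linear_funpow[OF h]
  show ?thesis
  proof (rule subspaceI)
    show "0 \<in> generalized_eigenspace T f c"
      using T linear_0[OF pow] by (auto simp: generalized_eigenspace_def subspace_0)
  next
    fix x y assume "x \<in> generalized_eigenspace T f c" "y \<in> generalized_eigenspace T f c"
    then obtain m m' where *: "x \<in> T" "y \<in> T" "(?h ^^ m) x = 0" "(?h ^^ m') y = 0"
      by (auto simp: generalized_eigenspace_def)
    then have "(?h ^^ (m + m')) x = 0" "(?h ^^ (m + m')) y = 0"
      using funpow_kernel_mono[OF h] by (meson le_add1 le_add2)+
    then have "(?h ^^ (m + m')) (x + y) = 0" using pow by (simp add: linear_add)
    then show "x + y \<in> generalized_eigenspace T f c"
      using * T by (auto simp: generalized_eigenspace_def subspace_add)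
  next
    fix a x assume "x \<in> generalized_eigenspace T f c"
    then obtain m where *: "x \<in> T" "(?h ^^ m) x = 0"
      by (auto simp: generalized_eigenspace_def)
    then have "(?h ^^ m) (a *\<^sub>R x) = 0" using linear_cmul[OF pow, of m a x] by simp
    then show "a *\<^sub>R x \<in> generalized_eigenspace T f c"
      using * T by (auto simp: generalized_eigenspace_def subspace_scale)
  qed
qed

lemma generalized_eigenspace_cong:
  assumes "\<And>v. v \<in> T \<Longrightarrow> f v = g v" "\<And>v. v \<in> T \<Longrightarrow> f v \<in> T" "subspace T"
  shows "generalized_eigenspace T f c = generalized_eigenspace T g c"
proof -
  have gT: "g v \<in> T" if "v \<in> T" for v using that assms by metis
  have "((\<lambda>w. f w - c *\<^sub>R w) ^^ m) v = ((\<lambda>w. g w - c *\<^sub>R w) ^^ m) v \<and>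
      ((\<lambda>w. f w - c *\<^sub>R w) ^^ m) v \<in> T" if "v \<in> T" for v m
    using that by (induction m) (auto simp: assms(1,3) gT subspace_diff subspace_scale)
  then show ?thesis by (auto simp: generalized_eigenspace_def)
qed

text \<open>Multiplicities add along kernel and image of an intertwining map. Beyond rank-nullity
  the point is surjectivity: an arbitrary preimage of a generalized eigenvector of \<open>g\<close>
  need not be one of \<open>f\<close>, and has to be corrected by an element of the kernel.\<close>

lemma dim_generalized_eigenspace_add:
  fixes f :: "'a::euclidean_space \<Rightarrow> 'a" and g :: "'b::euclidean_space \<Rightarrow> 'b" and \<phi> :: "'a \<Rightarrow> 'b"
  assumes T: "subspace T" and f: "linear f" and inv: "\<And>v. v \<in> T \<Longrightarrow> f v \<in> T"
    and \<phi>: "linear \<phi>" and g: "linear g" and comm: "\<And>v. v \<in> T \<Longrightarrow> \<phi> (f v) = g (\<phi> v)"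
  shows "dim (generalized_eigenspace T f c) =
    dim (generalized_eigenspace (T \<inter> {v. \<phi> v = 0}) f c) + dim (generalized_eigenspace (\<phi> ` T) g c)"
proof -
  let ?h = "\<lambda>w. f w - c *\<^sub>R w" and ?k = "\<lambda>w. g w - c *\<^sub>R w"
  let ?G = "generalized_eigenspace T f c"
  let ?S = "T \<inter> {v. \<phi> v = 0}"
  note h = linear_shift[OF f, of c]
  have hT: "?h ` T \<subseteq> T" using inv T by (auto simp: subspace_diff subspace_scale)
  have S: "subspace ?S"
    using T \<phi> by (auto simp: subspace_def linear_0 linear_add linear_cmul)
  have hS: "?h ` ?S \<subseteq> ?S"
    using hT linear_0[OF g] by (auto simp: comm linear_diff[OF \<phi>] linear_cmul[OF \<phi>])
  have step: "\<phi> (?h v) = ?k (\<phi> v)" if "v \<in> T" for v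
    using that by (simp add: comm linear_diff[OF \<phi>] linear_cmul[OF \<phi>])
  have pow: "\<phi> ((?h ^^ m) v) = (?k ^^ m) (\<phi> v)" if "v \<in> T" for v m
    using that step funpow_invariant[OF hT] by (induction m) auto
  have "?G \<inter> {v. \<phi> v = 0} = generalized_eigenspace ?S f c"
    by (auto simp: generalized_eigenspace_def)
  moreover have "\<phi> ` ?G = generalized_eigenspace (\<phi> ` T) g c"
  proof
    show "\<phi> ` ?G \<subseteq> generalized_eigenspace (\<phi> ` T) g c"
    proof
      fix w assume "w \<in> \<phi> ` ?G"
      then obtain v m where v: "v \<in> T" "(?h ^^ m) v = 0" "w = \<phi> v"
        by (auto simp: generalized_eigenspace_def)
      then have "(?k ^^ m) w = 0" using pow[OF v(1), of m] linear_0[OF \<phi>] by simp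
      then show "w \<in> generalized_eigenspace (\<phi> ` T) g c"
        using v by (auto simp: generalized_eigenspace_def)
    qed
    show "generalized_eigenspace (\<phi> ` T) g c \<subseteq> \<phi> ` ?G"
    proof
      fix w assume "w \<in> generalized_eigenspace (\<phi> ` T) g c"
      then obtain v m where v: "v \<in> T" "w = \<phi> v" "(?k ^^ m) w = 0"
        by (auto simp: generalized_eigenspace_def)
      then have hv: "(?h ^^ m) v \<in> ?S" using pow[OF v(1), of m] funpow_invariant[OF hT] by auto
      \<comment> \<open>Fitting's lemma on the kernel splits \<open>(?h ^^ m) v\<close>: the part
        \<open>(?h ^^ m) b\<close> disappears when \<open>v\<close> is replaced by
        \<open>v - b\<close>, which has the same image under \<open>\<phi>\<close>, and the
        remaining part is nilpotent.\<close>
      obtain a b M where ab: "a \<in> ?S" "b \<in> ?S" "(?h ^^ M) a = 0" "(?h ^^ m) v = a + (?h ^^ m) b"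
        by (rule fitting_decomposition[OF h S hS hv, where m = m])
      then have "(?h ^^ m) (v - b) = a" using linear_funpow[OF h, of m] by (simp add: linear_diff)
      then have "(?h ^^ (M + m)) (v - b) = 0" using ab by (simp add: funpow_add)
      moreover have "v - b \<in> T" using v ab T by (simp add: subspace_diff)
      moreover have "\<phi> (v - b) = w" using v ab by (simp add: linear_diff[OF \<phi>])
      ultimately show "w \<in> \<phi> ` ?G" by (auto simp: generalized_eigenspace_def intro!: rev_image_eqI)
    qed
  qed
  ultimately show ?thesis
    using dim_kernel_image[OF \<phi> subspace_generalized_eigenspace[OF f T]] by metis
qed

lemma generalized_eigenspace_scalar:
  fixes T :: "'a::euclidean_space set"
  assumes T: "subspace T" and f: "\<And>v. v \<in> T \<Longrightarrow> f v = a *\<^sub>R v"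
  shows "generalized_eigenspace T f c = (if c = a then T else {0})"
proof -
  have pow: "((\<lambda>w. f w - c *\<^sub>R w) ^^ m) v = (a - c) ^ m *\<^sub>R v" if "v \<in> T" for v m
    using that by (induction m) (auto simp: f T subspace_scale algebra_simps)
  have "(\<exists>m. (a - c) ^ m *\<^sub>R v = 0) \<longleftrightarrow> c = a \<or> v = 0" for v :: 'a
  proof
    assume "c = a \<or> v = 0"
    \<comment> \<open>The exponent is 1 because \<open>0 ^ 0 = 1\<close>.\<close>
    then have "(a - c) ^ 1 *\<^sub>R v = 0" by auto
    then show "\<exists>m. (a - c) ^ m *\<^sub>R v = 0" ..
  qed auto
  then show ?thesis
    using pow subspace_0[OF T] by (auto simp: generalized_eigenspace_def)
qed

text \<open>The eigenvectors form an indexed family, so that equal eigenvalues are counted as often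
  as they occur. Pairing \<open>(?h ^^ m) v\<close> with \<open>b j\<close> isolates one coefficient
  times a power of \<open>e j - c\<close>, which kills the coefficients with \<open>e j\<close>
  different from \<open>c\<close>.\<close>

lemma dim_generalized_eigenspace_diagonal:
  fixes b :: "'i \<Rightarrow> 'a::euclidean_space"
  assumes I: "finite I" and f: "linear f"
    and b: "\<And>i j. i \<in> I \<Longrightarrow> j \<in> I \<Longrightarrow> b i \<bullet> b j = (if i = j then 1 else 0)"
    and e: "\<And>i. i \<in> I \<Longrightarrow> f (b i) = e i *\<^sub>R b i"
  shows "dim (generalized_eigenspace (span (b ` I)) f c) = card {i \<in> I. e i = c}"
proof -
  let ?h = "\<lambda>w. f w - c *\<^sub>R w"
  note h = linear_shift[OF f, of c]
  have hb: "(?h ^^ m) (b i) = (e i - c) ^ m *\<^sub>R b i" if "i \<in> I" for i m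
    using that by (induction m) (auto simp: e linear_cmul[OF f] algebra_simps)
  let ?I = "{i \<in> I. e i = c}"
  have inj: "inj_on b I"
    by (rule inj_onI) (metis b zero_neq_one)
  have "generalized_eigenspace (span (b ` I)) f c = span (b ` ?I)"
  proof
    show "span (b ` ?I) \<subseteq> generalized_eigenspace (span (b ` I)) f c"
    proof (rule span_minimal)
      show "b ` ?I \<subseteq> generalized_eigenspace (span (b ` I)) f c"
        by (auto simp: generalized_eigenspace_def span_base e intro!: exI[of _ 1])
    qed (simp add: subspace_generalized_eigenspace f)
    show "generalized_eigenspace (span (b ` I)) f c \<subseteq> span (b ` ?I)"
    proof
      fix v assume "v \<in> generalized_eigenspace (span (b ` I)) f c"
      then obtain m where v: "v \<in> span (b ` I)" "(?h ^^ m) v = 0"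
        by (auto simp: generalized_eigenspace_def)
      obtain u where "v = (\<Sum>w\<in>b ` I. u w *\<^sub>R w)"
        using v(1) I by (auto simp: span_finite)
      then have u: "v = (\<Sum>i\<in>I. u (b i) *\<^sub>R b i)" by (simp add: sum.reindex inj)
      have "u (b j) = 0" if j: "j \<in> I" "e j \<noteq> c" for j
      proof -
        have "0 = (?h ^^ m) v \<bullet> b j" using v by simp
        also have "(?h ^^ m) v = (\<Sum>i\<in>I. u (b i) *\<^sub>R (e i - c) ^ m *\<^sub>R b i)"
          unfolding u using hb
          by (simp add: linear_sum[OF linear_funpow[OF h]] linear_cmul[OF linear_funpow[OF h]])
        also have "\<dots> \<bullet> b j = (\<Sum>i\<in>I. if i = j then u (b i) * (e i - c) ^ m else 0)"
          unfolding inner_sum_left by (rule sum.cong) (auto simp: b j)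
        also have "\<dots> = u (b j) * (e j - c) ^ m" using I j by simp
        finally show ?thesis using j by simp
      qed
      then have "v = (\<Sum>i\<in>?I. u (b i) *\<^sub>R b i)"
        unfolding u by (intro sum.mono_neutral_right I) auto
      moreover have "(\<Sum>i\<in>?I. u (b i) *\<^sub>R b i) \<in> span (b ` ?I)"
        by (intro span_sum span_scale span_base imageI)
      ultimately show "v \<in> span (b ` ?I)" by simp
    qed
  qed
  moreover have "independent (b ` ?I)"
  proof (rule pairwise_orthogonal_independent)
    show "pairwise orthogonal (b ` ?I)" by (auto simp: pairwise_def orthogonal_def b)
    have "b i \<noteq> 0" if "i \<in> I" for i using b[OF that that] by auto
    then show "0 \<notin> b ` ?I" by force
  qed
  ultimately show ?thesis
    using inj by (simp add: dim_eq_card_independent card_image inj_on_def)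
qed

text \<open>The last nonzero iterate of a generalized eigenvector is an eigenvector. This recovers
  the eigenvalues from the multiplicities.\<close>

lemma eigenvalues_on_iff_generalized:
  fixes f :: "'a::euclidean_space \<Rightarrow> 'a"
  assumes f: "linear f" and T: "subspace T" and inv: "\<And>v. v \<in> T \<Longrightarrow> f v \<in> T"
  shows "c \<in> eigenvalues_on T f \<longleftrightarrow> dim (generalized_eigenspace T f c) \<noteq> 0"
proof
  assume "c \<in> eigenvalues_on T f"
  then obtain v where v: "v \<in> T" "v \<noteq> 0" "f v = c *\<^sub>R v" by (auto simp: eigenvalues_on_def)
  then have "v \<in> generalized_eigenspace T f c"
    by (auto simp: generalized_eigenspace_def intro!: exI[of _ 1])
  then show "dim (generalized_eigenspace T f c) \<noteq> 0"
    using v unfolding dim_eq_0 by blast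
next
  let ?h = "\<lambda>w. f w - c *\<^sub>R w"
  assume "dim (generalized_eigenspace T f c) \<noteq> 0"
  then obtain v where "v \<in> generalized_eigenspace T f c" "v \<noteq> 0" unfolding dim_eq_0 by blast
  then obtain m where v: "v \<in> T" "v \<noteq> 0" "(?h ^^ m) v = 0" by (auto simp: generalized_eigenspace_def)
  then show "c \<in> eigenvalues_on T f"
  proof (induction m arbitrary: v)
    case (Suc m)
    show ?case
    proof (cases "?h v = 0")
      case True
      then show ?thesis using Suc.prems by (auto simp: eigenvalues_on_def)
    next
      case False
      moreover have "?h v \<in> T" using Suc.prems inv T by (simp add: subspace_diff subspace_scale)
      moreover have "(?h ^^ m) (?h v) = 0" using Suc.prems(3) by (simp only: funpow_Suc_right comp_apply)
      ultimately show ?thesis using Suc.IH by blast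
    qed
  qed simp
qed

section \<open>Hermitian matrices\<close>

text \<open>The Hermitian product whose real part is the Euclidean inner product of the underlying
  real space; real dimension counts can thus be applied to complex eigenvectors.\<close>

definition cip :: "complex^'n \<Rightarrow> complex^'n \<Rightarrow> complex" where
  "cip v w = (\<Sum>i\<in>UNIV. cnj (v $ i) * w $ i)"

lemma cip_simps [simp]:
  "cip v (w + w') = cip v w + cip v w'"
  "cip v (w - w') = cip v w - cip v w'"
  "cip (v + v') w = cip v w + cip v' w"
  "cip (v - v') w = cip v w - cip v' w"
  "cip v (c *s w) = c * cip v w"
  "cip (c *s v) w = cnj c * cip v w"
  "cip v (r *\<^sub>R w) = r *\<^sub>R cip v w"
  "cip (r *\<^sub>R v) w = r *\<^sub>R cip v w"
  "cip v 0 = 0" "cip 0 w = 0"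
  by (simp_all add: cip_def algebra_simps sum.distrib sum_subtractf sum_distrib_left
      scaleR_sum_right)

lemma cip_sum_right [simp]: "cip v (\<Sum>i\<in>I. f i) = (\<Sum>i\<in>I. cip v (f i))"
  by (induction I rule: infinite_finite_induct) auto

lemma cip_sum_left [simp]: "cip (\<Sum>i\<in>I. f i) v = (\<Sum>i\<in>I. cip (f i) v)"
  by (induction I rule: infinite_finite_induct) auto

lemma cnj_cip: "cnj (cip v w) = cip w v"
  by (simp add: cip_def mult.commute)

lemma inner_eq_Re_cip: "v \<bullet> w = Re (cip v w)"
  by (simp add: inner_vec_def cip_def inner_complex_def)

lemma cip_self: "cip v v = of_real (v \<bullet> v)"
proof -
  have "Im (cip v v) = 0" using cnj_cip[of v v] by (metis complex_cnj_cancel_iff complex_In_mult_cnj_zero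
    complex_is_Real_iff Reals_cnj_iff)
  then show ?thesis by (simp add: inner_eq_Re_cip complex_eq_iff)
qed

lemma cip_self_eq_0 [simp]: "cip v v = 0 \<longleftrightarrow> v = 0"
  by (simp add: cip_self)

lemma cip_adj: "cip v (A *v w) = cip (cadj A *v v) (w :: complex^'n)"
  unfolding cip_def cadj_def matrix_vector_mult_def
  by (simp add: sum_distrib_left sum_distrib_right mult_ac) (rule sum.swap)

lemma cip_axis: "cip (axis i 1) w = w $ i"
  by (simp add: cip_def axis_def if_distrib if_distribR cong: if_cong)

lemma scaleR_eq_smult: "r *\<^sub>R (v :: complex^'n) = of_real r *s v"
  by (simp add: vec_eq_iff) (simp add: scaleR_conv_of_real)

lemma mv_simps:
  fixes A :: "complex^'n^'m"
  shows "A *v (x + y) = A *v x + A *v y" "A *v (x - y) = A *v x - A *v y"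
    "A *v (r *\<^sub>R x) = r *\<^sub>R (A *v x)" "A *v (c *s x) = c *s (A *v x)" "A *v 0 = 0"
    "A *v (\<Sum>i\<in>I. f i) = (\<Sum>i\<in>I. A *v f i)"
proof -
  show add: "A *v (x + y) = A *v x + A *v y" for x y by (rule matrix_vector_right_distrib)
  show "A *v (x - y) = A *v x - A *v y" by (rule matrix_vector_mult_diff_distrib)
  show "A *v (r *\<^sub>R x) = r *\<^sub>R (A *v x)" "A *v (c *s x) = c *s (A *v x)"
    by (simp_all add: vec_eq_iff matrix_vector_mult_def sum_distrib_left scaleR_sum_right mult_ac)
  show "A *v 0 = 0" by simp
  then show "A *v (\<Sum>i\<in>I. f i) = (\<Sum>i\<in>I. A *v f i)"
    by (induction I rule: infinite_finite_induct) (auto simp: add)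
qed

lemma linear_mv: "linear (\<lambda>x. (A :: complex^'n^'m) *v x)"
  by (rule linearI) (simp_all add: mv_simps)

definition csubspace :: "(complex^'n) set \<Rightarrow> bool" where
  "csubspace S \<longleftrightarrow> 0 \<in> S \<and> (\<forall>x\<in>S. \<forall>y\<in>S. x + y \<in> S) \<and> (\<forall>c. \<forall>x\<in>S. c *s x \<in> S)"

lemma csubspace_imp_subspace: "csubspace S \<Longrightarrow> subspace S"
  by (auto simp: csubspace_def subspace_def scaleR_eq_smult)

lemma nonneg_quadratic_imp_linear_coeff_zero:
  fixes a b :: real
  assumes "\<And>t. a * t + b * t\<^sup>2 \<ge> 0"
  shows "a = 0"
proof (rule ccontr)
  assume a: "a \<noteq> 0"
  \<comment> \<open>Any \<open>c > b\<close> works: at \<open>t = - a / c\<close> the quadratic has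
    the value \<open>a^2 (b - c) / c^2\<close>.\<close>
  define c where "c = \<bar>b\<bar> + 1"
  have c: "c > 0" "b - c < 0" by (auto simp: c_def)
  have "0 \<le> a * (- a / c) + b * (- a / c)\<^sup>2" by (rule assms)
  also have "\<dots> = a\<^sup>2 * (b - c) / c\<^sup>2"
    using c by (simp add: field_simps power2_eq_square)
  also have "\<dots> < 0" using a c by (simp add: divide_less_0_iff mult_less_0_iff)
  finally show False by simp
qed

text \<open>The quadratic form of \<open>H\<close> attains its maximum on the unit sphere of
  \<open>S\<close>, and a maximizer is an eigenvector: \<open>g\<close>, the gap to the maximal
  Rayleigh quotient, is nonnegative on \<open>S\<close> and vanishes at \<open>u\<close>, so its
  first variation there is zero.\<close>

lemma hermitian_eigenvector_exists:
  fixes H :: "complex^'n^'n"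
  assumes H: "cadj H = H" and S: "csubspace S" and inv: "\<And>v. v \<in> S \<Longrightarrow> H *v v \<in> S" and ne: "S \<noteq> {0}"
  obtains u r where "u \<in> S" "cip u u = 1" "H *v u = of_real r *s u"
proof -
  note sub = csubspace_imp_subspace[OF S]
  define q where "q v = v \<bullet> (H *v v)" for v
  have sym: "v \<bullet> (H *v w) = (H *v v) \<bullet> w" for v w
    by (simp add: inner_eq_Re_cip cip_adj H)
  let ?K = "S \<inter> sphere 0 1"
  have "compact ?K"
    using sub by (simp add: closed_Int_compact closed_subspace)
  moreover obtain s where s: "s \<in> S" "s \<noteq> 0" using ne subspace_0[OF sub] by blast
  then have "s /\<^sub>R norm s \<in> ?K" using sub by (simp add: subspace_scale)
  then have "?K \<noteq> {}" by blast
  moreover have "continuous_on ?K q"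
    unfolding q_def by (intro continuous_intros linear_continuous_on_compose linear_mv)
  ultimately obtain u where u: "u \<in> ?K" "\<And>v. v \<in> ?K \<Longrightarrow> q v \<le> q u"
    using continuous_attains_sup by metis
  have uS: "u \<in> S" and uu: "u \<bullet> u = 1" using u(1) by (auto simp: dot_square_norm)
  define g where "g v = q u * (v \<bullet> v) - q v" for v
  have g: "g v \<ge> 0" if v: "v \<in> S" for v
  proof (cases "v = 0")
    case False
    then have "q (v /\<^sub>R norm v) \<le> q u" using v sub by (intro u(2)) (simp add: subspace_scale)
    moreover have "q (v /\<^sub>R norm v) = q v / (v \<bullet> v)"
      by (simp add: q_def mv_simps power2_norm_eq_inner[symmetric] power2_eq_square field_simps)
    moreover have "v \<bullet> v > 0" using False by simp
    ultimately show ?thesis by (simp add: g_def field_simps)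
  qed (simp add: g_def q_def)
  \<comment> \<open>The defect of the eigenvector equation is itself used as direction of variation:
    the linear term of \<open>g\<close> at \<open>u\<close> along it is
    \<open>2 (w \<bullet> w)\<close>.\<close>
  define w where "w = q u *\<^sub>R u - H *v u"
  have wS: "w \<in> S" using uS inv sub by (simp add: w_def subspace_diff subspace_scale)
  have "2 * (w \<bullet> w) * t + g w * t\<^sup>2 \<ge> 0" for t
  proof -
    have "w \<bullet> w = (q u *\<^sub>R u - H *v u) \<bullet> w" by (simp only: w_def)
    then have ww: "w \<bullet> w = q u * (u \<bullet> w) - (H *v u) \<bullet> w" by (simp add: inner_diff_left)
    have "u \<bullet> (H *v w) = (H *v u) \<bullet> w" "w \<bullet> (H *v u) = (H *v u) \<bullet> w"
      by (rule sym, rule inner_commute)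
    then have "q (u + t *\<^sub>R w) = q u + 2 * t * ((H *v u) \<bullet> w) + t\<^sup>2 * q w"
      by (simp add: q_def mv_simps inner_add_left inner_add_right power2_eq_square distrib_left)
    moreover have "(u + t *\<^sub>R w) \<bullet> (u + t *\<^sub>R w) = 1 + 2 * t * (u \<bullet> w) + t\<^sup>2 * (w \<bullet> w)"
      using uu inner_commute[of w u] by (simp add: inner_add_left inner_add_right power2_eq_square distrib_left)
    ultimately have "g (u + t *\<^sub>R w) = 2 * (w \<bullet> w) * t + g w * t\<^sup>2"
      unfolding g_def ww by (simp only: ring_distribs mult_1_right) simp
    then show ?thesis using g[of "u + t *\<^sub>R w"] uS wS sub by (simp add: subspace_add subspace_scale)
  qed
  then have "2 * (w \<bullet> w) = 0" by (rule nonneg_quadratic_imp_linear_coeff_zero)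
  then have "H *v u = of_real (q u) *s u" by (simp add: w_def scaleR_eq_smult)
  moreover have "cip u u = 1" using uu by (simp add: cip_self)
  ultimately show thesis using that uS by blast
qed

text \<open>Induction on the real dimension: an eigenvector is split off and its orthogonal
  complement in \<open>S\<close> is again invariant. The size \<open>r\<close> of the basis is left
  open, because completeness, stated as an expansion formula, determines it later.\<close>

lemma hermitian_eigenbasis_csubspace:
  fixes H :: "complex^'n^'n"
  assumes H: "cadj H = H"
  shows "csubspace S \<Longrightarrow> (\<And>v. v \<in> S \<Longrightarrow> H *v v \<in> S) \<Longrightarrow>
    \<exists>(r::nat) v l. (\<forall>i<r. v i \<in> S \<and> H *v v i = of_real (l i) *s v i) \<and>
      (\<forall>i<r. \<forall>j<r. cip (v i) (v j) = (if i = j then 1 else 0)) \<and>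
      (\<forall>w\<in>S. w = (\<Sum>j<r. cip (v j) w *s v j))"
proof (induction "dim S" arbitrary: S rule: less_induct)
  case less
  show ?case
  proof (cases "S = {0}")
    case True
    then show ?thesis by (auto intro!: exI[of _ 0])
  next
    case False
    obtain u c where u: "u \<in> S" "cip u u = 1" "H *v u = of_real c *s u"
      using hermitian_eigenvector_exists[OF H less.prems False] by metis
    define S' where "S' = {w\<in>S. cip u w = 0}"
    have S': "csubspace S'"
      using less.prems(1) by (auto simp: S'_def csubspace_def)
    have inv: "H *v v \<in> S'" if "v \<in> S'" for v
      using that less.prems(2) by (auto simp: S'_def cip_adj H u)
    have "u \<notin> S'" using u by (simp add: S'_def)
    moreover have "S' \<subseteq> S" by (auto simp: S'_def)
    ultimately have "S' \<subset> S" using u by blast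
    then have "dim S' < dim S"
      using dim_psubset csubspace_imp_subspace S' less.prems(1) by (metis span_eq_iff)
    from less.hyps[OF this S' inv] obtain r :: nat and v l where IH:
      "\<forall>i<r. v i \<in> S' \<and> H *v v i = of_real (l i) *s v i"
      "\<forall>i<r. \<forall>j<r. cip (v i) (v j) = (if i = j then 1 else 0)"
      "\<forall>w\<in>S'. w = (\<Sum>j<r. cip (v j) w *s v j)" by blast
    have ort: "cip u (v i) = 0" "cip (v i) u = 0" if "i < r" for i
      using IH(1) that cnj_cip[of u "v i"] by (auto simp: S'_def)
    let ?v = "v(r := u)" and ?l = "l(r := c)"
    have "w = (\<Sum>j<Suc r. cip (?v j) w *s ?v j)" if w: "w \<in> S" for w
    proof -
      let ?w = "w + (- cip u w) *s u"
      have "?w \<in> S" using w u(1) less.prems(1) unfolding csubspace_def by blast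
      then have "?w \<in> S'" using u unfolding S'_def by simp
      then have "?w = (\<Sum>j<r. cip (v j) ?w *s v j)" using IH(3) by blast
      also have "\<dots> = (\<Sum>j<r. cip (v j) w *s v j)" by (intro sum.cong) (auto simp: ort)
      finally show ?thesis by (simp add: algebra_simps)
    qed
    moreover have "\<forall>i<Suc r. ?v i \<in> S \<and> H *v ?v i = of_real (?l i) *s ?v i"
      using IH(1) u by (auto simp: less_Suc_eq S'_def)
    moreover have "\<forall>i<Suc r. \<forall>j<Suc r. cip (?v i) (?v j) = (if i = j then 1 else 0)"
      using IH(2) u ort by (auto simp: less_Suc_eq)
    ultimately show ?thesis by blast
  qed
qed

lemma cip_axis_right: "cip w (axis i 1) = cnj (w $ i)"
  by (metis cip_axis cnj_cip)

lemma axis_nth: "axis i c $ j = (if j = i then c else 0)"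
  by (simp add: axis_def)

section \<open>Corners and their eigenvalues\<close>

lemma pos_less_iff: "pos i < pos j \<longleftrightarrow> i < (j :: 'n::{finite,linorder})"
proof
  show "i < j \<Longrightarrow> pos i < pos j" for i j :: 'n
    unfolding pos_def by (intro psubset_card_mono) auto
  then show "pos i < pos j \<Longrightarrow> i < j"
    by (metis antisym_conv3 order_less_irrefl order_less_trans)
qed

lemma pos_le_iff: "pos i \<le> pos j \<longleftrightarrow> i \<le> (j :: 'n::{finite,linorder})"
  using pos_less_iff by (metis linorder_not_less)

lemma pos_eq_iff [simp]: "pos i = pos j \<longleftrightarrow> i = (j :: 'n::{finite,linorder})"
  by (metis pos_less_iff neq_iff order_less_irrefl)

lemma pos_less_card: "pos (i :: 'n::{finite,linorder}) < CARD('n)"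
  unfolding pos_def by (intro psubset_card_mono) auto

lemma bij_betw_pos: "bij_betw pos (UNIV :: 'n::{finite,linorder} set) {..<CARD('n)}"
proof -
  have "inj (pos :: 'n \<Rightarrow> nat)" by (rule injI) simp
  then have "pos ` (UNIV :: 'n set) = {..<CARD('n)}"
    using pos_less_card by (intro card_subset_eq) (auto simp: card_image)
  then show ?thesis using \<open>inj pos\<close> by (simp add: bij_betw_def)
qed

text \<open>The inverse of \<open>pos\<close>, written with the same sorted list that
  \<open>corner\<close> uses for its indices.\<close>

definition at_pos :: "nat \<Rightarrow> 'n::{finite,linorder}" where
  "at_pos a = sorted_list_of_set UNIV ! a"

lemma pos_at_pos [simp]: "a < CARD('n) \<Longrightarrow> pos (at_pos a :: 'n::{finite,linorder}) = a"
proof -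
  assume a: "a < CARD('n)"
  let ?xs = "sorted_list_of_set (UNIV :: 'n set)"
  have len: "length ?xs = CARD('n)" by simp
  have s: "sorted_wrt (<) ?xs" by (rule strict_sorted_list_of_set)
  have "{j. j < ?xs ! a} = (\<lambda>b. ?xs ! b) ` {..<a}"
  proof
    show "(\<lambda>b. ?xs ! b) ` {..<a} \<subseteq> {j. j < ?xs ! a}"
      using s a len by (auto simp: sorted_wrt_iff_nth_less)
    show "{j. j < ?xs ! a} \<subseteq> (\<lambda>b. ?xs ! b) ` {..<a}"
    proof
      fix j assume "j \<in> {j. j < ?xs ! a}"
      moreover obtain b where b: "b < CARD('n)" "j = ?xs ! b"
        using len by (metis UNIV_I finite_class.finite_UNIV in_set_conv_nth set_sorted_list_of_set)
      ultimately have "b < a"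
        using s a len unfolding sorted_wrt_iff_nth_less
        by (metis linorder_neqE_nat mem_Collect_eq order_less_asym order_less_irrefl)
      then show "j \<in> (\<lambda>b. ?xs ! b) ` {..<a}" using b by auto
    qed
  qed
  moreover have "inj_on (\<lambda>b. ?xs ! b) {..<a}"
    using a len by (auto intro!: inj_on_nth)
  ultimately show ?thesis by (simp add: pos_def at_pos_def card_image)
qed

lemma at_pos_pos [simp]: "at_pos (pos i) = (i :: 'n::{finite,linorder})"
  by (metis pos_at_pos pos_eq_iff pos_less_card)

lemma sum_pos: "(\<Sum>i\<in>(UNIV :: 'n::{finite,linorder} set). f (pos i)) = (\<Sum>a<CARD('n). f a)"
  using sum.reindex_bij_betw[OF bij_betw_pos, of f] by simp

lemma card_pos_less: "m \<le> CARD('n) \<Longrightarrow> card {i :: 'n::{finite,linorder}. pos i < m} = m"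
proof -
  assume m: "m \<le> CARD('n)"
  have "bij_betw pos {i :: 'n. pos i < m} {..<m}"
    unfolding bij_betw_def
  proof
    show "pos ` {i :: 'n. pos i < m} = {..<m}"
    proof
      show "{..<m} \<subseteq> pos ` {i :: 'n. pos i < m}"
      proof
        fix a assume "a \<in> {..<m}"
        then have "pos (at_pos a :: 'n) = a" "a < m" using m by auto
        then show "a \<in> pos ` {i :: 'n. pos i < m}" by (metis (mono_tags) image_eqI mem_Collect_eq)
      qed
    qed auto
  qed (simp add: inj_on_def)
  then show ?thesis by (simp add: bij_betw_same_card)
qed

section \<open>Padded corners and ordered eigenbases\<close>

definition corner_space :: "nat \<Rightarrow> (complex, 'n::{finite,linorder}) vec set" where
  "corner_space m = {v. \<forall>i. m \<le> pos i \<longrightarrow> v $ i = 0}"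

text \<open>Corners are kept as full matrices padded with zeros, so that corners of all sizes have
  one type and act on one space.\<close>

definition cut :: "nat \<Rightarrow> ('n::{finite,linorder}) cmat \<Rightarrow> 'n cmat" where
  "cut m A = (\<chi> i j. if pos i < m \<and> pos j < m then A $ i $ j else 0)"

lemma cut_nth [simp]: "cut m A $ i $ j = (if pos i < m \<and> pos j < m then A $ i $ j else 0)"
  by (simp add: cut_def)

lemma cut_full [simp]: "CARD('n) \<le> m \<Longrightarrow> cut m A = (A :: ('n::{finite,linorder}) cmat)"
  using pos_less_card[where 'n = 'n] by (simp add: vec_eq_iff) (meson order_less_le_trans)

lemma cut_cut: "m' \<le> m \<Longrightarrow> cut m' (cut m A) = cut m' A"
  by (auto simp: vec_eq_iff)

lemma cadj_nth [simp]: "cadj A $ i $ j = cnj (A $ j $ i)"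
  by (simp add: cadj_def)

lemma cadj_cut: "cadj (cut m A) = cut m (cadj A)"
  by (simp add: vec_eq_iff)

lemma csubspace_corner_space: "csubspace (corner_space m)"
  by (simp add: csubspace_def corner_space_def)

lemma corner_space_mono: "m \<le> m' \<Longrightarrow> corner_space m \<subseteq> corner_space m'"
  by (auto simp: corner_space_def)

lemma cut_mv_in: "cut m A *v w \<in> corner_space m"
  by (simp add: corner_space_def matrix_vector_mult_def)

text \<open>The monotone order makes the values of \<open>l\<close> below \<open>m\<close> depend on
  \<open>H\<close> only, which is what identifies them with Gelfand-Tsetlin variables. Values of
  \<open>l\<close> from \<open>m\<close> on are arbitrary.\<close>

definition eigenbasis ::
    "nat \<Rightarrow> ('n::{finite,linorder}) cmat \<Rightarrow> (nat \<Rightarrow> (complex, 'n) vec) \<Rightarrow> (nat \<Rightarrow> real) \<Rightarrow> bool" where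
  "eigenbasis m H v l \<longleftrightarrow>
     (\<forall>i<m. v i \<in> corner_space m \<and> H *v v i = of_real (l i) *s v i) \<and>
     (\<forall>i<m. \<forall>j<m. cip (v i) (v j) = (if i = j then 1 else 0)) \<and>
     (\<forall>w\<in>corner_space m. w = (\<Sum>j<m. cip (v j) w *s v j)) \<and>
     (\<forall>i j. i \<le> j \<longrightarrow> j < m \<longrightarrow> l i \<le> l j)"

lemma eigenbasisD:
  assumes "eigenbasis m H v l"
  shows "i < m \<Longrightarrow> v i \<in> corner_space m" "i < m \<Longrightarrow> H *v v i = of_real (l i) *s v i"
    "i < m \<Longrightarrow> j < m \<Longrightarrow> cip (v i) (v j) = (if i = j then 1 else 0)"
    "w \<in> corner_space m \<Longrightarrow> w = (\<Sum>j<m. cip (v j) w *s v j)"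
    "i \<le> j \<Longrightarrow> j < m \<Longrightarrow> l i \<le> l j"
proof -
  note * = assms[unfolded eigenbasis_def]
  show "i < m \<Longrightarrow> v i \<in> corner_space m" "i < m \<Longrightarrow> H *v v i = of_real (l i) *s v i"
    using *[THEN conjunct1] by auto
  show "i < m \<Longrightarrow> j < m \<Longrightarrow> cip (v i) (v j) = (if i = j then 1 else 0)"
    using *[THEN conjunct2, THEN conjunct1] by auto
  show "w \<in> corner_space m \<Longrightarrow> w = (\<Sum>j<m. cip (v j) w *s v j)"
    by (rule *[THEN conjunct2, THEN conjunct2, THEN conjunct1, THEN bspec])
  show "i \<le> j \<Longrightarrow> j < m \<Longrightarrow> l i \<le> l j"
    using *[THEN conjunct2, THEN conjunct2, THEN conjunct2] by auto
qed

lemma axis_in_corner_space: "pos i < m \<Longrightarrow> axis i c \<in> corner_space m"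
  by (auto simp: corner_space_def axis_def)

lemma eigenbasis_exists:
  fixes H :: "('n::{finite,linorder}) cmat"
  assumes H: "cadj H = H" and m: "m \<le> CARD('n)"
  obtains v l where "eigenbasis m (cut m H) v l"
proof -
  have "cadj (cut m H) = cut m H" using H by (simp add: cadj_cut)
  let ?Q = "\<lambda>(r::nat) v l. (\<forall>i<r. v i \<in> corner_space m \<and> cut m H *v v i = of_real (l i) *s v i) \<and>
      (\<forall>i<r. \<forall>j<r. cip (v i) (v j) = (if i = j then 1 else 0)) \<and>
      (\<forall>w\<in>corner_space m. w = (\<Sum>j<r. cip (v j) w *s v j))"
  have "\<exists>r v l. ?Q r v l"
    by (rule hermitian_eigenbasis_csubspace[OF \<open>cadj (cut m H) = cut m H\<close>
          csubspace_corner_space[of m] cut_mv_in])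
  then obtain r where "\<exists>v l. ?Q r v l" ..
  then obtain v where "\<exists>l. ?Q r v l" ..
  then obtain l where Q: "?Q r v l" ..
  have v: "v i \<in> corner_space m" "cut m H *v v i = of_real (l i) *s v i" if "i < r" for i
    using Q[THEN conjunct1] that by auto
  have ort: "cip (v i) (v j) = (if i = j then 1 else 0)" if "i < r" "j < r" for i j
    using Q[THEN conjunct2, THEN conjunct1] that by auto
  have compl: "w = (\<Sum>j<r. cip (v j) w *s v j)" if "w \<in> corner_space m" for w
    by (rule Q[THEN conjunct2, THEN conjunct2, THEN bspec, OF that])
  \<comment> \<open>A diagonal entry of the resolution of the identity. Summed over the
    \<open>m\<close> coordinates of the corner it counts the basis vectors, whence
    \<open>r = m\<close>.\<close>
  have one: "(\<Sum>j<r. cnj (v j $ i) * v j $ i) = 1" if "pos i < m" for i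
    using arg_cong[OF compl[OF axis_in_corner_space[OF that, of 1]], of "\<lambda>w. w $ i"]
    by (simp add: cip_axis_right axis_nth)
  have "(\<Sum>i\<in>{i. pos i < m}. \<Sum>j<r. cnj (v j $ i) * v j $ i) = (\<Sum>j<r. cip (v j) (v j))"
    unfolding cip_def
    by (subst sum.swap, intro sum.cong refl sum.mono_neutral_left)
      (use v(1) in \<open>auto simp: corner_space_def\<close>)
  then have "of_nat m = (of_nat r :: complex)"
    using m by (simp add: one ort card_pos_less)
  then have r: "r = m" by (simp only: of_nat_eq_iff)
  \<comment> \<open>The permutation that puts the eigenvalues into nondecreasing order.\<close>
  define p where "p j = sort_key l [0..<m] ! j" for j
  have p: "bij_betw p {..<m} {..<m}"
  proof -
    have "bij_betw (\<lambda>j. sort_key l [0..<m] ! j) {..<length (sort_key l [0..<m])} (set (sort_key l [0..<m]))"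
      by (rule bij_betw_nth) auto
    then show ?thesis by (simp add: p_def[abs_def] atLeast0LessThan)
  qed
  have pm: "p j < m" if "j < m" for j using p that by (auto simp: bij_betw_def)
  have pinj: "p i = p j \<longleftrightarrow> i = j" if "i < m" "j < m" for i j
    using p that by (auto simp: bij_betw_def inj_on_def)
  have "eigenbasis m (cut m H) (v \<circ> p) (l \<circ> p)"
    unfolding eigenbasis_def
  proof (intro conjI allI impI ballI)
    fix w :: "(complex, 'n) vec" assume "w \<in> corner_space m"
    then have "w = (\<Sum>j<m. cip (v j) w *s v j)" by (rule compl[unfolded r])
    also have "\<dots> = (\<Sum>j<m. cip ((v \<circ> p) j) w *s (v \<circ> p) j)"
      using sum.reindex_bij_betw[OF p, of "\<lambda>j. cip (v j) w *s v j"] by simp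
    finally show "w = (\<Sum>j<m. cip ((v \<circ> p) j) w *s (v \<circ> p) j)" .
  next
    fix i j assume "i \<le> j" "j < m"
    then show "(l \<circ> p) i \<le> (l \<circ> p) j"
      using sorted_nth_mono[OF sorted_sort_key[of l "[0..<m]"], of i j] by (simp add: p_def)
  qed (use v ort r pm pinj in auto)
  then show thesis using that by blast
qed

text \<open>Both formulas are the expansion of \<open>axis k 1\<close> in the eigenbasis, the second
  one after applying \<open>H\<close>.\<close>

lemma eigenbasis_resolution:
  assumes e: "eigenbasis m H v l" and k: "pos k < m"
  shows "(\<Sum>j<m. v j $ i * cnj (v j $ k)) = (if i = k then 1 else 0)"
    and "(\<Sum>j<m. of_real (l j) * (v j $ i * cnj (v j $ k))) = H $ i $ k"
proof -
  have ax: "axis k 1 = (\<Sum>j<m. cnj (v j $ k) *s v j)"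
    using eigenbasisD(4)[OF e axis_in_corner_space[OF k, of 1]] unfolding cip_axis_right .
  show "(\<Sum>j<m. v j $ i * cnj (v j $ k)) = (if i = k then 1 else 0)"
    using arg_cong[OF ax, of "\<lambda>w. w $ i"] by (simp add: axis_nth mult.commute)
  have "H *v axis k 1 = (\<Sum>j<m. cnj (v j $ k) *s (H *v v j))"
    by (subst ax) (simp add: mv_simps)
  also have "\<dots> = (\<Sum>j<m. cnj (v j $ k) *s (of_real (l j) *s v j))"
    by (intro sum.cong refl) (simp add: eigenbasisD(2)[OF e])
  finally have "(H *v axis k 1) $ i = (\<Sum>j<m. of_real (l j) * (v j $ i * cnj (v j $ k)))"
    by (simp add: mult_ac)
  then show "(\<Sum>j<m. of_real (l j) * (v j $ i * cnj (v j $ k))) = H $ i $ k"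
    by (simp add: matrix_vector_mult_def axis_def if_distrib cong: if_cong)
qed

section \<open>Characteristic polynomials of corners\<close>

definition herm :: "('n::finite) cmat \<Rightarrow> 'n cmat" where
  "herm x = (\<chi> i j. - \<i> * x $ i $ j)"

lemma herm_nth [simp]: "herm x $ i $ j = - \<i> * x $ i $ j"
  by (simp add: herm_def)

lemma cadj_herm: "cadj x = - x \<Longrightarrow> cadj (herm x) = herm x"
  by (auto simp: vec_eq_iff)

text \<open>The bridge between padded corners and the matrices of \<open>corner\<close>: the
  eigenvectors as columns form a unitary matrix of size \<open>m\<close> that diagonalizes the
  corner, and similar matrices have equal characteristic polynomials.\<close>

lemma char_poly_corner:
  fixes x :: "('n::{finite,linorder}) cmat"
  assumes m: "m \<le> CARD('n)" and e: "eigenbasis m (cut m (herm x)) v l"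
  shows "char_poly (corner m x) = (\<Prod>l\<leftarrow>map l [0..<m]. [: - (\<i> * complex_of_real l), 1 :])"
proof -
  let ?V = "Matrix.mat m m (\<lambda>(i,j). v j $ (at_pos i :: 'n))"
  let ?W = "Matrix.mat m m (\<lambda>(i,j). cnj (v i $ (at_pos j :: 'n)))"
  let ?D = "Matrix.mat m m (\<lambda>(i,j). if i = j then \<i> * complex_of_real (l i) else 0)"
  have posm: "pos (at_pos a :: 'n) = a" if "a < m" for a using that m by simp
  have inj: "(at_pos a :: 'n) = at_pos b \<longleftrightarrow> a = b" if "a < m" "b < m" for a b
    using that posm by metis
  have "?V * ?W = 1\<^sub>m m"
  proof (rule eq_matI)
    fix a b assume "a < dim_row (1\<^sub>m m)" "b < dim_col (1\<^sub>m m)"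
    then show "(?V * ?W) $$ (a, b) = 1\<^sub>m m $$ (a, b)"
      using eigenbasis_resolution(1)[OF e, of "at_pos b" "at_pos a"] posm inj
      by (simp add: scalar_prod_def atLeast0LessThan)
  qed auto
  moreover have "?W * ?V = 1\<^sub>m m"
  proof (rule eq_matI)
    fix a b assume "a < dim_row (1\<^sub>m m)" "b < dim_col (1\<^sub>m m)"
    then have ab: "a < m" "b < m" by auto
    have z: "v b $ i = 0" if "\<not> pos i < m" for i
      using eigenbasisD(1)[OF e ab(2)] that by (simp add: corner_space_def)
    have "(\<Sum>c<m. cnj (v a $ (at_pos c :: 'n)) * v b $ (at_pos c :: 'n)) =
        (\<Sum>c<CARD('n). cnj (v a $ (at_pos c :: 'n)) * v b $ (at_pos c :: 'n))"
      using m by (intro sum.mono_neutral_left) (auto simp: z)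
    also have "\<dots> = cip (v a) (v b)"
      unfolding cip_def by (subst sum_pos[symmetric]) simp
    finally show "(?W * ?V) $$ (a, b) = 1\<^sub>m m $$ (a, b)"
      using ab by (simp add: scalar_prod_def atLeast0LessThan eigenbasisD(3)[OF e])
  qed auto
  moreover have "corner m x = ?V * ?D * ?W"
  proof (rule eq_matI)
    fix a b assume "a < dim_row (?V * ?D * ?W)" "b < dim_col (?V * ?D * ?W)"
    then have ab: "a < m" "b < m" by auto
    have VD: "(?V * ?D) $$ (a, c) = v c $ (at_pos a :: 'n) * (\<i> * of_real (l c))" if "c < m" for c
      using ab that by (simp add: scalar_prod_def atLeast0LessThan if_distrib cong: if_cong)
    have "(?V * ?D * ?W) $$ (a, b) = (\<Sum>c<m. (?V * ?D) $$ (a, c) * ?W $$ (c, b))"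
      using ab by (simp add: scalar_prod_def atLeast0LessThan)
    also have "\<dots> = \<i> * (\<Sum>c<m. of_real (l c) * (v c $ (at_pos a :: 'n) * cnj (v c $ (at_pos b :: 'n))))"
      unfolding sum_distrib_left using ab by (intro sum.cong refl) (simp only: VD lessThan_iff, simp)
    also have "\<dots> = \<i> * cut m (herm x) $ (at_pos a) $ (at_pos b)"
      using eigenbasis_resolution(2)[OF e, of "at_pos b" "at_pos a"] posm ab by simp
    also have "\<dots> = corner m x $$ (a, b)"
      using ab posm by (simp add: corner_def at_pos_def[symmetric])
    finally show "corner m x $$ (a, b) = (?V * ?D * ?W) $$ (a, b)" by simp
  qed (auto simp: corner_def)
  ultimately have "similar_mat (corner m x) ?D"
    by (intro similar_matI[where P = ?V and Q = ?W and n = m]) (auto simp: corner_def)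
  then have "char_poly (corner m x) = char_poly ?D" by (rule char_poly_similar)
  also have "\<dots> = (\<Prod>a\<leftarrow>diag_mat ?D. [:- a, 1:])"
    by (rule char_poly_upper_triangular[of _ m]) auto
  also have "diag_mat ?D = map (\<lambda>l. \<i> * complex_of_real l) (map l [0..<m])"
    by (auto simp: diag_mat_def)
  finally show ?thesis by (simp add: o_def)
qed

text \<open>The product determines the multiset of its roots, imaginary parts recover the list up to
  order, and sortedness fixes the order. This is the uniqueness behind the definite description in
  \<open>gt_list\<close>.\<close>

lemma prod_list_linear_eq_imp_sorted_eq:
  assumes "sorted ls" "sorted ls'"
    and "(\<Prod>l\<leftarrow>ls. [: - (\<i> * complex_of_real l), 1 :]) = (\<Prod>l\<leftarrow>ls'. [: - (\<i> * complex_of_real l), 1 :])"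
  shows "ls = ls'"
proof -
  have "proots (\<Prod>l\<leftarrow>ls. [: - (\<i> * complex_of_real l), 1 :]) = image_mset (\<lambda>l. \<i> * complex_of_real l) (mset ls)"
    for ls
  proof (induction ls)
    case (Cons a ls)
    have nz: "(\<Prod>l\<leftarrow>ls. [: - (\<i> * complex_of_real l), 1 :]) \<noteq> 0"
      by (auto simp: prod_list_zero_iff)
    then show ?case
      using Cons proots_mult[OF _ nz, of "[: - (\<i> * complex_of_real a), 1 :]"]
      by (simp del: mult_pCons_left)
  qed simp
  then have "image_mset (\<lambda>l. \<i> * complex_of_real l) (mset ls) = image_mset (\<lambda>l. \<i> * complex_of_real l) (mset ls')"
    using assms(3) by metis
  then have "image_mset Im (image_mset (\<lambda>l. \<i> * complex_of_real l) (mset ls)) =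
      image_mset Im (image_mset (\<lambda>l. \<i> * complex_of_real l) (mset ls'))" by simp
  then have "mset ls = mset ls'" by (simp add: multiset.map_comp o_def)
  then show ?thesis using assms by (metis properties_for_sort)
qed

lemma gt_list_eq:
  fixes x :: "('n::{finite,linorder}) cmat"
  assumes e: "eigenbasis (CARD('n) - s) (cut (CARD('n) - s) (herm x)) v l"
  shows "gt_list s x = map l [0..<CARD('n) - s]"
  unfolding gt_list_def
proof (rule the_equality)
  have s: "sorted (map l [0..<CARD('n) - s])"
    using eigenbasisD(5)[OF e] by (auto simp: sorted_iff_nth_mono)
  note c = char_poly_corner[OF diff_le_self e]
  show "sorted (map l [0..<CARD('n) - s]) \<and> char_poly (corner (CARD('n) - s) x) =
      (\<Prod>l\<leftarrow>map l [0..<CARD('n) - s]. [: - (\<i> * complex_of_real l), 1 :])"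
    using s c by blast
  show "ls = map l [0..<CARD('n) - s]" if "sorted ls \<and> char_poly (corner (CARD('n) - s) x) =
      (\<Prod>l\<leftarrow>ls. [: - (\<i> * complex_of_real l), 1 :])" for ls
    using that s c prod_list_linear_eq_imp_sorted_eq by metis
qed

lemma gt_eq:
  fixes x :: "('n::{finite,linorder}) cmat"
  assumes "eigenbasis (CARD('n) - s) (cut (CARD('n) - s) (herm x)) v l" "1 \<le> j" "j \<le> CARD('n) - s"
  shows "gt s j x = l (j - 1)"
  using assms by (auto simp: gt_def gt_list_eq)

section \<open>Comparison of eigenvalues\<close>

text \<open>For the zero operator the generalized eigenspace of 0 is everything, so the count for
  diagonal operators specializes to this.\<close>

lemma dim_span_orthonormal:
  fixes b :: "'i \<Rightarrow> 'a::euclidean_space"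
  assumes "finite I" "\<And>i j. i \<in> I \<Longrightarrow> j \<in> I \<Longrightarrow> b i \<bullet> b j = (if i = j then 1 else 0)"
  shows "dim (span (b ` I)) = card I"
  using dim_generalized_eigenspace_diagonal[of I "\<lambda>_. 0" b "\<lambda>_. 0" 0] assms
    generalized_eigenspace_scalar[of "span (b ` I)" "\<lambda>_. 0" 0 0]
  by (simp add: linear_zero)

section \<open>Complex spans and their real dimension\<close>

definition cspan :: "(nat \<Rightarrow> complex^'n) \<Rightarrow> nat set \<Rightarrow> (complex^'n) set" where
  "cspan v I = range (\<lambda>c. \<Sum>i\<in>I. c i *s v i)"

lemma cspanI: "u = (\<Sum>i\<in>I. c i *s v i) \<Longrightarrow> u \<in> cspan v I"
  unfolding cspan_def image_def by blast

lemma smult_simps: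
  "(a + b) *s v = a *s v + b *s (v :: complex^'n)" "a *s (v + w) = a *s v + a *s w"
  "a *s (b *s v) = (a * b) *s v" "(0::complex) *s v = 0" "a *s (0 :: complex^'n) = 0"
  "(1::complex) *s v = v" "a *s (\<Sum>i\<in>I. f i) = (\<Sum>i\<in>I. a *s f i)"
  "r *\<^sub>R (a *s v) = (r *\<^sub>R a) *s v"
  by (simp_all add: vec_eq_iff algebra_simps sum_distrib_left)

lemma csubspace_cspan: "csubspace (cspan v I)"
  unfolding csubspace_def
proof (intro conjI ballI allI)
  show "0 \<in> cspan v I" unfolding cspan_def by (rule range_eqI[of _ _ "\<lambda>_. 0"]) (simp add: smult_simps)
next
  fix x y assume "x \<in> cspan v I" "y \<in> cspan v I"
  then obtain c d where "x = (\<Sum>i\<in>I. c i *s v i)" "y = (\<Sum>i\<in>I. d i *s v i)" by (auto simp: cspan_def)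
  then have "x + y = (\<Sum>i\<in>I. (c i + d i) *s v i)" by (simp add: smult_simps sum.distrib)
  then show "x + y \<in> cspan v I" by (rule cspanI)
next
  fix a x assume "x \<in> cspan v I"
  then obtain c where "x = (\<Sum>i\<in>I. c i *s v i)" by (auto simp: cspan_def)
  then have "a *s x = (\<Sum>i\<in>I. (a * c i) *s v i)" by (simp add: smult_simps)
  then show "a *s x \<in> cspan v I" by (rule cspanI)
qed

text \<open>A real basis of a complex span; the Boolean component marks the factor
  \<open>\<i>\<close>.\<close>

definition cbasis :: "(nat \<Rightarrow> complex^'n) \<Rightarrow> nat \<times> bool \<Rightarrow> complex^'n" where
  "cbasis v p = (if snd p then \<i> else 1) *s v (fst p)"

lemma cbasis_orthonormal:
  assumes "\<And>i j. i \<in> I \<Longrightarrow> j \<in> I \<Longrightarrow> cip (v i) (v j) = (if i = j then 1 else 0)"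
    and "p \<in> I \<times> UNIV" "q \<in> I \<times> UNIV"
  shows "cbasis v p \<bullet> cbasis v q = (if p = q then 1 else 0)"
  using assms by (cases p; cases q) (auto simp: cbasis_def inner_eq_Re_cip)

lemma span_cbasis:
  assumes I: "finite I"
  shows "span (cbasis v ` (I \<times> UNIV)) = cspan v I"
proof
  show "span (cbasis v ` (I \<times> UNIV)) \<subseteq> cspan v I"
  proof (rule span_minimal)
    show "cbasis v ` (I \<times> UNIV) \<subseteq> cspan v I"
    proof clarsimp
      fix j e assume j: "j \<in> I"
      have "cbasis v (j, e) = (\<Sum>i\<in>I. (if i = j then (if e then \<i> else 1) else 0) *s v i)"
        using I j by (simp add: cbasis_def if_distrib[of "\<lambda>c. c *s _"] smult_simps cong: if_cong)
      then show "cbasis v (j, e) \<in> cspan v I" by (rule cspanI)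
    qed
  qed (rule csubspace_imp_subspace[OF csubspace_cspan])
  show "cspan v I \<subseteq> span (cbasis v ` (I \<times> UNIV))"
  proof
    fix x assume "x \<in> cspan v I"
    then obtain c where c: "x = (\<Sum>i\<in>I. c i *s v i)" by (auto simp: cspan_def)
    have "c i *s v i = Re (c i) *\<^sub>R cbasis v (i, False) + Im (c i) *\<^sub>R cbasis v (i, True)" for i
      by (simp add: cbasis_def smult_simps vec_eq_iff complex_eq_iff)
    moreover have "cbasis v (i, e) \<in> span (cbasis v ` (I \<times> UNIV))" if "i \<in> I" for i e
      using that by (intro span_base imageI) auto
    ultimately show "x \<in> span (cbasis v ` (I \<times> UNIV))"
      unfolding c by (auto intro!: span_sum span_add span_scale)
  qed
qed

lemma dim_cspan:
  assumes "finite I" "\<And>i j. i \<in> I \<Longrightarrow> j \<in> I \<Longrightarrow> cip (v i) (v j) = (if i = j then 1 else 0)"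
  shows "dim (cspan v I) = 2 * card I"
proof -
  have "dim (span (cbasis v ` (I \<times> UNIV))) = card (I \<times> (UNIV :: bool set))"
  proof (rule dim_span_orthonormal)
    show "cbasis v p \<bullet> cbasis v q = (if p = q then 1 else 0)"
      if "p \<in> I \<times> UNIV" "q \<in> I \<times> UNIV" for p q
      by (rule cbasis_orthonormal[OF assms(2) that])
  qed (simp add: assms(1))
  then show ?thesis using assms by (simp add: span_cbasis card_cartesian_product)
qed

lemma corner_space_eq_cspan: "eigenbasis m H v l \<Longrightarrow> corner_space m = cspan v {..<m}"
proof
  assume e: "eigenbasis m H v l"
  show "corner_space m \<subseteq> cspan v {..<m}"
  proof
    fix w :: "(complex, 'a) vec" assume "w \<in> corner_space m"
    from eigenbasisD(4)[OF e this] show "w \<in> cspan v {..<m}"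
      by (rule cspanI)
  qed
  have "v i \<in> corner_space m" if "i < m" for i using e that by (rule eigenbasisD)
  then show "cspan v {..<m} \<subseteq> corner_space m"
    by (auto simp: cspan_def corner_space_def)
qed

lemma dim_corner_space:
  assumes "m \<le> CARD('n::{finite,linorder})"
  shows "dim (corner_space m :: (complex, 'n) vec set) = 2 * m"
proof -
  have "cadj (0 :: 'n cmat) = 0" by (simp add: vec_eq_iff)
  from eigenbasis_exists[OF this assms] obtain v l where e: "eigenbasis m (cut m (0 :: 'n cmat)) v l"
    by blast
  show ?thesis
    unfolding corner_space_eq_cspan[OF e] using dim_cspan[of "{..<m}" v] eigenbasisD(3)[OF e] by simp
qed

section \<open>Comparison of eigenvalues by dimension counts\<close>

text \<open>The weights \<open>c i\<close> are the squared moduli of the coefficients of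
  \<open>u\<close>, so the quadratic form is a weighted sum of the eigenvalues with total weight
  \<open>u \<bullet> u\<close>.\<close>

lemma rayleigh_quotient:
  fixes v :: "nat \<Rightarrow> complex^'n"
  assumes ort: "\<And>i j. i \<in> I \<Longrightarrow> j \<in> I \<Longrightarrow> cip (v i) (v j) = (if i = j then 1 else 0)"
    and e: "\<And>i. i \<in> I \<Longrightarrow> A *v v i = of_real (l i) *s v i" and u: "u \<in> cspan v I" and I: "finite I"
  obtains c where "u \<bullet> u = (\<Sum>i\<in>I. c i)" "u \<bullet> (A *v u) = (\<Sum>i\<in>I. l i * c i)" "\<forall>i. (c i :: real) \<ge> 0"
proof -
  obtain a where a: "u = (\<Sum>i\<in>I. a i *s v i)" using u by (auto simp: cspan_def)
  have Au: "A *v u = (\<Sum>i\<in>I. (a i * of_real (l i)) *s v i)"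
    unfolding a mv_simps by (intro sum.cong refl) (simp add: e smult_simps)
  have ip: "cip u (\<Sum>i\<in>I. b i *s v i) = (\<Sum>i\<in>I. cnj (a i) * b i)" for b
  proof -
    have "cip u (\<Sum>i\<in>I. b i *s v i) = (\<Sum>j\<in>I. b j * (\<Sum>i\<in>I. cnj (a i) * cip (v i) (v j)))"
      by (simp add: a)
    also have "\<dots> = (\<Sum>j\<in>I. b j * (\<Sum>i\<in>I. if i = j then cnj (a i) else 0))"
      by (intro sum.cong refl arg_cong2[of _ _ _ _ "(*)"]) (simp add: ort)
    also have "\<dots> = (\<Sum>i\<in>I. cnj (a i) * b i)" using I by (simp add: mult.commute)
    finally show ?thesis .
  qed
  have "cip u u = (\<Sum>i\<in>I. cnj (a i) * a i)" using ip[of a] unfolding a[symmetric] .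
  then have "u \<bullet> u = (\<Sum>i\<in>I. (cmod (a i))\<^sup>2)"
    by (simp add: inner_eq_Re_cip cmod_power2) (simp add: power2_eq_square)
  moreover have "u \<bullet> (A *v u) = (\<Sum>i\<in>I. l i * (cmod (a i))\<^sup>2)"
    unfolding inner_eq_Re_cip Au ip by (simp add: cmod_power2) (simp add: power2_eq_square algebra_simps)
  ultimately show thesis using that[of "\<lambda>i. (cmod (a i))\<^sup>2"] by simp
qed

text \<open>Two spans of complex dimensions adding up to more than \<open>m\<close> share a nonzero vector.\<close>

lemma eigenvalue_comparison:
  fixes v w :: "nat \<Rightarrow> (complex, 'n::{finite,linorder}) vec"
  assumes m: "m \<le> CARD('n)" and IJ: "finite I" "finite J" "card I + card J > m"
    and v: "\<And>i. i \<in> I \<Longrightarrow> v i \<in> corner_space m" "\<And>i. i \<in> I \<Longrightarrow> A *v v i = of_real (l i) *s v i"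
      "\<And>i j. i \<in> I \<Longrightarrow> j \<in> I \<Longrightarrow> cip (v i) (v j) = (if i = j then 1 else 0)"
      "\<And>i. i \<in> I \<Longrightarrow> \<alpha> \<le> l i"
    and w: "\<And>i. i \<in> J \<Longrightarrow> w i \<in> corner_space m" "\<And>i. i \<in> J \<Longrightarrow> B *v w i = of_real (l' i) *s w i"
      "\<And>i j. i \<in> J \<Longrightarrow> j \<in> J \<Longrightarrow> cip (w i) (w j) = (if i = j then 1 else 0)"
      "\<And>i. i \<in> J \<Longrightarrow> l' i \<le> \<beta>"
    and AB: "\<And>u. u \<in> cspan v I \<Longrightarrow> u \<in> cspan w J \<Longrightarrow> u \<bullet> (A *v u) \<le> u \<bullet> (B *v u) + \<epsilon> * (u \<bullet> u)"
  shows "\<alpha> \<le> \<beta> + \<epsilon>"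
proof -
  have S: "subspace (cspan v I)" "subspace (cspan w J)"
    by (rule csubspace_imp_subspace[OF csubspace_cspan])+
  have C: "subspace (corner_space m :: (complex, 'n) vec set)"
    by (rule csubspace_imp_subspace[OF csubspace_corner_space])
  have sub: "cspan v I \<subseteq> corner_space m" "cspan w J \<subseteq> corner_space m"
    using v(1) w(1) by (auto simp: cspan_def corner_space_def)
  have "{x + y |x y. x \<in> cspan v I \<and> y \<in> cspan w J} \<subseteq> corner_space m"
  proof
    fix z assume "z \<in> {x + y |x y. x \<in> cspan v I \<and> y \<in> cspan w J}"
    then obtain x y where z: "z = x + y" "x \<in> cspan v I" "y \<in> cspan w J" by auto
    show "z \<in> corner_space m"
      unfolding z(1) using z(2,3) sub by (intro subspace_add[OF C]) auto
  qed
  from dim_subset[OF this] have "dim {x + y |x y. x \<in> cspan v I \<and> y \<in> cspan w J} \<le> 2 * m"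
    using dim_corner_space[OF m] by simp
  moreover have "dim (cspan v I) = 2 * card I" "dim (cspan w J) = 2 * card J"
    using IJ v(3) w(3) by (auto intro!: dim_cspan)
  ultimately have "dim (cspan v I \<inter> cspan w J) \<noteq> 0"
    using dim_sums_Int[OF S] IJ by linarith
  then obtain u where u: "u \<in> cspan v I" "u \<in> cspan w J" "u \<noteq> 0" unfolding dim_eq_0 by blast
  obtain c where c: "u \<bullet> u = (\<Sum>i\<in>I. c i)" "u \<bullet> (A *v u) = (\<Sum>i\<in>I. l i * c i)" "\<forall>i. c i \<ge> 0"
    by (rule rayleigh_quotient[OF v(3) v(2) u(1) IJ(1)]; (assumption | (rule that; assumption)))
  obtain d where d: "u \<bullet> u = (\<Sum>i\<in>J. d i)" "u \<bullet> (B *v u) = (\<Sum>i\<in>J. l' i * d i)" "\<forall>i. d i \<ge> 0"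
    by (rule rayleigh_quotient[OF w(3) w(2) u(2) IJ(2)]; (assumption | (rule that; assumption)))
  \<comment> \<open>Seen from \<open>I\<close>, the common vector averages eigenvalues that are at
    least \<open>\<alpha>\<close>; seen from \<open>J\<close>, eigenvalues that are at most
    \<open>\<beta>\<close>.\<close>
  have "\<alpha> * (u \<bullet> u) \<le> u \<bullet> (A *v u)"
    unfolding c(2) unfolding c(1) sum_distrib_left by (intro sum_mono mult_right_mono v(4) c(3)[rule_format])
  also have "\<dots> \<le> u \<bullet> (B *v u) + \<epsilon> * (u \<bullet> u)" using u AB by blast
  also have "u \<bullet> (B *v u) \<le> \<beta> * (u \<bullet> u)"
    unfolding d(2) unfolding d(1) sum_distrib_left by (intro sum_mono mult_right_mono w(4) d(3)[rule_format])
  finally have "\<alpha> * (u \<bullet> u) \<le> (\<beta> + \<epsilon>) * (u \<bullet> u)" by (simp add: algebra_simps)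
  then show ?thesis using u(3) by simp
qed

lemma cut_quadratic_form:
  assumes "u \<in> corner_space m" "m \<le> m'"
  shows "u \<bullet> (cut m' H *v u) = u \<bullet> (cut m H *v u)"
proof -
  have z: "u $ i = 0" if "\<not> pos i < m" for i using assms(1) that by (simp add: corner_space_def)
  have "u $ i \<bullet> ((cut m' H *v u) $ i) = u $ i \<bullet> ((cut m H *v u) $ i)" for i
  proof (cases "pos i < m")
    case True
    have "(cut m' H *v u) $ i = (cut m H *v u) $ i"
      unfolding matrix_vector_mult_def using True assms(2) z
      by (auto intro!: sum.cong simp: if_distrib)
    then show ?thesis by simp
  qed (simp add: z)
  then show ?thesis by (simp add: inner_vec_def)
qed

text \<open>On vectors supported in the smaller corner both quadratic forms agree, so the comparison
  applies with error 0. In each case the two index sets have \<open>m + 2\<close> elements together,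
  one more than the dimension \<open>m + 1\<close> of the larger corner.\<close>

lemma cauchy_interlacing:
  fixes H :: "('n::{finite,linorder}) cmat"
  assumes m: "Suc m \<le> CARD('n)" and i: "i < m"
    and v: "eigenbasis (Suc m) (cut (Suc m) H) v l" and w: "eigenbasis m (cut m H) w l'"
  shows "l i \<le> l' i" "l' i \<le> l (Suc i)"
proof -
  have wS: "w j \<in> corner_space (Suc m)" if "j < m" for j
    using eigenbasisD(1)[OF w that] corner_space_mono[of m "Suc m"] by auto
  have cw: "cspan w J \<subseteq> corner_space m" if "J \<subseteq> {..<m}" for J
    using eigenbasisD(1)[OF w] that unfolding cspan_def corner_space_def
    by (auto intro!: sum.neutral simp: subset_iff)
  note D = eigenbasisD[OF v] and E = eigenbasisD[OF w]
  have "l i \<le> l' i + 0"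
  proof (rule eigenvalue_comparison[OF m, of "{i..m}" "{..i}" v _ l "l i" w _ l'])
    show "u \<bullet> (cut (Suc m) H *v u) \<le> u \<bullet> (cut m H *v u) + 0 * (u \<bullet> u)" if "u \<in> cspan w {..i}" for u
    proof -
      have "{..i} \<subseteq> {..<m}" using i by auto
      then have "u \<in> corner_space m" using cw that by blast
      then show ?thesis using cut_quadratic_form[of u m "Suc m" H] by simp
    qed
  qed (use i D E wS in auto)
  then show "l i \<le> l' i" by simp
  have "l' i \<le> l (Suc i) + 0"
  proof (rule eigenvalue_comparison[OF m, of "{i..<m}" "{..Suc i}" w _ l' "l' i" v _ l])
    show "u \<bullet> (cut m H *v u) \<le> u \<bullet> (cut (Suc m) H *v u) + 0 * (u \<bullet> u)" if "u \<in> cspan w {i..<m}" for u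
    proof -
      have "{i..<m} \<subseteq> {..<m}" by auto
      then have "u \<in> corner_space m" using cw that by blast
      then show ?thesis using cut_quadratic_form[of u m "Suc m" H] by simp
    qed
  qed (use i D E wS in auto)
  then show "l' i \<le> l (Suc i)" by simp
qed

lemma mv_norm_bound: "\<exists>K>0. \<forall>A u. norm ((A :: complex^'n^'m) *v u) \<le> norm A * norm u * K"
proof -
  have "bilinear (\<lambda>(A :: complex^'n^'m) u. A *v u)"
    unfolding bilinear_def
    by (auto intro!: linearI simp: mv_simps vec_eq_iff matrix_vector_mult_def sum.distrib algebra_simps
        scaleR_sum_right)
  then have "bounded_bilinear (\<lambda>(A :: complex^'n^'m) u. A *v u)"
    by (simp add: bilinear_conv_bounded_bilinear)
  then show ?thesis by (metis bounded_bilinear.pos_bounded)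
qed

lemma matrix_vector_diff: "(A - B) *v u = A *v u - B *v (u :: complex^'n)"
  by (simp add: vec_eq_iff matrix_vector_mult_def algebra_simps sum_subtractf)

text \<open>Weyl's perturbation inequality: the quadratic forms of two corners differ by at most
  \<open>K * norm (x - y)\<close> times \<open>u \<bullet> u\<close>, and the index sets
  \<open>{j-1..<?m}\<close> and \<open>{..j-1}\<close> overlap. It gives continuity of the
  Gelfand-Tsetlin variables and allows limits of realized patterns.\<close>

lemma gt_lipschitz:
  fixes x :: "('n::{finite,linorder}) cmat"
  shows "\<exists>K. \<forall>(x :: ('n::{finite,linorder}) cmat) y. cadj x = - x \<longrightarrow> cadj y = - y \<longrightarrow>
    (\<forall>s j. 1 \<le> j \<longrightarrow> j \<le> CARD('n) - s \<longrightarrow> \<bar>gt s j x - gt s j y\<bar> \<le> K * norm (x - y))"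
proof -
  obtain K where K: "K > 0" "\<And>(A :: 'n cmat) u. norm (A *v u) \<le> norm A * norm u * K"
    using mv_norm_bound by blast
  have "gt s j x \<le> gt s j y + K * norm (x - y)"
    if xy: "cadj x = - x" "cadj y = - y" and j: "1 \<le> j" "j \<le> CARD('n) - s" for x y :: "'n cmat" and s j
  proof -
    let ?m = "CARD('n) - s"
    obtain v l where v: "eigenbasis ?m (cut ?m (herm x)) v l"
      using eigenbasis_exists[OF cadj_herm[OF xy(1)] diff_le_self] by blast
    obtain w l' where w: "eigenbasis ?m (cut ?m (herm y)) w l'"
      using eigenbasis_exists[OF cadj_herm[OF xy(2)] diff_le_self] by blast
    note D = eigenbasisD[OF v] and E = eigenbasisD[OF w]
    have q: "u \<bullet> (cut ?m (herm x) *v u) \<le> u \<bullet> (cut ?m (herm y) *v u) + K * norm (x - y) * (u \<bullet> u)" for u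
    proof -
      have "u \<bullet> (cut ?m (herm x) *v u) - u \<bullet> (cut ?m (herm y) *v u) = u \<bullet> (cut ?m (herm (x - y)) *v u)"
        unfolding inner_diff_right[symmetric] matrix_vector_diff[symmetric]
        by (intro arg_cong[of _ _ "\<lambda>A. u \<bullet> (A *v u)"]) (auto simp: vec_eq_iff algebra_simps)
      also have "\<dots> \<le> norm u * norm (cut ?m (herm (x - y)) *v u)"
        by (rule norm_cauchy_schwarz)
      also have "\<dots> \<le> norm u * (norm (cut ?m (herm (x - y))) * norm u * K)"
        by (intro mult_left_mono K) simp
      also have "\<dots> \<le> norm u * (norm (x - y) * norm u * K)"
      proof (intro mult_left_mono mult_right_mono)
        show "norm (cut ?m (herm (x - y))) \<le> norm (x - y)"
          by (intro norm_le_componentwise_cart) (auto simp: norm_mult intro!: norm_le_componentwise_cart)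
      qed (use K in auto)
      finally show ?thesis by (simp add: power2_norm_eq_inner[symmetric] power2_eq_square mult_ac)
    qed
    have "l (j - 1) \<le> l' (j - 1) + K * norm (x - y)"
    proof (rule eigenvalue_comparison[OF diff_le_self[of _ s], of "{j-1..<?m}" "{..j-1}" v _ l "l (j-1)" w _ l' _ "K * norm (x - y)"])
      show "u \<bullet> (cut ?m (herm x) *v u) \<le> u \<bullet> (cut ?m (herm y) *v u) + K * norm (x - y) * (u \<bullet> u)" for u
        by (rule q)
    qed (use j D E in auto)
    then show ?thesis using gt_eq[OF v j] gt_eq[OF w j] by simp
  qed
  note le = this
  have "\<bar>gt s j x - gt s j y\<bar> \<le> K * norm (x - y)"
    if "cadj x = - x" "cadj y = - y" "1 \<le> j" "j \<le> CARD('n) - s" for x y :: "'n cmat" and s j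
    using le[of x y j s] le[of y x j s] that by (simp add: norm_minus_commute abs_le_iff)
  then show ?thesis by blast
qed

section \<open>Realization of interlacing patterns\<close>

lemma interlacing_order:
  fixes p q :: "nat \<Rightarrow> real"
  assumes int: "\<And>i. i < m \<Longrightarrow> q i < p i \<and> p i < q (Suc i)"
  shows "i \<le> j \<Longrightarrow> j < m \<Longrightarrow> q i < p j" "j < i \<Longrightarrow> i \<le> m \<Longrightarrow> p j < q i"
    "i < j \<Longrightarrow> j \<le> m \<Longrightarrow> q i < q j" "i < j \<Longrightarrow> j < m \<Longrightarrow> p i < p j"
proof -
  have le: "q i \<le> q j" if "i \<le> j" "j \<le> m" for i j
    using that
  proof (induction rule: dec_induct)
    case (step k)
    then show ?case using int[of k] by simp
  qed simp
  show 1: "q i < p j" if "i \<le> j" "j < m" for i j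
    using le[OF that(1)] int[OF that(2)] that by auto
  show 2: "p j < q i" if "j < i" "i \<le> m" for i j
    using le[of "Suc j" i] int[of j] that by auto
  show "q i < q j" if "i < j" "j \<le> m" for i j
    using int[of i] 2[of i j] that by auto
  show "p i < p j" if "i < j" "j < m" for i j
    using 2[of i j] int[of j] that by auto
qed

lemma degree_prod_linear:
  fixes q :: "nat \<Rightarrow> real"
  shows "finite A \<Longrightarrow> degree (\<Prod>i\<in>A. [:- q i, 1:]) = card A"
  by (subst degree_prod_eq_sum_degree) auto

lemma coeff_prod_linear:
  fixes q :: "nat \<Rightarrow> real"
  assumes "finite A" shows "coeff (\<Prod>i\<in>A. [:- q i, 1:]) (card A) = 1"
  using lead_coeff_prod[of "\<lambda>i. [:- q i, 1:]" A] degree_prod_linear[OF assms, of q] by simp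

text \<open>
  The secular function \<open>t - d - \<Sum> a j / (t - p j)\<close> can be given the prescribed zeros \<open>q i\<close>;
  interlacing makes the residues positive.
\<close>

lemma partial_fractions_interlacing:
  fixes p q :: "nat \<Rightarrow> real"
  assumes int: "\<And>i. i < m \<Longrightarrow> q i < p i \<and> p i < q (Suc i)"
  obtains a d where "\<forall>j<m. 0 < a j" "\<forall>i\<le>m. q i - d = (\<Sum>j<m. a j / (q i - p j))"
proof -
  note ord = interlacing_order[of m q p, OF int]
  define Q where "Q = (\<Prod>i\<in>{..m}. [:- q i, 1:])"
  define W where "W = (\<Prod>j\<in>{..<m}. [:- p j, 1:])"
  define Wj where "Wj j = (\<Prod>i\<in>{..<m} - {j}. [:- p i, 1:])" for j
  \<comment> \<open>The residues at the poles \<open>p j\<close>; the value of \<open>Wj j\<close>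
    at \<open>p j\<close> is the derivative of \<open>W\<close> there.\<close>
  define a where "a j = - poly Q (p j) / poly (Wj j) (p j)" for j
  \<comment> \<open>In \<open>R\<close> the terms of degree \<open>m + 1\<close> cancel, and the
    choice of \<open>a\<close> makes it vanish at every \<open>p j\<close>. With \<open>d\<close>
    chosen so that \<open>R + d W\<close> vanishes at \<open>q 0\<close> as well, this polynomial of
    degree at most \<open>m\<close> has \<open>m + 1\<close> zeros. Its vanishing at
    \<open>q i\<close>, where \<open>Q\<close> is zero, is the required equation.\<close>
  define R where "R = Q - [:0, 1:] * W + (\<Sum>j<m. Polynomial.smult (a j) (Wj j))"
  define d where "d = - poly R (q 0) / poly W (q 0)"
  have pinj: "p i = p j \<longleftrightarrow> i = j" if "i < m" "j < m" for i j
    using that ord(4) by (metis linorder_neqE_nat order_less_irrefl)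
  have pq: "q i \<noteq> p j" if "i \<le> m" "j < m" for i j
    using that ord(1,2) by (metis not_less order_less_irrefl)
  have Wjj: "poly (Wj j) (p j) \<noteq> 0" if "j < m" for j
    using that pinj by (auto simp: Wj_def poly_prod)
  have Wq: "poly W (q i) \<noteq> 0" if "i \<le> m" for i
    using that pq by (auto simp: W_def poly_prod)
  have W_split: "W = [:- p j, 1:] * Wj j" if "j < m" for j
    unfolding W_def Wj_def using that by (subst prod.remove[of _ j]) auto
  have R_p: "poly R (p j) = 0" if j: "j < m" for j
  proof -
    have 0: "poly (Wj i) (p j) = 0" if "i \<noteq> j" for i
      using that j by (auto simp: Wj_def poly_prod)
    have "(\<Sum>i<m. a i * poly (Wj i) (p j)) = (\<Sum>i<m. if i = j then a j * poly (Wj j) (p j) else 0)"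
      by (intro sum.cong) (auto simp: 0)
    also have "\<dots> = - poly Q (p j)" using j Wjj[OF j] by (simp add: a_def)
    finally show ?thesis
      using j by (simp add: R_def W_split[OF j] poly_sum)
  qed
  have S: "R + Polynomial.smult d W = 0"
  proof (rule poly_eqI_degree[of "insert (q 0) (p ` {..<m})"])
    fix t assume "t \<in> insert (q 0) (p ` {..<m})"
    then show "poly (R + Polynomial.smult d W) t = poly 0 t"
    proof
      assume "t = q 0"
      then show ?thesis using Wq[of 0] by (simp add: d_def)
    next
      assume "t \<in> p ` {..<m}"
      then obtain j where j: "j < m" "t = p j" by auto
      then show ?thesis using R_p[OF j(1)] by (simp add: W_split[OF j(1)])
    qed
  next
    have "q 0 \<notin> p ` {..<m}" using pq[of 0] by auto
    then have card: "card (insert (q 0) (p ` {..<m})) = Suc m"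
      using pinj by (simp add: card_image inj_on_def)
    have dW: "degree W = m" unfolding W_def by (simp add: degree_prod_linear)
    have dWj: "degree (Wj j) \<le> m" for j
      unfolding Wj_def using card_Diff1_le[of "{..<m}" j] by (simp add: degree_prod_linear)
    have dQ: "degree Q = Suc m" unfolding Q_def by (simp add: degree_prod_linear)
    have "degree (Q - [:0, 1:] * W) \<le> m"
    proof (rule degree_le, intro allI impI)
      fix i assume i: "m < i"
      have "coeff Q (Suc m) = 1" using coeff_prod_linear[of "{..m}" q] by (simp add: Q_def)
      moreover have "coeff W m = 1" using coeff_prod_linear[of "{..<m}" p] by (simp add: W_def)
      moreover have "coeff Q i = 0" "coeff W (i - 1) = 0" if "i \<noteq> Suc m"
        using i that dQ dW by (auto intro!: coeff_eq_0)
      ultimately show "coeff (Q - [:0, 1:] * W) i = 0"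
        using i by (cases "i = Suc m") (auto simp: coeff_pCons split: nat.splits)
    qed
    moreover have "degree (\<Sum>j<m. Polynomial.smult (a j) (Wj j)) \<le> m"
      by (rule degree_sum_le) (use dWj in auto)
    ultimately have "degree R \<le> m" unfolding R_def by (rule degree_add_le)
    then have "degree (R + Polynomial.smult d W) \<le> m"
      by (rule degree_add_le) (simp add: dW)
    then show "degree (R + Polynomial.smult d W) < card (insert (q 0) (p ` {..<m}))"
      by (simp only: card)
    show "degree (0 :: real poly) < card (insert (q 0) (p ` {..<m}))" by (simp only: card degree_0)
  qed
  have "q i - d = (\<Sum>j<m. a j / (q i - p j))" if i: "i \<le> m" for i
  proof -
    have "poly Q (q i) = 0" using i by (auto simp: Q_def poly_prod)
    moreover have "poly (R + Polynomial.smult d W) (q i) = 0" using S by simp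
    moreover have "(\<Sum>j<m. a j / (q i - p j)) * poly W (q i) = (\<Sum>j<m. a j * poly (Wj j) (q i))"
      unfolding sum_distrib_right using pq[OF i]
      by (intro sum.cong refl) (simp add: W_split field_simps)
    ultimately have "(\<Sum>j<m. a j / (q i - p j)) * poly W (q i) = (q i - d) * poly W (q i)"
      by (simp add: R_def poly_sum left_diff_distrib)
    then show ?thesis using Wq[OF i] by simp
  qed
  moreover have "0 < a j" if j: "j < m" for j
  proof -
    \<comment> \<open>Apart from \<open>q j\<close> and \<open>q (Suc j)\<close>, which enclose
      \<open>p j\<close>, every zero is paired with a pole \<open>p i\<close> on the same side of
      \<open>p j\<close>. All quotients in the product are then positive, and the sign of
      \<open>a j\<close> is that of the two remaining factors.\<close>
    define \<sigma> where "\<sigma> i = (if i < j then i else Suc i)" for i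
    have set: "{..m} = insert j (insert (Suc j) (\<sigma> ` ({..<m} - {j})))"
    proof
      show "{..m} \<subseteq> insert j (insert (Suc j) (\<sigma> ` ({..<m} - {j})))"
      proof
        fix i assume i: "i \<in> {..m}"
        consider "i < j" | "i = j" | "i = Suc j" | "i > Suc j" by linarith
        then show "i \<in> insert j (insert (Suc j) (\<sigma> ` ({..<m} - {j})))"
        proof cases
          case 1 then show ?thesis using j by (auto simp: \<sigma>_def intro!: image_eqI[of _ _ i])
        next
          case 4 then show ?thesis using i by (auto simp: \<sigma>_def intro!: image_eqI[of _ _ "i - 1"])
        qed auto
      qed
    qed (use j in \<open>auto simp: \<sigma>_def\<close>)
    have inj: "inj_on \<sigma> ({..<m} - {j})" by (auto simp: inj_on_def \<sigma>_def split: if_splits)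
    have notin: "j \<notin> insert (Suc j) (\<sigma> ` ({..<m} - {j}))" "Suc j \<notin> \<sigma> ` ({..<m} - {j})"
      by (auto simp: \<sigma>_def split: if_splits)
    have gen: "- (x * ((u - w) * P)) / D = x * (w - u) * (P / D)" for x u w P D :: real
      by (simp add: algebra_simps diff_divide_distrib add_divide_distrib)
    have "poly Q (p j) = (\<Prod>i\<in>{..m}. p j - q i)" by (simp add: Q_def poly_prod)
    also have "\<dots> = (p j - q j) * ((p j - q (Suc j)) * (\<Prod>i\<in>{..<m} - {j}. p j - q (\<sigma> i)))"
      unfolding set using notin by (simp add: prod.reindex[OF inj])
    finally have "a j = (p j - q j) * (q (Suc j) - p j) *
        ((\<Prod>i\<in>{..<m} - {j}. p j - q (\<sigma> i)) / (\<Prod>i\<in>{..<m} - {j}. p j - p i))"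
      using gen unfolding a_def Wj_def poly_prod by simp
    also have "(\<Prod>i\<in>{..<m} - {j}. p j - q (\<sigma> i)) / (\<Prod>i\<in>{..<m} - {j}. p j - p i) =
        (\<Prod>i\<in>{..<m} - {j}. (p j - q (\<sigma> i)) / (p j - p i))"
      by (simp add: prod_dividef)
    finally have a: "a j = (p j - q j) * (q (Suc j) - p j) *
        (\<Prod>i\<in>{..<m} - {j}. (p j - q (\<sigma> i)) / (p j - p i))" .
    have "0 < (p j - q (\<sigma> i)) / (p j - p i)" if i: "i \<in> {..<m} - {j}" for i
    proof (cases "i < j")
      case True
      then show ?thesis using j ord(1)[of i j] ord(4)[of i j] by (simp add: \<sigma>_def)
    next
      case False
      then show ?thesis using i ord(2)[of j "Suc i"] ord(4)[of j i]
        by (auto simp: \<sigma>_def intro!: divide_neg_neg)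
    qed
    then have "0 < (\<Prod>i\<in>{..<m} - {j}. (p j - q (\<sigma> i)) / (p j - p i))" by (rule prod_pos)
    then show ?thesis unfolding a using int[OF j] by (intro mult_pos_pos) auto
  qed
  ultimately show thesis using that by blast
qed

lemma eigenbasis_cong:
  assumes "eigenbasis m H v l" "\<And>i. i < m \<Longrightarrow> l i = l' i"
  shows "eigenbasis m H v l'"
  using assms(1) unfolding eigenbasis_def by (simp add: assms(2)[symmetric])

lemma eigenvalue_in_eigenbasis:
  assumes e: "eigenbasis m H v l" and H: "cadj H = H" and u: "u \<in> corner_space m" "u \<noteq> 0"
    and Hu: "H *v u = of_real c *s u"
  shows "c \<in> l ` {..<m}"
proof -
  have "\<exists>j<m. cip (v j) u \<noteq> 0"
  proof (rule ccontr)
    assume "\<not> ?thesis"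
    then have "(\<Sum>j<m. cip (v j) u *s v j) = 0" by (auto simp: smult_simps intro!: sum.neutral)
    then show False using eigenbasisD(4)[OF e u(1)] u(2) by simp
  qed
  then obtain j where j: "j < m" "cip (v j) u \<noteq> 0" by blast
  have "of_real c * cip (v j) u = cip (v j) (H *v u)" by (simp add: Hu)
  also have "\<dots> = of_real (l j) * cip (v j) u"
    by (simp add: cip_adj H eigenbasisD(2)[OF e j(1)])
  finally have "c = l j" using j(2) by simp
  then show ?thesis using j by auto
qed

text \<open>A new row and column with entries \<open>c\<close> and diagonal entry \<open>d\<close>
  turn the spectrum of the corner into the zeros of the secular function. Positive residues have
  real square roots, so every strictly interlacing row can be prescribed; smaller corners remain
  untouched.\<close>

lemma strict_pattern_realization:
  fixes q :: "nat \<Rightarrow> nat \<Rightarrow> real"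
  assumes "m \<le> CARD('n::{finite,linorder})"
    and "\<And>r i. r < m \<Longrightarrow> i < r \<Longrightarrow> q (Suc r) i < q r i \<and> q r i < q (Suc r) (Suc i)"
  shows "\<exists>H :: 'n cmat. cadj H = H \<and> cut m H = H \<and> (\<forall>r\<le>m. \<exists>v. eigenbasis r (cut r H) v (q r))"
  using assms
proof (induction m)
  case 0
  have "cadj (0 :: 'n cmat) = 0" "cut 0 (0 :: 'n cmat) = 0" by (simp_all add: vec_eq_iff)
  moreover obtain v l where "eigenbasis 0 (cut 0 (0 :: 'n cmat)) v l"
    using eigenbasis_exists[OF calculation(1), of 0] by auto
  then have "eigenbasis 0 (cut 0 (0 :: 'n cmat)) v (q 0)" by (rule eigenbasis_cong) simp
  ultimately show ?case by (intro exI[of _ 0]) auto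
next
  case (Suc m)
  then obtain H :: "'n cmat" where H: "cadj H = H" "cut m H = H"
    and r: "\<And>r. r \<le> m \<Longrightarrow> \<exists>v. eigenbasis r (cut r H) v (q r)"
    by (metis Suc_leD less_SucI)
  obtain v where v: "eigenbasis m H v (q m)" using r[of m] H(2) by auto
  have int: "q (Suc m) i < q m i \<and> q m i < q (Suc m) (Suc i)" if "i < m" for i
    using Suc.prems(2)[of m i] that by simp
  obtain a d where a: "\<forall>j<m. 0 < a j"
    and d: "\<forall>i\<le>m. q (Suc m) i - d = (\<Sum>j<m. a j / (q (Suc m) i - q m j))"
    by (rule partial_fractions_interlacing[of m "q (Suc m)" "q m", OF int])
  define z :: 'n where "z = at_pos m"
  have z: "pos z = m" using Suc.prems(1) by (simp add: z_def)
  then have zD: "pos i = m \<longleftrightarrow> i = z" for i by (metis pos_eq_iff)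
  \<comment> \<open>The residue \<open>a j\<close> is the squared modulus of the component of the
    new column along \<open>v j\<close>.\<close>
  define c where "c = (\<Sum>j<m. of_real (sqrt (a j)) *s v j)"
  have H0: "H $ i $ j = 0" if "\<not> (pos i < m \<and> pos j < m)" for i j
    using that H(2) by (metis cut_nth)
  have c0: "c $ i = 0" if "\<not> pos i < m" for i
    using that eigenbasisD(1)[OF v] by (auto simp: c_def corner_space_def)
  define H' :: "'n cmat" where "H' = (\<chi> i j. H $ i $ j + c $ i * (if j = z then 1 else 0)
    + (if i = z then 1 else 0) * cnj (c $ j) + (if i = z then 1 else 0) * (if j = z then of_real d else 0))"
  have H'n: "H' $ i $ j = H $ i $ j + c $ i * (if j = z then 1 else 0)
    + (if i = z then 1 else 0) * cnj (c $ j) + (if i = z then 1 else 0) * (if j = z then of_real d else 0)" for i j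
    by (simp add: H'_def)
  have cn: "cnj (H $ j $ i) = H $ i $ j" for i j
    using arg_cong[OF H(1), of "\<lambda>A. A $ i $ j"] by simp
  have "cadj H' = H'" by (simp add: vec_eq_iff H'n cn)
  moreover have cutH': "cut (Suc m) H' = H'"
    using z c0 H0 by (auto simp: vec_eq_iff H'n less_Suc_eq zD)
  moreover have "cut r H' = cut r H" if "r \<le> m" for r
    using that z by (auto simp: vec_eq_iff H'n)
  moreover have "\<exists>w. eigenbasis (Suc m) H' w (q (Suc m))"
  proof -
    have H'v: "H' *v u = H *v u + (u $ z) *s c + (cip c u + of_real d * u $ z) *s axis z 1" for u
    proof (rule vec_eq_iff[THEN iffD2], rule allI)
      fix i
      have "(H' *v u) $ i = (\<Sum>j\<in>UNIV. H $ i $ j * u $ j) + c $ i * (\<Sum>j\<in>UNIV. (if j = z then u $ j else 0))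
        + (if i = z then 1 else 0) * (\<Sum>j\<in>UNIV. cnj (c $ j) * u $ j)
        + (if i = z then 1 else 0) * (\<Sum>j\<in>UNIV. if j = z then of_real d * u $ j else 0)"
        unfolding matrix_vector_mult_def vec_lambda_beta H'n sum_distrib_left sum.distrib[symmetric]
        by (intro sum.cong) (auto simp: algebra_simps)
      then show "(H' *v u) $ i = (H *v u + (u $ z) *s c + (cip c u + of_real d * u $ z) *s axis z 1) $ i"
        by (simp add: matrix_vector_mult_def cip_def axis_nth)
    qed
    obtain w l where w: "eigenbasis (Suc m) H' w l"
      using eigenbasis_exists[OF \<open>cadj H' = H'\<close> Suc.prems(1)] cutH' by metis
    have "q (Suc m) i \<in> l ` {..<Suc m}" if i: "i \<le> m" for i
    proof -
      let ?q = "q (Suc m) i"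
      have ne: "?q \<noteq> q m j" if "j < m" for j
        using interlacing_order(1,2)[of m "q (Suc m)" "q m", OF int] i that
        by (metis not_less order_less_irrefl)
      \<comment> \<open>Solving the eigenvector equation for \<open>?q\<close> with last coordinate
        1: the components along the \<open>v j\<close> are forced, and the last coordinate of the
        equation is the secular equation.\<close>
      define b where "b j = sqrt (a j) / (?q - q m j)" for j
      define u where "u = (\<Sum>j<m. of_real (b j) *s v j) + axis z 1"
      have vz: "v j $ z = 0" if "j < m" for j
        using eigenbasisD(1)[OF v that] z by (simp add: corner_space_def)
      have uz: "u $ z = 1" by (simp add: u_def axis_nth vz)
      have uC: "u \<in> corner_space (Suc m)"
        unfolding corner_space_def
      proof (intro CollectI allI impI)
        fix i :: 'n assume "Suc m \<le> pos i"
        then show "u $ i = 0"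
          using eigenbasisD(1)[OF v] z by (auto simp: u_def axis_nth corner_space_def intro!: sum.neutral)
      qed
      have "H *v axis z 1 = 0"
        using H0 z by (simp add: vec_eq_iff matrix_vector_mult_def axis_nth if_distrib cong: if_cong)
      then have Hu: "H *v u = (\<Sum>j<m. of_real (b j * q m j) *s v j)"
        by (simp add: u_def mv_simps eigenbasisD(2)[OF v] smult_simps)
      have "cip c (axis z 1) = 0" using c0 z by (simp add: cip_axis_right)
      moreover have "cip c (v j) = of_real (sqrt (a j))" if "j < m" for j
      proof -
        have "cip c (v j) = (\<Sum>i<m. if i = j then of_real (sqrt (a j)) else 0)"
          unfolding c_def cip_sum_left
          by (intro sum.cong refl) (use that eigenbasisD(3)[OF v] in auto)
        then show ?thesis using that by simp
      qed
      ultimately have "cip c u = (\<Sum>j<m. of_real (b j * sqrt (a j)))" by (simp add: u_def)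
      also have "\<dots> = of_real (\<Sum>j<m. a j / (?q - q m j))"
        unfolding of_real_sum using a
        by (intro sum.cong refl arg_cong[of _ _ of_real]) (simp add: b_def less_imp_le)
      also have "\<dots> = of_real (?q - d)" using d i by simp
      finally have cu: "cip c u = of_real (?q - d)" .
      have "b j * q m j + sqrt (a j) = ?q * b j" if "j < m" for j
        using ne[OF that] by (simp add: b_def field_simps)
      then have "(\<Sum>j<m. of_real (b j * q m j + sqrt (a j)) *s v j) = (\<Sum>j<m. of_real (?q * b j) *s v j)"
        by simp
      then have "H *v u + c = of_real ?q *s (\<Sum>j<m. of_real (b j) *s v j)"
        by (simp add: Hu c_def sum.distrib[symmetric] smult_simps)
      moreover have "H' *v u = (H *v u + c) + of_real ?q *s axis z 1"
        unfolding H'v uz cu by (simp add: smult_simps)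
      ultimately have "H' *v u = of_real ?q *s (\<Sum>j<m. of_real (b j) *s v j) + of_real ?q *s axis z 1"
        by simp
      also have "\<dots> = of_real ?q *s u" unfolding u_def by (simp add: smult_simps)
      finally have "H' *v u = of_real ?q *s u" .
      moreover have "u \<noteq> 0" using uz by auto
      ultimately show ?thesis
        using eigenvalue_in_eigenbasis[OF w \<open>cadj H' = H'\<close> uC] by blast
    qed
    moreover have "set [0..<Suc m] = {..<Suc m}" by auto
    ultimately have sub: "set (map (q (Suc m)) [0..<Suc m]) \<subseteq> set (map l [0..<Suc m])"
      unfolding set_map by (auto simp del: upt_Suc simp: less_Suc_eq_le)
    have mono: "q (Suc m) i < q (Suc m) j" if "i < j" "j < Suc m" for i j
      using interlacing_order(3)[of m "q (Suc m)" "q m" i j, OF int] that by simp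
    \<comment> \<open>The \<open>m + 1\<close> prescribed values are distinct and all occur among
      the \<open>m + 1\<close> eigenvalues, so there are no others; sortedness then matches the two
      lists entry by entry.\<close>
    have dist: "distinct (map (q (Suc m)) [0..<Suc m])"
      unfolding distinct_map by (auto simp: inj_on_def) (metis linorder_neqE_nat mono order_less_irrefl less_Suc_eq)+
    have eq: "set (map (q (Suc m)) [0..<Suc m]) = set (map l [0..<Suc m])"
    proof (rule card_seteq[OF _ sub])
      show "card (set (map l [0..<Suc m])) \<le> card (set (map (q (Suc m)) [0..<Suc m]))"
        using card_length[of "map l [0..<Suc m]"] distinct_card[OF dist] by simp
    qed simp
    have "distinct (map l [0..<Suc m])"
      using eq distinct_card[OF dist] by (intro card_distinct) (metis length_map)
    moreover have "sorted (map l [0..<Suc m])" "sorted (map (q (Suc m)) [0..<Suc m])"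
      unfolding sorted_iff_nth_mono
      using eigenbasisD(5)[OF w] mono by (auto simp del: upt_Suc simp: order_le_less)
    ultimately have "map l [0..<Suc m] = map (q (Suc m)) [0..<Suc m]"
      using sorted_distinct_set_unique eq dist by metis
    then have "l i = q (Suc m) i" if "i < Suc m" for i
      using that by (auto simp del: upt_Suc)
    then show ?thesis using eigenbasis_cong[OF w] by blast
  qed
  ultimately show ?case using r cutH' by (intro exI[of _ H']) (auto simp: le_Suc_eq)
qed

lemma norm_le_sum_entries: "norm (A :: complex^'n^'m) \<le> (\<Sum>i\<in>UNIV. \<Sum>j\<in>UNIV. norm (A $ i $ j))"
proof -
  have "norm A \<le> (\<Sum>i\<in>UNIV. norm (A $ i))"
    unfolding norm_vec_def[of A] by (rule L2_set_le_sum) simp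
  also have "\<dots> \<le> (\<Sum>i\<in>UNIV. \<Sum>j\<in>UNIV. norm (A $ i $ j))"
    by (intro sum_mono) (subst norm_vec_def, rule L2_set_le_sum, simp)
  finally show ?thesis .
qed

lemma eigenbasis_entry_bound:
  fixes H :: "('n::{finite,linorder}) cmat"
  assumes e: "eigenbasis CARD('n) H v l"
  shows "norm (H $ i $ k) \<le> (\<Sum>j<CARD('n). \<bar>l j\<bar>)"
proof -
  have v: "norm (v j $ i) \<le> 1" if "j < CARD('n)" for i j
  proof -
    have "v j \<bullet> v j = 1" using eigenbasisD(3)[OF e that that] by (simp add: inner_eq_Re_cip)
    then have "norm (v j) = 1" by (simp add: norm_eq_1)
    then show ?thesis using Finite_Cartesian_Product.norm_nth_le[of "v j" i] by simp
  qed
  have "norm (H $ i $ k) \<le> (\<Sum>j<CARD('n). norm (of_real (l j) * (v j $ i * cnj (v j $ k))))"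
    unfolding eigenbasis_resolution(2)[OF e pos_less_card, symmetric] by (rule norm_sum)
  also have "\<dots> \<le> (\<Sum>j<CARD('n). \<bar>l j\<bar> * (1 * 1))"
    unfolding norm_mult norm_of_real complex_mod_cnj
    by (intro sum_mono mult_left_mono mult_mono v) auto
  finally show ?thesis by simp
qed

text \<open>Weak patterns are limits of strict ones. The approximating matrices are bounded through
  the eigenvalues of the full matrix, and the Lipschitz bound carries all rows, the top row
  included, to the limit.\<close>

theorem pattern_realization:
  fixes q :: "nat \<Rightarrow> nat \<Rightarrow> real"
  assumes "\<And>r i. r < CARD('n::{finite,linorder}) \<Longrightarrow> i < r \<Longrightarrow>
    q (Suc r) i \<le> q r i \<and> q r i \<le> q (Suc r) (Suc i)"
  shows "\<exists>x :: 'n cmat. cadj x = - x \<and>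
    (\<forall>s j. 1 \<le> j \<longrightarrow> j \<le> CARD('n) - s \<longrightarrow> gt s j x = q (CARD('n) - s) (j - 1))"
proof -
  let ?n = "CARD('n)"
  \<comment> \<open>The numbers \<open>2 i - r\<close> interlace strictly: those at
    \<open>(r + 1, i)\<close>, \<open>(r, i)\<close> and \<open>(r + 1, i + 1)\<close> increase by 1
    each time.\<close>
  define qN where "qN N r i = q r i + (2 * real i - real r) / real (Suc N)" for N r i
  have "qN N (Suc r) i < qN N r i \<and> qN N r i < qN N (Suc r) (Suc i)" if "r < ?n" "i < r" for N r i
    using assms[OF that] by (auto simp: qN_def intro!: add_le_less_mono divide_strict_right_mono)
  then have "\<exists>H :: 'n cmat. cadj H = H \<and> cut ?n H = H \<and> (\<forall>r\<le>?n. \<exists>v. eigenbasis r (cut r H) v (qN N r))" for N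
    by (intro strict_pattern_realization) auto
  then obtain H :: "nat \<Rightarrow> 'n cmat" where H: "\<And>N. cadj (H N) = H N"
    and e: "\<And>N r. r \<le> ?n \<Longrightarrow> \<exists>v. eigenbasis r (cut r (H N)) v (qN N r)"
    by metis
  define x :: "nat \<Rightarrow> 'n cmat" where "x N = (\<chi> i j. \<i> * H N $ i $ j)" for N
  have herm: "herm (x N) = H N" for N by (simp add: vec_eq_iff x_def)
  have Hc: "cnj (H N $ j $ i) = H N $ i $ j" for N i j
    using arg_cong[OF H[of N], of "\<lambda>A. A $ i $ j"] by simp
  have x: "cadj (x N) = - x N" for N by (simp add: vec_eq_iff x_def Hc)
  have gt: "gt s j (x N) = qN N (?n - s) (j - 1)" if "1 \<le> j" "j \<le> ?n - s" for N s j
  proof -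
    obtain v where v: "eigenbasis (?n - s) (cut (?n - s) (H N)) v (qN N (?n - s))"
      using e[OF diff_le_self] by metis
    show ?thesis by (rule gt_eq[OF v[folded herm] that])
  qed
  \<comment> \<open>A bound on the top row that is uniform in \<open>N\<close>; it bounds every
    entry of \<open>H N\<close>.\<close>
  define B where "B = (\<Sum>j<?n. \<bar>q ?n j\<bar> + \<bar>2 * real j - real ?n\<bar>)"
  have "norm (x N) \<le> (\<Sum>i\<in>(UNIV::'n set). \<Sum>j\<in>(UNIV::'n set). B)" for N
  proof -
    obtain v where "eigenbasis ?n (cut ?n (H N)) v (qN N ?n)" using e by blast
    then have v: "eigenbasis ?n (H N) v (qN N ?n)" by simp
    have "\<bar>qN N ?n j\<bar> \<le> \<bar>q ?n j\<bar> + \<bar>2 * real j - real ?n\<bar>" for j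
    proof -
      have "\<bar>qN N ?n j\<bar> \<le> \<bar>q ?n j\<bar> + \<bar>(2 * real j - real ?n) / real (Suc N)\<bar>"
        unfolding qN_def by (rule abs_triangle_ineq)
      also have "\<bar>(2 * real j - real ?n) / real (Suc N)\<bar> = \<bar>2 * real j - real ?n\<bar> / real (Suc N)"
        by (simp add: abs_divide)
      also have "\<dots> \<le> \<bar>2 * real j - real ?n\<bar> / 1"
        by (intro divide_left_mono) auto
      finally show ?thesis by simp
    qed
    then have "norm (H N $ i $ k) \<le> B" for i k
      using eigenbasis_entry_bound[OF v, of i k] unfolding B_def
      by (meson order_trans sum_mono)
    then have "norm (x N $ i $ k) \<le> B" for i k by (simp add: x_def norm_mult)
    then have "(\<Sum>i\<in>UNIV. \<Sum>j\<in>UNIV. norm (x N $ i $ j)) \<le> (\<Sum>i\<in>(UNIV::'n set). \<Sum>j\<in>(UNIV::'n set). B)"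
      by (intro sum_mono)
    then show ?thesis using norm_le_sum_entries[of "x N"] by linarith
  qed
  then obtain C where "\<And>N. x N \<in> cball 0 C" by auto
  then obtain y \<tau> where y: "strict_mono \<tau>" "(x \<circ> \<tau>) \<longlonglongrightarrow> y"
    using compact_imp_seq_compact[OF compact_cball, of "0 :: 'n cmat" C] unfolding seq_compact_def by blast
  have lim: "(\<lambda>N. x (\<tau> N)) \<longlonglongrightarrow> y" using y(2) by (simp add: o_def)
  have "cnj (y $ j $ i) = - y $ i $ j" for i j
  proof (rule LIMSEQ_unique)
    show "(\<lambda>N. cnj (x (\<tau> N) $ j $ i)) \<longlonglongrightarrow> cnj (y $ j $ i)"
      by (intro tendsto_cnj tendsto_vec_nth lim)
    have "cnj (x N $ j $ i) = - x N $ i $ j" for N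
      using arg_cong[OF x[of N], of "\<lambda>A. A $ i $ j"] by simp
    then show "(\<lambda>N. cnj (x (\<tau> N) $ j $ i)) \<longlonglongrightarrow> - y $ i $ j"
      by (simp only:) (intro tendsto_minus tendsto_vec_nth lim)
  qed
  then have y_skew: "cadj y = - y" by (simp add: vec_eq_iff)
  obtain K where K: "\<And>(x :: 'n cmat) y s j. cadj x = - x \<Longrightarrow> cadj y = - y \<Longrightarrow> 1 \<le> j \<Longrightarrow>
      j \<le> CARD('n) - s \<Longrightarrow> \<bar>gt s j x - gt s j y\<bar> \<le> K * norm (x - y)"
    using gt_lipschitz[where 'n = 'n] by blast
  have "gt s j y = q (?n - s) (j - 1)" if j: "1 \<le> j" "j \<le> ?n - s" for s j
  proof (rule LIMSEQ_unique)
    have "(\<lambda>N. norm (x (\<tau> N) - y)) \<longlonglongrightarrow> 0"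
      using lim by (simp add: LIM_zero_iff tendsto_norm_zero_iff)
    then have K0: "(\<lambda>N. K * norm (x (\<tau> N) - y)) \<longlonglongrightarrow> 0" by (rule tendsto_mult_right_zero)
    show "(\<lambda>N. gt s j (x (\<tau> N))) \<longlonglongrightarrow> gt s j y"
      by (rule LIM_zero_cancel, rule Lim_null_comparison[OF _ K0])
        (use K[OF x y_skew j] in \<open>auto intro!: always_eventually\<close>)
    let ?c = "2 * real (j - 1) - real (?n - s)"
    have "(\<lambda>N. q (?n - s) (j - 1) + ?c * inverse (real (Suc N))) \<longlonglongrightarrow> q (?n - s) (j - 1) + ?c * 0"
      by (intro tendsto_intros LIMSEQ_inverse_real_of_nat)
    from LIMSEQ_subseq_LIMSEQ[OF this y(1)]
    show "(\<lambda>N. gt s j (x (\<tau> N))) \<longlonglongrightarrow> q (?n - s) (j - 1)"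
      unfolding gt[OF j] qN_def by (simp add: o_def divide_inverse)
  qed
  then show ?thesis using y_skew by blast
qed

section \<open>Matrix algebra\<close>

definition cs :: "complex \<Rightarrow> ('n::finite) cmat \<Rightarrow> 'n cmat" where
  "cs c A = (\<chi> i j. c * A $ i $ j)"

lemma cs_nth [simp]: "cs c A $ i $ j = c * A $ i $ j"
  by (simp add: cs_def)

lemma mm_distrib:
  fixes A B C :: "('n::finite) cmat"
  shows "(A + B) ** C = A ** C + B ** C" "A ** (B + C) = A ** B + A ** C"
    "(A - B) ** C = A ** C - B ** C" "A ** (B - C) = A ** B - A ** C"
    "(- A) ** B = - (A ** B)" "A ** (- B) = - (A ** B)"
    "(r *\<^sub>R A) ** B = r *\<^sub>R (A ** B)" "A ** (r *\<^sub>R B) = r *\<^sub>R (A ** B)"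
    "cs c A ** B = cs c (A ** B)" "A ** cs c B = cs c (A ** B)"
    "A ** 0 = 0" "0 ** A = 0"
  by (simp_all add: vec_eq_iff matrix_matrix_mult_def sum.distrib sum_subtractf sum_negf algebra_simps
      scaleR_sum_right sum_distrib_left)

lemma cs_simps:
  fixes A B :: "('n::finite) cmat"
  shows "cs c (A + B) = cs c A + cs c B" "cs c (A - B) = cs c A - cs c B" "cs c (- A) = - cs c A"
    "cs a (cs b A) = cs (a * b) A" "cs 1 A = A" "cs (- 1) A = - A" "cs (- c) A = - cs c A"
    "cs c (r *\<^sub>R A) = r *\<^sub>R cs c A" "cs c 0 = 0"
  by (simp_all add: vec_eq_iff algebra_simps)

lemma cadj_simps:
  fixes A B :: "('n::finite) cmat"
  shows "cadj (A + B) = cadj A + cadj B" "cadj (A - B) = cadj A - cadj B" "cadj (- A) = - cadj A"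
    "cadj (A ** B) = cadj B ** cadj A" "cadj (cadj A) = A" "cadj (cs c A) = cs (cnj c) (cadj A)"
    "cadj (mat 1 :: 'n cmat) = mat 1" "cadj (r *\<^sub>R A) = r *\<^sub>R cadj A" "cadj (0 :: 'n cmat) = 0"
  by (simp_all add: vec_eq_iff matrix_matrix_mult_def mult.commute mat_def)

lemmas mm_assoc = matrix_mul_assoc[symmetric]

lemma trace_simps:
  fixes A B :: "('n::finite) cmat"
  shows "trace (A + B) = trace A + trace B" "trace (A - B) = trace A - trace B" "trace (- A) = - trace A"
    "trace (cs c A) = c * trace A" "trace (r *\<^sub>R A) = r *\<^sub>R trace A" "trace (0 :: 'n cmat) = 0"
    "trace (mat 1 :: 'n cmat) = of_nat CARD('n)"
  by (simp_all add: trace_def sum.distrib sum_subtractf sum_negf sum_distrib_left scaleR_sum_right mat_def)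

lemma trace_cadj: "trace (cadj A) = cnj (trace A)"
  by (simp add: trace_def)

lemma det_cadj: "det (cadj (A :: ('n::finite) cmat)) = cnj (det A)"
proof -
  have "det (cadj A) = det (transpose (\<chi> i j. cnj (A $ i $ j)))"
    by (intro arg_cong[of _ _ det]) (simp add: vec_eq_iff transpose_def)
  also have "\<dots> = det (\<chi> i j. cnj (A $ i $ j))" by (rule det_transpose)
  also have "\<dots> = cnj (det A)" by (simp add: det_def)
  finally show ?thesis .
qed

lemma SU_D:
  assumes "g \<in> SU"
  shows "cadj g ** g = mat 1" "g ** cadj g = mat 1" "cadj g ** (g ** A) = A" "g ** (cadj g ** A) = A"
proof -
  show 1: "cadj g ** g = mat 1" "g ** cadj g = mat 1"
    using assms SU_right_inverse by (auto simp: SU_def)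
  show "cadj g ** (g ** A) = A" "g ** (cadj g ** A) = A"
    by (simp_all add: matrix_mul_assoc 1)
qed

definition diagm :: "('n::finite \<Rightarrow> complex) \<Rightarrow> 'n cmat" where
  "diagm d = (\<chi> i j. if i = j then d i else 0)"

lemma diagm_mult:
  "(A ** diagm d) $ i $ j = A $ i $ j * d j" "(diagm d ** A) $ i $ j = d i * A $ i $ j"
  by (simp_all add: diagm_def matrix_matrix_mult_def if_distrib if_distribR cong: if_cong)

lemma diagm_conj_nth:
  fixes g :: "('n::finite) cmat"
  shows "(g ** diagm d ** cadj g) $ i $ j = (\<Sum>b\<in>UNIV. d b * (g $ i $ b * cnj (g $ j $ b)))"
proof -
  have "(g ** diagm d ** cadj g) $ i $ j = (\<Sum>b\<in>UNIV. (g ** diagm d) $ i $ b * cnj (g $ j $ b))"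
    by (simp add: matrix_matrix_mult_def[of "g ** diagm d"])
  also have "\<dots> = (\<Sum>b\<in>UNIV. d b * (g $ i $ b * cnj (g $ j $ b)))"
    unfolding diagm_mult(1) by (simp add: mult_ac)
  finally show ?thesis .
qed

text \<open>The eigenvalues are placed in decreasing order along the diagonal, since
  \<open>rho k\<close> and \<open>E k\<close> carry their larger eigenvalue in the first
  \<open>k\<close> positions.\<close>

lemma unitary_diagonalization:
  fixes H :: "('n::{finite,linorder}) cmat"
  assumes e: "eigenbasis CARD('n) H v l"
  shows "\<exists>g\<in>SU. H = g ** diagm (\<lambda>b. of_real (l (CARD('n) - Suc (pos b)))) ** cadj g"
proof -
  let ?n = "CARD('n)"
  define \<tau> where "\<tau> b = ?n - Suc (pos b)" for b :: 'n
  have \<tau>: "\<tau> b < ?n" for b using pos_less_card[of b] by (simp add: \<tau>_def)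
  have "a = b" if "\<tau> a = \<tau> b" for a b
  proof -
    have "pos a = pos b"
      using that pos_less_card[of a] pos_less_card[of b] unfolding \<tau>_def by linarith
    then show ?thesis by (simp only: pos_eq_iff)
  qed
  then have \<tau>_eq: "\<tau> a = \<tau> b \<longleftrightarrow> a = b" for a b by blast
  define g0 :: "'n cmat" where "g0 = (\<chi> i b. v (\<tau> b) $ i)"
  have u0: "cadj g0 ** g0 = mat 1"
  proof -
    have "(cadj g0 ** g0) $ a $ b = cip (v (\<tau> a)) (v (\<tau> b))" for a b
      by (simp add: matrix_matrix_mult_def cip_def g0_def)
    then show ?thesis by (simp add: vec_eq_iff mat_def eigenbasisD(3)[OF e \<tau> \<tau>] \<tau>_eq)
  qed
  have det1: "cnj (det g0) * det g0 = 1"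
    using arg_cong[OF u0, of det] by (simp add: det_mul det_cadj)
  obtain b0 :: 'n where True by simp
  \<comment> \<open>One column is multiplied by a phase so that the determinant becomes 1; a
    diagonal factor does not change the conjugated diagonal matrix.\<close>
  define d where "d b = (if b = b0 then cnj (det g0) else 1)" for b
  have dd: "cnj (d b) * d b = 1" "d b * cnj (d b) = 1" for b
    using det1 by (auto simp: d_def mult.commute)
  have "cadj (diagm d) ** diagm d = mat 1"
    by (simp add: vec_eq_iff diagm_mult) (auto simp: diagm_def mat_def dd)
  then have u: "cadj (g0 ** diagm d) ** (g0 ** diagm d) = mat 1"
    using u0 by (simp add: cadj_simps mm_assoc) (simp add: matrix_mul_assoc)
  have "det (diagm d) = (\<Prod>b\<in>UNIV. diagm d $ b $ b)" by (rule det_diagonal) (simp add: diagm_def)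
  also have "\<dots> = (\<Prod>b\<in>UNIV. if b = b0 then cnj (det g0) else 1)"
    by (simp add: diagm_def d_def)
  also have "\<dots> = cnj (det g0)" by simp
  finally have "det (g0 ** diagm d) = 1" using det1 by (simp add: det_mul mult.commute)
  then have "g0 ** diagm d \<in> SU" using u by (simp add: SU_def)
  moreover have "H = (g0 ** diagm d) ** diagm (\<lambda>b. of_real (l (\<tau> b))) ** cadj (g0 ** diagm d)"
  proof -
    have "H $ i $ j = ((g0 ** diagm d) ** diagm (\<lambda>b. of_real (l (\<tau> b))) ** cadj (g0 ** diagm d)) $ i $ j" for i j
    proof -
      let ?f = "\<lambda>a. of_real (l a) * (v a $ i * cnj (v a $ j))"
      have "H $ i $ j = (\<Sum>a<?n. ?f a)"
        by (rule eigenbasis_resolution(2)[OF e pos_less_card, symmetric])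
      also have "\<dots> = (\<Sum>a<?n. ?f (?n - Suc a))" by (rule sum.nat_diff_reindex[symmetric])
      also have "\<dots> = (\<Sum>b\<in>(UNIV :: 'n set). ?f (\<tau> b))" unfolding \<tau>_def by (rule sum_pos[symmetric])
      also have "\<dots> = (\<Sum>b\<in>UNIV. of_real (l (\<tau> b)) * ((g0 ** diagm d) $ i $ b * cnj ((g0 ** diagm d) $ j $ b)))"
      proof (intro sum.cong refl)
        fix b
        have "(g0 ** diagm d) $ i $ b * cnj ((g0 ** diagm d) $ j $ b) =
            (v (\<tau> b) $ i * cnj (v (\<tau> b) $ j)) * (d b * cnj (d b))"
          by (simp add: diagm_mult g0_def)
        then show "?f (\<tau> b) = of_real (l (\<tau> b)) * ((g0 ** diagm d) $ i $ b * cnj ((g0 ** diagm d) $ j $ b))"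
          by (simp only: dd mult_1_right)
      qed
      finally show ?thesis by (simp only: diagm_conj_nth)
    qed
    then show ?thesis by (simp add: vec_eq_iff)
  qed
  ultimately show ?thesis unfolding \<tau>_def by blast
qed

section \<open>The Grassmannian as a space of projections\<close>

definition projection :: "nat \<Rightarrow> ('n::finite) cmat \<Rightarrow> bool" where
  "projection r P \<longleftrightarrow> cadj P = P \<and> P ** P = P \<and> trace P = of_nat r"

text \<open>The base point among the projections of rank \<open>k\<close>; \<open>rho k\<close> is
  \<open>\<i>\<close> times \<open>E k\<close> made traceless.\<close>

definition E :: "nat \<Rightarrow> ('n::{finite,linorder}) cmat" where
  "E k = diagm (\<lambda>i. if pos i < k then 1 else 0)"

lemma E_nth: "E k $ i $ j = (if i = j \<and> pos i < k then 1 else 0)"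
  by (simp add: E_def diagm_def)

lemma projection_E: "k \<le> CARD('n) \<Longrightarrow> projection k (E k :: ('n::{finite,linorder}) cmat)"
proof -
  assume k: "k \<le> CARD('n)"
  have "trace (E k :: 'n cmat) = (\<Sum>i\<in>(UNIV :: 'n set). if pos i < k then 1 else 0)"
    by (simp add: trace_def E_nth)
  also have "\<dots> = of_nat k" using card_pos_less[OF k] by (simp add: sum.If_cases)
  moreover have "E k ** E k = (E k :: 'n cmat)"
    by (simp add: vec_eq_iff E_def diagm_mult) (simp add: diagm_def)
  ultimately show ?thesis by (auto simp: projection_def vec_eq_iff E_nth)
qed

lemma projection_conj:
  assumes "projection r P" "g \<in> SU" shows "projection r (g ** P ** cadj g)"
  using assms
proof -
  have "trace (g ** (P ** cadj g)) = trace ((P ** cadj g) ** g)" by (rule trace_mul_sym)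
  then show ?thesis using assms unfolding projection_def
    by (simp add: cadj_simps mm_assoc SU_D) (simp add: matrix_mul_assoc)
qed

lemma trace_eigenbasis:
  fixes H :: "('n::{finite,linorder}) cmat"
  assumes e: "eigenbasis CARD('n) H v l"
  shows "trace H = of_real (\<Sum>j<CARD('n). l j)"
proof -
  have "trace H = (\<Sum>i\<in>UNIV. \<Sum>j<CARD('n). of_real (l j) * (v j $ i * cnj (v j $ i)))"
    unfolding trace_def by (intro sum.cong refl eigenbasis_resolution(2)[OF e, symmetric] pos_less_card)
  also have "\<dots> = (\<Sum>j<CARD('n). of_real (l j) * cip (v j) (v j))"
    by (subst sum.swap) (simp add: cip_def sum_distrib_left mult_ac)
  also have "\<dots> = (\<Sum>j<CARD('n). of_real (l j))"
    by (intro sum.cong refl) (simp add: eigenbasisD(3)[OF e])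
  finally show ?thesis by simp
qed

text \<open>Idempotence allows only 0 and 1, the trace counts the ones, and the nondecreasing order
  puts them last.\<close>

lemma projection_eigenvalues:
  fixes P :: "('n::{finite,linorder}) cmat"
  assumes P: "projection r P" and e: "eigenbasis CARD('n) P v l"
  shows "r \<le> CARD('n)" "j < CARD('n) \<Longrightarrow> l j = (if CARD('n) - r \<le> j then 1 else 0)"
proof -
  let ?n = "CARD('n)"
  have l01: "l j = 0 \<or> l j = 1" if j: "j < ?n" for j
  proof -
    have "P *v (P *v v j) = P *v v j"
      using P by (simp add: projection_def matrix_vector_mul_assoc)
    then have "cip (v j) (P *v (P *v v j)) = cip (v j) (P *v v j)" by simp
    moreover have "cip (v j) (v j) = 1" using eigenbasisD(3)[OF e j j] by simp
    ultimately have "complex_of_real (l j) * of_real (l j) = of_real (l j)"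
      unfolding eigenbasisD(2)[OF e j] mv_simps by simp
    then show ?thesis by simp
  qed
  define S where "S = {j. j < ?n \<and> l j = 1}"
  have "of_nat r = complex_of_real (\<Sum>j<?n. l j)"
    using P trace_eigenbasis[OF e] by (simp add: projection_def)
  also have "(\<Sum>j<?n. l j) = (\<Sum>j<?n. if l j = 1 then 1 else 0)"
    by (intro sum.cong refl) (use l01 in fastforce)
  also have "\<dots> = of_nat (card S)"
    by (simp add: sum.If_cases S_def) (simp add: Int_def conj_commute)
  finally have r: "r = card S" by (simp only: of_real_of_nat_eq of_nat_eq_iff)
  have Sn: "S \<subseteq> {..<?n}" by (auto simp: S_def)
  then show rn: "r \<le> ?n" using card_mono[OF _ Sn] r by simp
  have up: "i \<in> S" if "j \<in> S" "j \<le> i" "i < ?n" for i j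
    using that eigenbasisD(5)[OF e that(2,3)] l01[of i] by (auto simp: S_def)
  have "S \<subseteq> {?n - r..<?n}"
  proof
    fix j assume j: "j \<in> S"
    then have "{j..<?n} \<subseteq> S" using up by auto
    then have "?n - j \<le> r" using card_mono[of S "{j..<?n}"] Sn r finite_subset by fastforce
    then show "j \<in> {?n - r..<?n}" using j Sn by auto
  qed
  then have "S = {?n - r..<?n}" using rn r by (intro card_subset_eq) auto
  then have "j \<in> S \<longleftrightarrow> ?n - r \<le> j \<and> j < ?n" for j by simp
  then show "l j = (if ?n - r \<le> j then 1 else 0)" if "j < ?n"
    using that l01[of j] by (auto simp: S_def)
qed

lemma projection_unitary_conj:
  fixes P :: "('n::{finite,linorder}) cmat"
  assumes P: "projection r P"
  shows "r \<le> CARD('n)" "\<exists>g\<in>SU. P = g ** E r ** cadj g"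
proof -
  obtain v l where e: "eigenbasis CARD('n) P v l"
    using eigenbasis_exists[of P "CARD('n)"] P by (auto simp: projection_def)
  note ev = projection_eigenvalues[OF P e]
  show "r \<le> CARD('n)" by (rule ev)
  have "diagm (\<lambda>b::'n. of_real (l (CARD('n) - Suc (pos b)))) = E r"
  proof -
    have "of_real (l (CARD('n) - Suc (pos b))) = (if pos b < r then 1 else (0 :: complex))" for b :: 'n
      using ev(2)[of "CARD('n) - Suc (pos b)"] ev(1) pos_less_card[of b] by auto
    then show ?thesis by (simp add: E_def)
  qed
  then show "\<exists>g\<in>SU. P = g ** E r ** cadj g" using unitary_diagonalization[OF e] by simp
qed

lemma rho_eq: "k \<le> CARD('n) \<Longrightarrow>
  rho k = cs \<i> (E k - cs (of_nat k / of_nat CARD('n)) (mat 1) :: ('n::{finite,linorder}) cmat)"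
  by (auto simp: vec_eq_iff rho_def E_nth mat_def field_simps of_nat_diff)

lemma Gr_iff:
  fixes x :: "('n::{finite,linorder}) cmat"
  assumes k: "k \<le> CARD('n)"
  shows "x \<in> Gr k \<longleftrightarrow> (\<exists>P. projection k P \<and> x = cs \<i> (P - cs (of_nat k / of_nat CARD('n)) (mat 1)))"
proof -
  have orb: "orbit_map k g = cs \<i> (g ** E k ** cadj g - cs (of_nat k / of_nat CARD('n)) (mat 1))"
    if "g \<in> SU" for g :: "'n cmat"
    using that by (simp add: orbit_map_def rho_eq[OF k] mm_distrib SU_D)
  show ?thesis
  proof
    assume "x \<in> Gr k"
    then obtain g where "g \<in> SU" "x = orbit_map k g" by (auto simp: Gr_def)
    then show "\<exists>P. projection k P \<and> x = cs \<i> (P - cs (of_nat k / of_nat CARD('n)) (mat 1))"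
      using orb projection_conj[OF projection_E[OF k]] by blast
  next
    assume "\<exists>P. projection k P \<and> x = cs \<i> (P - cs (of_nat k / of_nat CARD('n)) (mat 1))"
    then obtain P where P: "projection k P" "x = cs \<i> (P - cs (of_nat k / of_nat CARD('n)) (mat 1))" by blast
    then obtain g where "g \<in> SU" "P = g ** E k ** cadj g" using projection_unitary_conj(2) by blast
    then show "x \<in> Gr k" using orb P by (auto simp: Gr_def)
  qed
qed

lemma herm_Gr: "herm (cs \<i> A) = A"
  by (simp add: vec_eq_iff)

lemma skew_Gr:
  assumes "projection k P" shows "cadj (cs \<i> (P - cs (of_nat k / of_nat m) (mat 1))) = - cs \<i> (P - cs (of_nat k / of_nat m) (mat 1))"
  using assms by (simp add: cadj_simps projection_def cs_simps)

text \<open>The cut identity acts as the identity on \<open>corner_space m\<close>, so subtracting a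
  scalar matrix shifts every eigenvalue of every corner by the same number and keeps the
  eigenvectors.\<close>

lemma eigenbasis_shift:
  assumes m: "m \<le> CARD('n)"
  shows "eigenbasis m (cut m (A - cs (of_real c) (mat 1) :: ('n::{finite,linorder}) cmat)) v l \<longleftrightarrow>
    eigenbasis m (cut m A) v (\<lambda>j. l j + c)"
proof -
  have "cut m (A - cs (of_real c) (mat 1)) *v w = cut m A *v w - of_real c *s w"
    if w: "w \<in> corner_space m" for w :: "(complex, 'n) vec"
  proof -
    have z: "w $ i = 0" if "\<not> pos i < m" for i using w that by (simp add: corner_space_def)
    have "(cut m (mat 1 :: 'n cmat) *v w) $ i = (\<Sum>j\<in>UNIV. if i = j then w $ j else 0)" for i
      unfolding matrix_vector_mult_def vec_lambda_beta cut_nth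
      by (intro sum.cong refl) (auto simp: mat_def z)
    then have 1: "cut m (mat 1 :: 'n cmat) *v w = w" by (simp add: vec_eq_iff)
    have 2: "cut m (A - cs (of_real c) (mat 1)) = cut m A - cs (of_real c) (cut m (mat 1))"
      by (simp add: vec_eq_iff)
    have "cs (of_real c) B *v w = of_real c *s (B *v w)" for B
      by (simp add: vec_eq_iff matrix_vector_mult_def sum_distrib_left mult_ac)
    then show ?thesis unfolding 2 matrix_vector_diff by (simp add: 1)
  qed
  then have *: "v i \<in> corner_space m \<Longrightarrow>
      cut m (A - cs (of_real c) (mat 1)) *v v i = of_real (l i) *s v i \<longleftrightarrow> cut m A *v v i = of_real (l i + c) *s v i" for i
    by (simp add: diff_eq_eq smult_simps)
  show ?thesis unfolding eigenbasis_def using * by auto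
qed

lemma gt_level_0:
  fixes x :: "('n::{finite,linorder}) cmat"
  assumes k: "k \<le> CARD('n)" and x: "x \<in> Gr k" and j: "1 \<le> j" "j \<le> CARD('n)"
  shows "gt 0 j x = (if CARD('n) - k < j then real (CARD('n) - k) / real CARD('n) else - real k / real CARD('n))"
proof -
  let ?c = "real k / real CARD('n)"
  obtain P where P: "projection k P" and xP: "x = cs \<i> (P - cs (of_nat k / of_nat CARD('n)) (mat 1))"
    using x Gr_iff[OF k] by blast
  have hx: "herm x = P - cs (of_real ?c) (mat 1)" by (simp add: xP herm_Gr)
  obtain v l where e: "eigenbasis CARD('n) (cut CARD('n) (herm x)) v l"
    using eigenbasis_exists[OF cadj_herm, of x "CARD('n)"] skew_Gr[OF P] xP by blast
  then have "eigenbasis CARD('n) (cut CARD('n) P) v (\<lambda>j. l j + ?c)"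
    unfolding hx using eigenbasis_shift by blast
  then have "l (j - 1) + ?c = (if CARD('n) - k \<le> j - 1 then 1 else 0)"
    using projection_eigenvalues(2)[OF P, of v "\<lambda>j. l j + ?c" "j - 1"] j by simp
  moreover have "gt 0 j x = l (j - 1)" using gt_eq[of 0 x v l j] e j by simp
  moreover have "real (CARD('n) - k) / real CARD('n) = 1 - ?c" using k by (simp add: field_simps of_nat_diff)
  ultimately show ?thesis using j by (auto split: if_splits)
qed

text \<open>A conjugation orbit of skew-Hermitian matrices is determined by the spectrum, that is,
  by level 0 of the Gelfand-Tsetlin variables.\<close>

lemma Gr_I_gt:
  fixes x :: "('n::{finite,linorder}) cmat"
  assumes k: "k \<le> CARD('n)" and x: "cadj x = - x"
    and gt: "\<And>j. 1 \<le> j \<Longrightarrow> j \<le> CARD('n) \<Longrightarrow>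
      gt 0 j x = (if CARD('n) - k < j then real (CARD('n) - k) / real CARD('n) else - real k / real CARD('n))"
  shows "x \<in> Gr k"
proof -
  let ?c = "real k / real CARD('n)"
  obtain v l where e: "eigenbasis CARD('n) (cut CARD('n) (herm x)) v l"
    using eigenbasis_exists[OF cadj_herm[OF x], of "CARD('n)"] by blast
  have l: "l j = gt 0 (Suc j) x" if "j < CARD('n)" for j
    using gt_eq[of 0 x v l "Suc j"] e that by simp
  obtain g where g: "g \<in> SU" "herm x = g ** diagm (\<lambda>b. of_real (l (CARD('n) - Suc (pos b)))) ** cadj g"
    using unitary_diagonalization[of "herm x" v l] e by auto
  have "of_real (l (CARD('n) - Suc (pos b))) = - \<i> * rho k $ b $ b" for b :: 'n
    using pos_less_card[of b] k by (auto simp: l gt rho_def)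
  then have "diagm (\<lambda>b. of_real (l (CARD('n) - Suc (pos b)))) = herm (rho k :: 'n cmat)"
    by (simp add: vec_eq_iff diagm_def) (simp add: rho_def)
  moreover have hc: "herm y = cs (- \<i>) y" for y :: "'n cmat" by (simp add: vec_eq_iff)
  ultimately have "cs (- \<i>) x = cs (- \<i>) (orbit_map k g)"
    using g(2) by (simp add: hc mm_distrib orbit_map_def)
  then have "cs \<i> (cs (- \<i>) x) = cs \<i> (cs (- \<i>) (orbit_map k g))" by simp
  then have "x = orbit_map k g" by (simp add: cs_simps)
  then show ?thesis using g(1) by (simp add: Gr_def)
qed

section \<open>The image of the Gelfand-Tsetlin map\<close>

lemma gt_interlacing:
  fixes x :: "('n::{finite,linorder}) cmat"
  assumes x: "cadj x = - x" and a: "Suc s < CARD('n)" "a < CARD('n) - Suc s"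
  shows "gt s (Suc a) x \<le> gt (Suc s) (Suc a) x" "gt (Suc s) (Suc a) x \<le> gt s (Suc (Suc a)) x"
proof -
  define m where "m = CARD('n) - Suc s"
  have m: "CARD('n) - s = Suc m" using a by (simp add: m_def)
  have m_le: "Suc m \<le> CARD('n)" "m \<le> CARD('n)" using a by (auto simp: m_def)
  obtain v l where e: "eigenbasis (Suc m) (cut (Suc m) (herm x)) v l"
    using eigenbasis_exists[OF cadj_herm[OF x] m_le(1)] by blast
  obtain v' l' where e': "eigenbasis m (cut m (herm x)) v' l'"
    using eigenbasis_exists[OF cadj_herm[OF x] m_le(2)] by blast
  have g: "gt s (Suc i) x = l i" if "i < Suc m" for i
    using gt_eq[of s x v l "Suc i"] e that m by simp
  have g': "gt (Suc s) (Suc i) x = l' i" if "i < m" for i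
    using gt_eq[of "Suc s" x v' l' "Suc i"] e' that m_def by simp
  have am: "a < m" "Suc m \<le> CARD('n)" using a by (auto simp: m_def)
  show "gt s (Suc a) x \<le> gt (Suc s) (Suc a) x" "gt (Suc s) (Suc a) x \<le> gt s (Suc (Suc a)) x"
    using cauchy_interlacing[OF am(2,1) e e'] am by (simp_all add: g g')
qed

text \<open>The coordinates of the polytope, with level 0 included so that the interlacing
  inequalities start from the fixed top row. The factor -2 reverses the order, which accounts for
  the reversed index.\<close>

definition gt_pattern :: "nat \<Rightarrow> ('n::{finite,linorder}) cmat \<Rightarrow> nat \<times> nat \<Rightarrow> real" where
  "gt_pattern k x = (\<lambda>(s,i). -2 * (gt s (CARD('n) - s + 1 - i) x - real (CARD('n) - k) / real CARD('n)))"

lemma gt_pattern_in_gc_patterns: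
  fixes x :: "('n::{finite,linorder}) cmat"
  assumes k: "k \<le> CARD('n)" and x: "x \<in> Gr k"
  shows "gt_pattern k x \<in> gc_patterns CARD('n) (\<lambda>i. if i \<le> k then 0 else 2)"
proof -
  let ?n = "CARD('n)"
  have skew: "cadj x = - x" using x Gr_iff[OF k, of x] skew_Gr by blast
  have c: "real (?n - k) / real ?n = 1 - real k / real ?n" using k by (simp add: field_simps of_nat_diff)
  have "gt_pattern k x (0, i) = (if i \<le> k then 0 else 2)" if "1 \<le> i" "i \<le> ?n" for i
  proof -
    have gt: "gt 0 (?n + 1 - i) x = (if ?n - k < ?n + 1 - i then 1 - real k / real ?n else - real k / real ?n)"
      using gt_level_0[OF k x, of "?n + 1 - i"] that unfolding c by simp
    show ?thesis unfolding gt_pattern_def prod.case diff_zero gt c using that k by auto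
  qed
  moreover have "gt_pattern k x (s, i) \<le> gt_pattern k x (Suc s, i) \<and>
      gt_pattern k x (Suc s, i) \<le> gt_pattern k x (s, i + 1)" if "(Suc s, i) \<in> levels ?n" for s i
  proof -
    define a where "a = ?n - Suc s - i"
    have "Suc s < ?n" "a < ?n - Suc s" "?n - s + 1 - i = Suc (Suc a)" "?n - Suc s + 1 - i = Suc a"
      "?n - s + 1 - (i + 1) = Suc a"
      using that by (auto simp: levels_def a_def)
    then show ?thesis using gt_interlacing[OF skew, of s a] by (simp add: gt_pattern_def)
  qed
  ultimately show ?thesis by (auto simp: gc_patterns_def)
qed

lemma gc_pattern_realized:
  assumes k: "k \<le> CARD('n::{finite,linorder})"
    and y: "y \<in> gc_patterns CARD('n) (\<lambda>i. if i \<le> k then 0 else 2)"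
  shows "\<exists>x\<in>(Gr k :: 'n cmat set). \<forall>s i. s < CARD('n) \<longrightarrow> 1 \<le> i \<longrightarrow> i \<le> CARD('n) - s \<longrightarrow>
    gt_pattern k x (s,i) = y (s,i)"
proof -
  let ?n = "CARD('n)" and ?c = "real (CARD('n) - k) / real CARD('n)"
  \<comment> \<open>The inverse of the affine map in \<open>gt_pattern\<close>, indexed by the
    corner size \<open>r = n - s\<close> and by \<open>a\<close>, counted from 0 in increasing
    order, so that \<open>i = r - a\<close>.\<close>
  define q where "q r a = ?c - y (?n - r, r - a) / 2" for r a
  have "q (Suc r) a \<le> q r a \<and> q r a \<le> q (Suc r) (Suc a)" if "r < ?n" "a < r" for r a
  proof -
    define s where "s = ?n - Suc r"
    have s: "?n - r = Suc s" using that by (simp add: s_def)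
    have "(Suc s, r - a) \<in> levels ?n" using that by (auto simp: levels_def s_def)
    then have "y (s, r - a) \<le> y (Suc s, r - a)" "y (Suc s, r - a) \<le> y (s, (r - a) + 1)"
      using y by (auto simp: gc_patterns_def)
    moreover have "Suc r - a = (r - a) + 1" using that by simp
    ultimately show ?thesis by (simp add: q_def s s_def[symmetric])
  qed
  then have "\<exists>x :: 'n cmat. cadj x = - x \<and> (\<forall>s j. 1 \<le> j \<longrightarrow> j \<le> ?n - s \<longrightarrow> gt s j x = q (?n - s) (j - 1))"
    by (intro pattern_realization) auto
  then obtain x :: "'n cmat" where x: "cadj x = - x"
    and gt: "\<And>s j. 1 \<le> j \<Longrightarrow> j \<le> ?n - s \<Longrightarrow> gt s j x = q (?n - s) (j - 1)" by blast
  have c: "?c = 1 - real k / real ?n" using k by (simp add: field_simps of_nat_diff)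
  have "x \<in> Gr k"
  proof (rule Gr_I_gt[OF k x])
    fix j assume j: "1 \<le> j" "j \<le> ?n"
    have "\<forall>i\<in>{1..?n}. y (0, i) = (if i \<le> k then 0 else 2)"
      using y by (simp add: gc_patterns_def)
    moreover have "?n - (j - 1) \<in> {1..?n}" using j by auto
    ultimately have Y: "y (0, ?n - (j - 1)) = (if ?n - (j - 1) \<le> k then 0 else 2)" by (rule bspec)
    have "gt 0 j x = 1 - real k / real ?n - y (0, ?n - (j - 1)) / 2"
      using gt[of j 0] j unfolding q_def c by simp
    then show "gt 0 j x = (if ?n - k < j then ?c else - real k / real ?n)"
      using j unfolding Y c by auto
  qed
  moreover have "gt_pattern k x (s, i) = y (s, i)" if "s < ?n" "1 \<le> i" "i \<le> ?n - s" for s i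
    using that gt[of "?n - s + 1 - i" s] by (simp add: gt_pattern_def q_def)
  ultimately show ?thesis by blast
qed

section \<open>The Nijenhuis tensor\<close>

lemma su_D: "X \<in> su \<Longrightarrow> cadj X = - X" "X \<in> su \<Longrightarrow> trace X = 0"
  by (auto simp: su_def)

lemma subspace_su: "subspace su"
  by (auto simp: subspace_def su_def cadj_simps trace_simps)

lemmas su_closed = subspace_0[OF subspace_su] subspace_add[OF subspace_su] subspace_diff[OF subspace_su]
  subspace_scale[OF subspace_su] subspace_neg[OF subspace_su]

lemma lie_bracket_simps:
  "lie_bracket (A + B) C = lie_bracket A C + lie_bracket B C" "lie_bracket A (B + C) = lie_bracket A B + lie_bracket A C"
  "lie_bracket (A - B) C = lie_bracket A C - lie_bracket B C" "lie_bracket A (B - C) = lie_bracket A B - lie_bracket A C"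
  "lie_bracket (- A) B = - lie_bracket A B" "lie_bracket A (- B) = - lie_bracket A B"
  "lie_bracket (r *\<^sub>R A) B = r *\<^sub>R lie_bracket A B" "lie_bracket A (r *\<^sub>R B) = r *\<^sub>R lie_bracket A B"
  by (simp_all add: lie_bracket_def mm_distrib algebra_simps)

lemma lie_bracket_skew:
  assumes "cadj A = - A" "cadj B = - B" shows "lie_bracket A B \<in> su"
  using assms by (simp add: su_def lie_bracket_def cadj_simps mm_distrib trace_simps trace_mul_sym[of B A])

lemma trace_lie_bracket: "trace (lie_bracket A B ** C) = trace (A ** lie_bracket B C)"
  using trace_mul_sym[of B "A ** C"]
  by (simp add: lie_bracket_def mm_distrib trace_simps mm_assoc)

lemma trace_lie_bracket_cycle: "trace (lie_bracket A B ** C) = trace (B ** lie_bracket C A)"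
  by (metis trace_mul_sym trace_lie_bracket)

lemma blinfun_trace_form: "blinfun_apply (trace_form X) Y = Re (trace (X ** Y))"
  by (simp add: trace_form_def bounded_linear_Blinfun_apply bounded_linear_trace_form)

lemma blinfun_right_translation: "blinfun_apply (right_translation h) A = A ** h"
  by (simp add: right_translation_def bounded_linear_Blinfun_apply bounded_linear_right_translation)

text \<open>On skew-Hermitian matrices the trace form is negative definite. Nondegeneracy and the
  representation of functionals both come from this.\<close>

lemma skew_inner: "cadj X = - X \<Longrightarrow> Re (trace (X ** Y)) = - (X \<bullet> Y)"
proof -
  assume X: "cadj X = - X"
  have "cnj (X $ j $ i) = - X $ i $ j" for i j
    using arg_cong[OF X, of "\<lambda>A. A $ i $ j"] by simp
  then have "trace (X ** Y) = (\<Sum>i\<in>UNIV. \<Sum>j\<in>UNIV. - (cnj (X $ j $ i) * Y $ j $ i))"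
    by (simp add: trace_def matrix_matrix_mult_def)
  also have "\<dots> = (\<Sum>j\<in>UNIV. \<Sum>i\<in>UNIV. - (cnj (X $ j $ i) * Y $ j $ i))" by (rule sum.swap)
  finally show ?thesis by (simp add: inner_vec_def inner_complex_def sum_negf)
qed

lemma skew_trace_product_real: "cadj X = - X \<Longrightarrow> cadj Y = - Y \<Longrightarrow> Im (trace (X ** Y)) = 0"
proof -
  assume "cadj X = - X" "cadj Y = - Y"
  then have "cnj (trace (X ** Y)) = trace (X ** Y)"
    by (simp add: trace_cadj[symmetric] cadj_simps mm_distrib trace_mul_sym[of Y X])
  then show ?thesis by (simp add: complex_eq_iff)
qed

section \<open>Covectors represented in su\<close>

text \<open>The inverse of the trace form identification. By \<open>su_rep_eqI\<close> the choice is
  unique, and it depends only on the restriction of the functional to \<open>su\<close>.\<close>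

definition su_rep :: "('n::finite cmat \<Rightarrow>\<^sub>L real) \<Rightarrow> 'n cmat" where
  "su_rep \<alpha> = (SOME X. X \<in> su \<and> (\<forall>Y\<in>su. blinfun_apply \<alpha> Y = Re (trace (X ** Y))))"

lemma su_rep_exists: "\<exists>X\<in>su. \<forall>Y\<in>su. blinfun_apply \<alpha> Y = Re (trace (X ** Y))"
proof -
  define a where "a = (\<Sum>b\<in>Basis. blinfun_apply \<alpha> b *\<^sub>R b)"
  have a: "blinfun_apply \<alpha> Y = a \<bullet> Y" for Y
  proof -
    have "blinfun_apply \<alpha> Y = blinfun_apply \<alpha> (\<Sum>b\<in>Basis. (Y \<bullet> b) *\<^sub>R b)" by (simp add: euclidean_representation)
    also have "\<dots> = (\<Sum>b\<in>Basis. blinfun_apply \<alpha> b * (b \<bullet> Y))"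
      unfolding blinfun.sum_right blinfun.scaleR_right
      by (intro sum.cong refl) (simp add: inner_commute)
    also have "\<dots> = a \<bullet> Y" by (simp add: a_def inner_sum_left)
    finally show ?thesis .
  qed
  obtain y z where yz: "y \<in> span su" "\<And>w. w \<in> span su \<Longrightarrow> orthogonal z w" "a = y + z"
    using orthogonal_subspace_decomp_exists[of su a] by metis
  have span: "span su = (su :: 'a cmat set)" using subspace_su by (simp add: span_eq_iff)
  have y: "y \<in> su" using yz(1) span by simp
  have "blinfun_apply \<alpha> Y = Re (trace ((- y) ** Y))" if "Y \<in> su" for Y
  proof -
    have "z \<bullet> Y = 0" using yz(2) that span by (simp add: orthogonal_def)
    then show ?thesis
      using skew_inner[OF su_D(1)[OF y], of Y] by (simp add: a yz(3) inner_add_left mm_distrib trace_simps)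
  qed
  moreover have "- y \<in> su" using y by (rule su_closed)
  ultimately show ?thesis by blast
qed

lemma su_rep: "su_rep \<alpha> \<in> su" "Y \<in> su \<Longrightarrow> blinfun_apply \<alpha> Y = Re (trace (su_rep \<alpha> ** Y))"
  using someI_ex[OF su_rep_exists[of \<alpha>, unfolded Bex_def]] unfolding su_rep_def[symmetric] by auto

lemma su_rep_eqI:
  assumes X: "X \<in> su" "\<And>Y. Y \<in> su \<Longrightarrow> blinfun_apply \<alpha> Y = Re (trace (X ** Y))"
  shows "su_rep \<alpha> = X"
proof -
  define D where "D = su_rep \<alpha> - X"
  have D: "D \<in> su" unfolding D_def using su_rep(1) X(1) by (rule su_closed)
  have "Re (trace (D ** D)) = 0"
    using su_rep(2)[OF D, of \<alpha>] X(2)[OF D] unfolding D_def[symmetric]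
    by (simp add: D_def mm_distrib(3) trace_simps(2))
  then have "D = 0" using skew_inner[OF su_D(1)[OF D], of D] by simp
  then show ?thesis by (simp add: D_def)
qed

lemma su_rep_trace_form: "X \<in> su \<Longrightarrow> su_rep (trace_form X) = X"
  by (rule su_rep_eqI) (simp_all add: blinfun_trace_form)

lemma linear_su_rep: "linear su_rep"
proof (rule linearI)
  show "su_rep (\<alpha> + \<beta>) = su_rep \<alpha> + su_rep \<beta>" for \<alpha> \<beta> :: "'a cmat \<Rightarrow>\<^sub>L real"
    by (intro su_rep_eqI) (auto intro: su_closed su_rep(1) simp: su_rep(2) blinfun.add_left mm_distrib trace_simps)
  show "su_rep (c *\<^sub>R \<alpha>) = c *\<^sub>R su_rep \<alpha>" for c and \<alpha> :: "'a cmat \<Rightarrow>\<^sub>L real"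
    by (intro su_rep_eqI) (auto intro: su_closed su_rep(1) simp: su_rep(2) blinfun.scaleR_left mm_distrib trace_simps)
qed

lemma blinfun_separates:
  fixes v w :: "'a::euclidean_space"
  assumes "\<And>\<beta> :: 'a \<Rightarrow>\<^sub>L real. blinfun_apply \<beta> v = blinfun_apply \<beta> w"
  shows "v = w"
proof -
  have "blinfun_apply (Blinfun (\<lambda>y. y \<bullet> (v - w))) y = y \<bullet> (v - w)" for y
    by (simp add: bounded_linear_Blinfun_apply bounded_linear_inner_left)
  then have "v \<bullet> (v - w) = w \<bullet> (v - w)" using assms by metis
  then have "(v - w) \<bullet> (v - w) = 0" by (simp add: inner_diff_left)
  then show ?thesis by simp
qed

lemma sharp_eqI:
  fixes v :: "'a::euclidean_space"
  assumes "\<And>\<beta>. blinfun_apply \<beta> v = P \<alpha> \<beta>"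
  shows "sharp P \<alpha> = v"
  unfolding sharp_def
proof (rule the_equality)
  show "\<forall>\<beta>. blinfun_apply \<beta> v = P \<alpha> \<beta>" using assms by simp
  show "w = v" if "\<forall>\<beta>. blinfun_apply \<beta> w = P \<alpha> \<beta>" for w
    by (rule blinfun_separates) (simp add: assms that)
qed

lemma bivector_on_skew:
  assumes "bivector_on T P" shows "P \<alpha> \<beta> = - P \<beta> \<alpha>"
proof -
  have b: "bilinear P" and 0: "\<And>\<alpha>. P \<alpha> \<alpha> = 0" using assms by (auto simp: bivector_on_def)
  have "P (\<alpha> + \<beta>) (\<alpha> + \<beta>) = P \<alpha> \<alpha> + P \<alpha> \<beta> + (P \<beta> \<alpha> + P \<beta> \<beta>)"
    by (simp add: bilinear_ladd[OF b] bilinear_radd[OF b])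
  then show ?thesis by (simp add: 0)
qed

text \<open>A bivector sees a covector only through its restriction to \<open>T\<close>, by skew
  symmetry in both arguments. Agreement on a set of representatives therefore suffices, which
  settles the uniqueness in the definite descriptions of \<open>kks\<close> and
  \<open>std_poisson_lie\<close>.\<close>

lemma bivector_on_eqI:
  assumes P: "bivector_on T P" and Q: "bivector_on T Q"
    and e: "\<And>\<alpha>. \<exists>\<alpha>'\<in>S. \<forall>v\<in>T. blinfun_apply \<alpha> v = blinfun_apply \<alpha>' v"
    and eq: "\<And>\<alpha> \<beta>. \<alpha> \<in> S \<Longrightarrow> \<beta> \<in> S \<Longrightarrow> P \<alpha> \<beta> = Q \<alpha> \<beta>"
  shows "P = Q"
proof (intro ext)
  fix \<alpha> \<beta>
  obtain \<alpha>' where a: "\<alpha>' \<in> S" "\<forall>v\<in>T. blinfun_apply \<alpha> v = blinfun_apply \<alpha>' v" using e by blast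
  obtain \<beta>' where b: "\<beta>' \<in> S" "\<forall>v\<in>T. blinfun_apply \<beta> v = blinfun_apply \<beta>' v" using e by blast
  have red: "R \<alpha> \<beta> = R \<alpha>' \<beta>'" if R: "bivector_on T R" for R
  proof -
    have bil: "bilinear R" using R by (simp add: bivector_on_def)
    have one: "R \<gamma> \<delta> = R \<gamma>' \<delta>" if "\<forall>v\<in>T. blinfun_apply \<gamma> v = blinfun_apply \<gamma>' v" for \<gamma> \<gamma>' \<delta>
    proof -
      have "\<forall>v\<in>T. blinfun_apply (\<gamma> - \<gamma>') v = 0" using that by (simp add: blinfun.diff_left)
      then have "R (\<gamma> - \<gamma>') \<delta> = 0" using R by (auto simp: bivector_on_def)
      then show ?thesis by (simp add: bilinear_lsub[OF bil])
    qed
    have "R \<alpha> \<beta> = R \<alpha>' \<beta>" by (rule one[OF a(2)])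
    also have "\<dots> = - R \<beta> \<alpha>'" by (rule bivector_on_skew[OF R])
    also have "\<dots> = - R \<beta>' \<alpha>'" by (simp add: one[OF b(2)])
    also have "\<dots> = R \<alpha>' \<beta>'" by (rule bivector_on_skew[OF R, symmetric])
    finally show ?thesis .
  qed
  show "P \<alpha> \<beta> = Q \<alpha> \<beta>" using red[OF P] red[OF Q] eq[OF a(1) b(1)] by simp
qed

section \<open>The Kirillov-Kostant-Souriau bivector\<close>

lemma tangent_orbit_su: "cadj x = - x \<Longrightarrow> tangent_orbit x \<subseteq> su"
  by (auto simp: tangent_orbit_def intro!: lie_bracket_skew su_D)

lemma bilinear_trace_form:
  assumes f: "linear (f :: 'a::real_vector \<Rightarrow> 'n::finite cmat)" and h: "linear h"
  shows "bilinear (\<lambda>\<alpha> \<beta>. Re (trace (f \<alpha> ** h \<beta>)))"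
  unfolding bilinear_def
  by (auto intro!: linearI simp: linear_add[OF f] linear_add[OF h] linear_cmul[OF f] linear_cmul[OF h]
      mm_distrib trace_simps)

lemma linear_lie_bracket: "linear f \<Longrightarrow> linear (\<lambda>\<alpha>. lie_bracket x (f \<alpha>))"
  by (rule linearI) (simp_all add: linear_add linear_cmul lie_bracket_simps)

lemma bivector_lie:
  fixes x :: "('n::finite) cmat"
  assumes x: "cadj x = - x"
  shows "bivector_on (tangent_orbit x) (\<lambda>\<alpha> \<beta>. Re (trace (lie_bracket x (su_rep \<alpha>) ** su_rep \<beta>)))"
  unfolding bivector_on_def
proof (intro conjI allI impI)
  show "bilinear (\<lambda>\<alpha> \<beta>. Re (trace (lie_bracket x (su_rep \<alpha>) ** su_rep \<beta>)))"
    by (intro bilinear_trace_form linear_lie_bracket linear_su_rep)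
  show "Re (trace (lie_bracket x (su_rep \<alpha>) ** su_rep \<alpha>)) = 0" for \<alpha>
    by (simp add: trace_lie_bracket) (simp add: lie_bracket_def trace_simps mm_distrib)
  fix \<alpha> \<beta> :: "'n cmat \<Rightarrow>\<^sub>L real"
  assume 0: "\<forall>v\<in>tangent_orbit x. blinfun_apply \<alpha> v = 0"
  have v: "lie_bracket (su_rep \<beta>) x \<in> tangent_orbit x" by (auto simp: tangent_orbit_def su_rep)
  have "Re (trace (lie_bracket x (su_rep \<alpha>) ** su_rep \<beta>)) = Re (trace (su_rep \<alpha> ** lie_bracket (su_rep \<beta>) x))"
    by (simp only: trace_lie_bracket_cycle)
  also have "\<dots> = blinfun_apply \<alpha> (lie_bracket (su_rep \<beta>) x)"
    using v tangent_orbit_su[OF x] by (intro su_rep(2)[symmetric]) auto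
  finally show "Re (trace (lie_bracket x (su_rep \<alpha>) ** su_rep \<beta>)) = 0" using 0 v by simp
qed

lemma kks_eq:
  assumes x: "cadj x = - x"
  shows "kks x = (\<lambda>\<alpha> \<beta>. Re (trace (lie_bracket x (su_rep \<alpha>) ** su_rep \<beta>)))" (is "_ = ?P")
  unfolding kks_def
proof (rule the_equality)
  have "Re (trace (lie_bracket x X ** Y)) = Re (trace (x ** lie_bracket X Y))" for X Y
    by (simp add: trace_lie_bracket)
  then show P: "bivector_on (tangent_orbit x) ?P \<and>
     (\<forall>X\<in>su. \<forall>Y\<in>su. ?P (trace_form X) (trace_form Y) = Re (trace (x ** lie_bracket X Y)))"
    using bivector_lie[OF x] by (simp add: su_rep_trace_form)
  fix Q assume Q: "bivector_on (tangent_orbit x) Q \<and>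
     (\<forall>X\<in>su. \<forall>Y\<in>su. Q (trace_form X) (trace_form Y) = Re (trace (x ** lie_bracket X Y)))"
  show "Q = ?P"
  proof (rule bivector_on_eqI[where S = "trace_form ` su"])
    show "\<exists>\<alpha>'\<in>trace_form ` su. \<forall>v\<in>tangent_orbit x. blinfun_apply \<alpha> v = blinfun_apply \<alpha>' v" for \<alpha>
      using tangent_orbit_su[OF x]
      by (intro bexI[of _ "trace_form (su_rep \<alpha>)"]) (auto simp: blinfun_trace_form su_rep)
  qed (use P Q in auto)
qed

lemma sharp_kks:
  assumes x: "cadj x = - x" shows "sharp (kks x) \<alpha> = lie_bracket x (su_rep \<alpha>)"
proof (rule sharp_eqI)
  fix \<beta>
  have "lie_bracket x (su_rep \<alpha>) \<in> su" using x by (intro lie_bracket_skew su_D(1)[OF su_rep(1)])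
  then show "blinfun_apply \<beta> (lie_bracket x (su_rep \<alpha>)) = kks x \<alpha> \<beta>"
    by (simp only: kks_eq[OF x] su_rep(2) trace_mul_sym[of "su_rep \<beta>" "lie_bracket x (su_rep \<alpha>)"])
qed

text \<open>The functional picked by \<open>flat\<close> is determined only modulo the annihilator
  of the tangent space. Its bracket with \<open>x\<close> is independent of the choice, and it is
  all that enters the Nijenhuis tensor.\<close>

lemma flat_kks:
  assumes x: "cadj x = - x" and v: "v \<in> tangent_orbit x"
  shows "lie_bracket x (su_rep (flat (kks x) v)) = v"
proof -
  obtain Z where Z: "Z \<in> su" "v = lie_bracket Z x" using v by (auto simp: tangent_orbit_def)
  then have "- Z \<in> su" by (simp add: su_closed)
  then have "sharp (kks x) (trace_form (- Z)) = v"
    by (simp add: sharp_kks[OF x] su_rep_trace_form Z(2) lie_bracket_def mm_distrib)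
  then have "sharp (kks x) (flat (kks x) v) = v"
    unfolding flat_def by (rule someI)
  then show ?thesis by (simp add: sharp_kks[OF x])
qed

section \<open>The standard Poisson-Lie structure\<close>

lemma J_op_nth: "J_op Z $ i $ j = (if i < j then \<i> * Z $ i $ j else if j < i then - \<i> * Z $ i $ j else 0)"
  by (simp add: J_op_def)

lemma linear_J_op: "linear J_op"
  by (rule linearI) (simp_all add: vec_eq_iff J_op_nth algebra_simps)

lemma J_op_skew: "cadj Z = - Z \<Longrightarrow> cadj (J_op Z) = - J_op Z"
proof -
  assume Z: "cadj Z = - Z"
  have "cnj (Z $ j $ i) = - Z $ i $ j" for i j
    using arg_cong[OF Z, of "\<lambda>A. A $ i $ j"] by simp
  then show ?thesis by (auto simp: vec_eq_iff J_op_nth)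
qed

lemma J_op_su: "Z \<in> su \<Longrightarrow> J_op Z \<in> su"
  using J_op_skew by (auto simp: su_def trace_def J_op_nth)

text \<open>\<open>J_op\<close> is skew for the trace form, because its sign changes when the two
  indices are exchanged.\<close>

lemma trace_J_op_self: "trace (J_op Z ** Z) = 0"
proof -
  define s where "s i j = (if i < j then \<i> else if j < i then - \<i> else (0 :: complex))" for i j :: 'a
  have "trace (J_op Z ** Z) = (\<Sum>i\<in>UNIV. \<Sum>j\<in>UNIV. s i j * (Z $ i $ j * Z $ j $ i))"
    unfolding trace_def matrix_matrix_mult_def by (auto simp: s_def J_op_nth intro!: sum.cong)
  also have "\<dots> = (\<Sum>j\<in>UNIV. \<Sum>i\<in>UNIV. s i j * (Z $ i $ j * Z $ j $ i))" by (rule sum.swap)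
  also have "\<dots> = (\<Sum>j\<in>UNIV. \<Sum>i\<in>UNIV. - (s j i * (Z $ j $ i * Z $ i $ j)))"
    by (intro sum.cong refl) (auto simp: s_def)
  also have "\<dots> = - trace (J_op Z ** Z)"
    unfolding trace_def matrix_matrix_mult_def
    by (simp add: sum_negf) (auto simp: s_def J_op_nth intro!: sum.cong)
  finally show ?thesis by (simp add: eq_neg_iff_add_eq_0)
qed

lemma C_minus_eq: "C_minus Z = cs \<i> Z - J_op Z"
  by (simp add: vec_eq_iff C_minus_def)

text \<open>Directness of the sum of \<open>su\<close> and \<open>b_minus\<close>:
  \<open>C_minus Z\<close> has no strictly upper part and a real diagonal, while skew-Hermitian
  matrices have an imaginary diagonal and a lower part determined by the upper one.\<close>

lemma C_minus_in_su_imp_0: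
  assumes Z: "Z \<in> su" and C: "C_minus Z \<in> su" shows "C_minus Z = 0"
proof -
  have c: "cnj (C_minus Z $ j $ i) = - C_minus Z $ i $ j" for i j
    using arg_cong[OF su_D(1)[OF C], of "\<lambda>A. A $ i $ j"] by simp
  have z: "cnj (Z $ i $ i) = - Z $ i $ i" for i
    using arg_cong[OF su_D(1)[OF Z], of "\<lambda>A. A $ i $ i"] by simp
  have up: "C_minus Z $ i $ j = 0" if "i < j" for i j
    using that by (simp add: C_minus_eq J_op_nth)
  have "C_minus Z $ i $ j = 0" for i j
  proof (cases i j rule: linorder_cases)
    case equal
    then show ?thesis using c[of i i] z[of i] by (simp add: C_minus_eq J_op_nth complex_eq_iff)
  next
    case greater
    then have "cnj (C_minus Z $ i $ j) = 0" using c[of i j] up[OF greater] by simp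
    then show ?thesis by simp
  qed (rule up)
  then show ?thesis by (simp add: vec_eq_iff)
qed

lemma C_minus_diff: "C_minus (A - B) = C_minus A - C_minus B"
  by (simp add: C_minus_eq cs_simps linear_diff[OF linear_J_op])

lemma pr_unique:
  assumes "X \<in> su" "Z \<in> su" "X' \<in> su" "Z' \<in> su" "X + C_minus Z = X' + C_minus Z'"
  shows "X' = X" "C_minus Z' = C_minus Z"
proof -
  have d: "X - X' = C_minus (Z' - Z)" using assms(5) by (simp add: C_minus_diff algebra_simps)
  have "X - X' \<in> su" "Z' - Z \<in> su" using assms by (auto intro: su_closed)
  then have "C_minus (Z' - Z) = 0" using d by (intro C_minus_in_su_imp_0) auto
  then show "X' = X" "C_minus Z' = C_minus Z" using d by (auto simp: C_minus_diff)
qed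

lemma pr_eq:
  assumes X: "X \<in> su" and Z: "Z \<in> su"
  shows "pr_g (X + C_minus Z) = X" "pr_b (X + C_minus Z) = C_minus Z"
proof -
  show "pr_g (X + C_minus Z) = X"
    unfolding pr_g_def b_minus_def
  proof (rule the_equality)
    show "X' = X" if "X' \<in> su \<and> (\<exists>B\<in>C_minus ` su. X + C_minus Z = X' + B)" for X'
      using that pr_unique(1)[OF X Z] by blast
  qed (use X Z in auto)
  show "pr_b (X + C_minus Z) = C_minus Z"
    unfolding pr_b_def b_minus_def
  proof (rule the_equality)
    show "B = C_minus Z" if "B \<in> C_minus ` su \<and> (\<exists>X'\<in>su. X + C_minus Z = X' + B)" for B
      using that pr_unique(2)[OF X Z] by blast
  qed (use X Z in auto)
qed

lemma Ad_su: "g \<in> SU \<Longrightarrow> X \<in> su \<Longrightarrow> cadj g ** X ** g \<in> su"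
  using trace_mul_sym[of "cadj g" "X ** g"]
  by (auto simp: su_def cadj_simps mm_distrib mm_assoc SU_D)

text \<open>The r-matrix \<open>J_op\<close>, conjugated by \<open>g\<close>, minus itself: the
  coboundary form of the right translated Poisson-Lie structure.\<close>

definition pl_form :: "('n::{finite,linorder}) cmat \<Rightarrow> 'n cmat \<Rightarrow> 'n cmat \<Rightarrow> real" where
  "pl_form g \<xi> \<eta> = Re (trace (J_op (cadj g ** \<xi> ** g) ** (cadj g ** \<eta> ** g))) - Re (trace (J_op \<xi> ** \<eta>))"

text \<open>The factor \<open>\<i>\<close> in \<open>C_minus\<close> turns the imaginary part of the
  trace into a real part; its \<open>J_op\<close> part contributes nothing, since the trace of a
  product of two skew-Hermitian matrices is real.\<close>

lemma pl_form_eq: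
  assumes g: "g \<in> SU" and \<xi>: "\<xi> \<in> su" and \<eta>: "\<eta> \<in> su"
  shows "Im (trace (pr_g (cadj g ** C_minus \<xi> ** g) ** pr_b (cadj g ** C_minus \<eta> ** g))) = pl_form g \<xi> \<eta>"
proof -
  let ?Ad = "\<lambda>X. cadj g ** X ** g"
  \<comment> \<open>Adding and subtracting \<open>J_op (?Ad X)\<close> exhibits both projections at
    once.\<close>
  have dec: "?Ad (C_minus X) = (J_op (?Ad X) - ?Ad (J_op X)) + C_minus (?Ad X)" for X
    by (simp add: C_minus_eq mm_distrib)
  have su: "J_op (?Ad X) - ?Ad (J_op X) \<in> su" "?Ad X \<in> su" if "X \<in> su" for X
    using that g by (auto intro!: su_closed J_op_su Ad_su)
  let ?U = "J_op (?Ad \<xi>) - ?Ad (J_op \<xi>)"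
  note U = su_D(1)[OF su(1)[OF \<xi>]] and V = su_D(1)[OF su(2)[OF \<eta>]]
  have "Im (trace (pr_g (?Ad (C_minus \<xi>)) ** pr_b (?Ad (C_minus \<eta>)))) = Im (trace (?U ** C_minus (?Ad \<eta>)))"
    unfolding dec pr_eq[OF su(1)[OF \<xi>] su(2)[OF \<xi>]] pr_eq[OF su(1)[OF \<eta>] su(2)[OF \<eta>]] ..
  also have "\<dots> = Re (trace (?U ** ?Ad \<eta>)) - Im (trace (?U ** J_op (?Ad \<eta>)))"
    unfolding C_minus_eq mm_distrib(4)[of ?U] mm_distrib(10)[of ?U] trace_simps(2,4) by simp
  also have "Im (trace (?U ** J_op (?Ad \<eta>))) = 0"
    by (rule skew_trace_product_real[OF U J_op_skew[OF V]])
  also have "Re (trace (?U ** ?Ad \<eta>)) - 0 = Re (trace (J_op (?Ad \<xi>) ** ?Ad \<eta>)) - Re (trace (?Ad (J_op \<xi>) ** ?Ad \<eta>))"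
    by (simp add: mm_distrib(3) trace_simps(2))
  also have "trace (?Ad (J_op \<xi>) ** ?Ad \<eta>) = trace (cadj g ** (J_op \<xi> ** \<eta> ** g))"
    using g by (simp add: mm_assoc SU_D)
  also have "\<dots> = trace (J_op \<xi> ** \<eta>)"
    unfolding trace_mul_sym[of "cadj g"] using g by (simp add: mm_assoc SU_D)
  finally show ?thesis by (simp only: pl_form_def)
qed

lemma linear_Ad:
  fixes f :: "'a::real_vector \<Rightarrow> ('n::finite) cmat" and A B :: "'n cmat"
  shows "linear f \<Longrightarrow> linear (\<lambda>\<alpha>. A ** f \<alpha> ** B)"
  by (rule linearI) (simp_all add: linear_add linear_cmul mm_distrib)

lemma bilinear_pl_form:
  assumes f: "linear (f :: 'a::real_vector \<Rightarrow> ('n::{finite,linorder}) cmat)"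
  shows "bilinear (\<lambda>\<alpha> \<beta>. pl_form g (f \<alpha>) (f \<beta>))"
proof -
  have J: "linear (\<lambda>\<alpha>. J_op (h \<alpha>))" if "linear h" for h :: "'a \<Rightarrow> 'n cmat"
    using linear_compose[OF that linear_J_op] by (simp add: o_def)
  have "bilinear (\<lambda>\<alpha> \<beta>. Re (trace (J_op (cadj g ** f \<alpha> ** g) ** (cadj g ** f \<beta> ** g))))"
    "bilinear (\<lambda>\<alpha> \<beta>. Re (trace (J_op (f \<alpha>) ** f \<beta>)))"
    by (intro bilinear_trace_form J linear_Ad f)+
  then show ?thesis unfolding pl_form_def bilinear_def by (auto intro: linear_compose_sub)
qed

lemma pl_form_self: "pl_form g \<xi> \<xi> = 0"
  by (simp add: pl_form_def trace_J_op_self)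

lemma std_poisson_lie_eq:
  fixes g :: "('n::{finite,linorder}) cmat"
  assumes g: "g \<in> SU"
  shows "std_poisson_lie g = (\<lambda>\<alpha> \<beta>. pl_form g (su_rep (\<alpha> o\<^sub>L right_translation g)) (su_rep (\<beta> o\<^sub>L right_translation g)))"
    (is "_ = ?P")
  unfolding std_poisson_lie_def
proof (rule the_equality)
  have lin: "linear (\<lambda>\<alpha> :: 'n cmat \<Rightarrow>\<^sub>L real. su_rep (\<alpha> o\<^sub>L right_translation g))"
  proof (rule linearI)
    fix \<alpha> \<beta> :: "'n cmat \<Rightarrow>\<^sub>L real" and c :: real
    have "(\<alpha> + \<beta>) o\<^sub>L right_translation g = (\<alpha> o\<^sub>L right_translation g) + (\<beta> o\<^sub>L right_translation g)"
      "(c *\<^sub>R \<alpha>) o\<^sub>L right_translation g = c *\<^sub>R (\<alpha> o\<^sub>L right_translation g)"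
      by (intro blinfun_eqI; simp add: blinfun.add_left blinfun.scaleR_left)+
    then show "su_rep ((\<alpha> + \<beta>) o\<^sub>L right_translation g) =
        su_rep (\<alpha> o\<^sub>L right_translation g) + su_rep (\<beta> o\<^sub>L right_translation g)"
      "su_rep ((c *\<^sub>R \<alpha>) o\<^sub>L right_translation g) = c *\<^sub>R su_rep (\<alpha> o\<^sub>L right_translation g)"
      by (simp_all only: linear_add[OF linear_su_rep] linear_cmul[OF linear_su_rep])
  qed
  have biv: "bivector_on (tangent_group g) ?P"
    unfolding bivector_on_def
  proof (intro conjI allI impI)
    show "bilinear ?P" by (rule bilinear_pl_form[OF lin])
    fix \<alpha> \<beta> :: "'n cmat \<Rightarrow>\<^sub>L real" assume "\<forall>v\<in>tangent_group g. blinfun_apply \<alpha> v = 0"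
    then have "su_rep (\<alpha> o\<^sub>L right_translation g) = 0"
      by (intro su_rep_eqI)
        (auto simp: su_closed blinfun_right_translation tangent_group_def mm_distrib trace_simps)
    then show "?P \<alpha> \<beta> = 0" using bilinear_lzero[OF bilinear_pl_form[OF linear_id, of g]] by (simp add: id_def)
  qed (rule pl_form_self)
  have "trace_form X o\<^sub>L right_translation (cadj g) o\<^sub>L right_translation g = trace_form X" for X
    using g by (intro blinfun_eqI) (simp add: blinfun_trace_form blinfun_right_translation mm_assoc SU_D)
  then show P: "bivector_on (tangent_group g) ?P \<and> (\<forall>\<xi>\<in>su. \<forall>\<eta>\<in>su.
     push (right_translation (cadj g)) ?P (trace_form \<xi>) (trace_form \<eta>) =
        Im (trace (pr_g (cadj g ** C_minus \<xi> ** g) ** pr_b (cadj g ** C_minus \<eta> ** g))))"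
    using biv g by (simp add: push_def su_rep_trace_form pl_form_eq)
  fix Q assume Q: "bivector_on (tangent_group g) Q \<and> (\<forall>\<xi>\<in>su. \<forall>\<eta>\<in>su.
     push (right_translation (cadj g)) Q (trace_form \<xi>) (trace_form \<eta>) =
        Im (trace (pr_g (cadj g ** C_minus \<xi> ** g) ** pr_b (cadj g ** C_minus \<eta> ** g))))"
  let ?S = "(\<lambda>X. trace_form X o\<^sub>L right_translation (cadj g)) ` su"
  show "Q = ?P"
  proof (rule bivector_on_eqI[where S = ?S])
    show "\<exists>\<alpha>'\<in>?S. \<forall>v\<in>tangent_group g. blinfun_apply \<alpha> v = blinfun_apply \<alpha>' v" for \<alpha>
    proof (rule bexI)
      show "trace_form (su_rep (\<alpha> o\<^sub>L right_translation g)) o\<^sub>L right_translation (cadj g) \<in> ?S"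
        using su_rep(1) by blast
      have "blinfun_apply \<alpha> (X ** g) = Re (trace (su_rep (\<alpha> o\<^sub>L right_translation g) ** X))" if "X \<in> su" for X
        using su_rep(2)[OF that, of "\<alpha> o\<^sub>L right_translation g"] by (simp add: blinfun_right_translation)
      then show "\<forall>v\<in>tangent_group g. blinfun_apply \<alpha> v =
          blinfun_apply (trace_form (su_rep (\<alpha> o\<^sub>L right_translation g)) o\<^sub>L right_translation (cadj g)) v"
        using g by (auto simp: tangent_group_def blinfun_trace_form blinfun_right_translation mm_assoc SU_D)
    qed
  qed (use P Q in \<open>auto simp: push_def\<close>)
qed

section \<open>The quotient structure and the Nijenhuis tensor\<close>

text \<open>The square of \<open>ad x\<close> is -1 on the tangent space: differentiating
  \<open>P^2 = P\<close> gives \<open>P v + v P = v\<close> and \<open>P v P = 0\<close>. This is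
  the complex structure of a Hermitian symmetric space.\<close>

lemma Gr_double_bracket:
  fixes x :: "('n::{finite,linorder}) cmat"
  assumes k: "k \<le> CARD('n)" and x: "x \<in> Gr k" and v: "v \<in> tangent_orbit x"
  shows "lie_bracket (lie_bracket x v) x = v"
proof -
  obtain P where P: "projection k P" and xP: "x = cs \<i> (P - cs (of_nat k / of_nat CARD('n)) (mat 1))"
    using x Gr_iff[OF k] by blast
  have PP: "P ** P = P" "P ** (P ** A) = P ** A" for A
    using P by (auto simp: projection_def matrix_mul_assoc)
  have br: "lie_bracket x A = cs \<i> (P ** A - A ** P)" "lie_bracket A x = cs \<i> (A ** P - P ** A)" for A
    by (simp_all add: xP lie_bracket_def mm_distrib cs_simps)
  obtain Z where Z: "v = lie_bracket Z x" using v by (auto simp: tangent_orbit_def)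
  have PvP: "P ** (v ** P) = 0" by (simp add: Z br mm_distrib cs_simps PP mm_assoc)
  have "v ** P + P ** v = v" by (simp add: Z br mm_distrib cs_simps PP mm_assoc)
  moreover have "lie_bracket (lie_bracket x v) x = v ** P + P ** v"
    unfolding br by (simp add: mm_distrib cs_simps PP mm_assoc PvP)
  ultimately show ?thesis by simp
qed

text \<open>Brackets with \<open>rho k\<close> live in the two off-diagonal blocks, on which
  \<open>ad (rho k)\<close> multiplies by \<open>\<i>\<close> and \<open>- \<i>\<close>. The upper
  block lies strictly above the diagonal and the lower one strictly below, so there
  \<open>J_op\<close> is the same operator.\<close>

lemma J_op_rho:
  fixes A :: "('n::{finite,linorder}) cmat"
  assumes k: "k \<le> CARD('n)"
  shows "J_op (lie_bracket (rho k) A) = lie_bracket (rho k) (lie_bracket (rho k) A)"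
proof -
  let ?e = "\<lambda>i :: 'n. if pos i < k then 1 else (0 :: complex)"
  have br: "lie_bracket (rho k) B $ i $ j = \<i> * (?e i - ?e j) * B $ i $ j" for B i j
    by (simp add: rho_eq[OF k] lie_bracket_def mm_distrib cs_simps E_def diagm_mult algebra_simps)
  have "J_op (lie_bracket (rho k) A) $ i $ j = lie_bracket (rho k) (lie_bracket (rho k) A) $ i $ j" for i j
  proof -
    have "i < j \<longleftrightarrow> pos i < pos j" "j < i \<longleftrightarrow> pos j < pos i" by (simp_all add: pos_less_iff)
    then show ?thesis by (simp add: J_op_nth br)
  qed
  then show ?thesis by (simp add: vec_eq_iff)
qed

text \<open>What \<open>pl_form\<close> becomes on the orbit: the conjugated r-matrix turns into the
  bracket with \<open>x\<close>, the other one stays \<open>J_op\<close>.\<close>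

definition bruhat_vector :: "('n::{finite,linorder}) cmat \<Rightarrow> 'n cmat \<Rightarrow> 'n cmat" where
  "bruhat_vector x \<xi> = lie_bracket x \<xi> - J_op \<xi>"

text \<open>A covector pulled back to the group and translated to the identity is represented by
  \<open>[x, su_rep \<alpha>]\<close>. Conjugation carries it to a bracket with
  \<open>rho k\<close>, where \<open>J_op_rho\<close> applies; after conjugating back,
  \<open>g\<close> is gone, so the result depends on \<open>x\<close> alone and descends to the
  quotient.\<close>

lemma push_std_poisson_lie:
  fixes g :: "('n::{finite,linorder}) cmat"
  assumes k: "k \<le> CARD('n)" and g: "g \<in> SU" and x: "x = orbit_map k g" and xs: "cadj x = - x"
  shows "push (orbit_differential k g) (std_poisson_lie g) = (\<lambda>\<alpha> \<beta>.
    Re (trace (bruhat_vector x (lie_bracket x (su_rep \<alpha>)) ** lie_bracket x (su_rep \<beta>))))"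
proof (intro ext)
  fix \<alpha> \<beta> :: "'n cmat \<Rightarrow>\<^sub>L real"
  have rep: "su_rep (\<gamma> o\<^sub>L orbit_differential k g o\<^sub>L right_translation g) = lie_bracket x (su_rep \<gamma>)" for \<gamma>
  proof (rule su_rep_eqI)
    show "lie_bracket x (su_rep \<gamma>) \<in> su" using xs by (intro lie_bracket_skew su_D(1)[OF su_rep(1)])
    fix Y :: "'n cmat" assume Y: "Y \<in> su"
    have "lie_bracket Y x \<in> su" using xs Y by (intro lie_bracket_skew) (auto dest: su_D)
    then have "blinfun_apply \<gamma> (lie_bracket Y x) = Re (trace (su_rep \<gamma> ** lie_bracket Y x))" by (rule su_rep)
    also have "\<dots> = Re (trace (lie_bracket x (su_rep \<gamma>) ** Y))"
      by (simp only: trace_lie_bracket_cycle)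
    finally show "blinfun_apply (\<gamma> o\<^sub>L orbit_differential k g o\<^sub>L right_translation g) Y =
        Re (trace (lie_bracket x (su_rep \<gamma>) ** Y))"
      using orbit_differential_translate[OF g Y, of k] by (simp add: blinfun_right_translation x)
  qed
  let ?Ad = "\<lambda>X. cadj g ** X ** g"
  have Ad_x: "?Ad (lie_bracket x X) = lie_bracket (rho k) (?Ad X)" for X
    using g by (simp add: x orbit_map_def lie_bracket_def mm_distrib mm_assoc SU_D)
  have Ad_tr: "trace (?Ad X ** ?Ad Y) = trace (X ** Y)" for X Y
  proof -
    have "trace (?Ad X ** ?Ad Y) = trace (cadj g ** (X ** Y ** g))" using g by (simp add: mm_assoc SU_D)
    also have "\<dots> = trace (X ** Y)"
      unfolding trace_mul_sym[of "cadj g"] using g by (simp add: mm_assoc SU_D)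
    finally show ?thesis .
  qed
  let ?\<xi> = "lie_bracket x (su_rep \<alpha>)" and ?\<eta> = "lie_bracket x (su_rep \<beta>)"
  have "J_op (?Ad ?\<xi>) = ?Ad (lie_bracket x ?\<xi>)"
    unfolding Ad_x J_op_rho[OF k] ..
  then have "pl_form g ?\<xi> ?\<eta> = Re (trace (lie_bracket x ?\<xi> ** ?\<eta>)) - Re (trace (J_op ?\<xi> ** ?\<eta>))"
    unfolding pl_form_def by (simp only: Ad_tr)
  then show "push (orbit_differential k g) (std_poisson_lie g) \<alpha> \<beta> =
      Re (trace (bruhat_vector x ?\<xi> ** ?\<eta>))"
    by (simp add: push_def std_poisson_lie_eq[OF g] rep bruhat_vector_def mm_distrib(3) trace_simps(2))
qed

lemma bruhat_poisson_eq:
  fixes x :: "('n::{finite,linorder}) cmat"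
  assumes k: "k \<le> CARD('n)" and x: "x \<in> Gr k" and xs: "cadj x = - x"
  shows "bruhat_poisson k x = (\<lambda>\<alpha> \<beta>.
    Re (trace (bruhat_vector x (lie_bracket x (su_rep \<alpha>)) ** lie_bracket x (su_rep \<beta>))))" (is "_ = ?P")
  unfolding bruhat_poisson_def
proof (rule the_equality)
  obtain g where g: "g \<in> SU" "orbit_map k g = x" using x by (auto simp: Gr_def)
  have push: "push (orbit_differential k g) (std_poisson_lie g) = ?P" if "g \<in> SU" "orbit_map k g = x" for g
    by (rule push_std_poisson_lie[OF k that(1) that(2)[symmetric] xs])
  have lin: "linear (\<lambda>\<alpha> :: 'n cmat \<Rightarrow>\<^sub>L real. lie_bracket x (su_rep \<alpha>))"
    by (rule linear_lie_bracket[OF linear_su_rep])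
  have linb: "linear (\<lambda>\<alpha> :: 'n cmat \<Rightarrow>\<^sub>L real. bruhat_vector x (lie_bracket x (su_rep \<alpha>)))"
    unfolding bruhat_vector_def
    using linear_compose[OF lin linear_J_op]
    by (intro linear_compose_sub linear_lie_bracket[OF lin]) (simp add: o_def)
  have "bivector_on (tangent_orbit x) ?P"
    unfolding bivector_on_def
  proof (intro conjI allI impI)
    show "bilinear ?P" by (rule bilinear_trace_form[OF linb lin])
    show "?P \<alpha> \<alpha> = 0" for \<alpha>
    proof -
      have "trace (lie_bracket x A ** A) = 0" for A
        by (simp add: trace_lie_bracket) (simp add: lie_bracket_def trace_simps mm_distrib)
      then show ?thesis by (simp add: bruhat_vector_def mm_distrib(3) trace_simps(2) trace_J_op_self)
    qed
    fix \<alpha> \<beta> :: "'n cmat \<Rightarrow>\<^sub>L real" assume 0: "\<forall>v\<in>tangent_orbit x. blinfun_apply \<alpha> v = 0"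
    let ?\<xi> = "lie_bracket x (su_rep \<alpha>)"
    have \<xi>: "?\<xi> \<in> su" using xs by (intro lie_bracket_skew su_D(1)[OF su_rep(1)])
    have t: "lie_bracket ?\<xi> x \<in> tangent_orbit x" using \<xi> by (auto simp: tangent_orbit_def)
    \<comment> \<open>A functional vanishing on the tangent space is tested on
      \<open>[?\<xi>, x]\<close>; negative definiteness of the trace form then gives
      \<open>?\<xi> = 0\<close>.\<close>
    have "Re (trace (?\<xi> ** ?\<xi>)) = Re (trace (su_rep \<alpha> ** lie_bracket ?\<xi> x))"
      by (simp only: trace_lie_bracket_cycle)
    also have "\<dots> = blinfun_apply \<alpha> (lie_bracket ?\<xi> x)"
      using t tangent_orbit_su[OF xs] by (intro su_rep(2)[symmetric]) auto
    also have "\<dots> = 0" using 0 t by blast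
    finally have "?\<xi> = 0" using skew_inner[OF su_D(1)[OF \<xi>], of ?\<xi>] by simp
    then show "?P \<alpha> \<beta> = 0"
      by (simp add: bruhat_vector_def lie_bracket_def mm_distrib linear_0[OF linear_J_op] trace_simps)
  qed
  then show "bivector_on (tangent_orbit x) ?P \<and>
     (\<forall>g\<in>SU. orbit_map k g = x \<longrightarrow> push (orbit_differential k g) (std_poisson_lie g) = ?P)"
    using push by blast
  show "Q = ?P" if "bivector_on (tangent_orbit x) Q \<and>
     (\<forall>g\<in>SU. orbit_map k g = x \<longrightarrow> push (orbit_differential k g) (std_poisson_lie g) = Q)" for Q
    using that g push by metis
qed

lemma sharp_bruhat_poisson:
  fixes x :: "('n::{finite,linorder}) cmat"
  assumes k: "k \<le> CARD('n)" and x: "x \<in> Gr k" and xs: "cadj x = - x"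
  shows "sharp (bruhat_poisson k x) \<alpha> = lie_bracket (bruhat_vector x (lie_bracket x (su_rep \<alpha>))) x"
proof (rule sharp_eqI)
  fix \<beta> :: "'n cmat \<Rightarrow>\<^sub>L real"
  let ?W = "bruhat_vector x (lie_bracket x (su_rep \<alpha>))"
  have 1: "lie_bracket x (su_rep \<alpha>) \<in> su" using xs by (intro lie_bracket_skew su_D(1)[OF su_rep(1)])
  then have "lie_bracket x (lie_bracket x (su_rep \<alpha>)) \<in> su"
    using xs by (intro lie_bracket_skew) (auto dest: su_D)
  then have W: "?W \<in> su" unfolding bruhat_vector_def using J_op_su[OF 1] by (intro su_closed)
  then have "lie_bracket ?W x \<in> su" using xs by (intro lie_bracket_skew) (auto dest: su_D)
  then have "blinfun_apply \<beta> (lie_bracket ?W x) = Re (trace (su_rep \<beta> ** lie_bracket ?W x))" by (rule su_rep)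
  also have "\<dots> = Re (trace (?W ** lie_bracket x (su_rep \<beta>)))"
    using trace_lie_bracket_cycle[of x "su_rep \<beta>" ?W] trace_mul_sym[of ?W] by metis
  finally show "blinfun_apply \<beta> (lie_bracket ?W x) = bruhat_poisson k x \<alpha> \<beta>"
    by (simp add: bruhat_poisson_eq[OF k x xs])
qed

lemma Gr_skew:
  fixes x :: "('n::{finite,linorder}) cmat"
  assumes k: "k \<le> CARD('n)" and x: "x \<in> Gr k"
  shows "cadj x = - x"
  using x Gr_iff[OF k, of x] skew_Gr by blast

theorem nijenhuis_eq:
  fixes x :: "('n::{finite,linorder}) cmat"
  assumes k: "k \<le> CARD('n)" and x: "x \<in> Gr k" and v: "v \<in> tangent_orbit x"
  shows "nijenhuis k x v = v + lie_bracket x (J_op v)"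
proof -
  note xs = Gr_skew[OF k x]
  have "nijenhuis k x v = lie_bracket (bruhat_vector x v) x"
    by (simp add: nijenhuis_def sharp_bruhat_poisson[OF k x xs] flat_kks[OF xs v])
  \<comment> \<open>The double bracket identity returns the first summand of
    \<open>bruhat_vector x v\<close> to \<open>v\<close>.\<close>
  also have "\<dots> = v - lie_bracket (J_op v) x"
    by (simp add: bruhat_vector_def lie_bracket_simps Gr_double_bracket[OF k x v])
  finally show ?thesis by (simp add: lie_bracket_def)
qed

section \<open>Multiplicities of the eigenvalues\<close>

text \<open>
  On tangent vectors \<open>nij_op P\<close> is the Nijenhuis tensor. On all skew-Hermitian matrices it is
  compatible with cutting to upper left corners: by \<open>nij_op_nth\<close> an entry of the image depends only
  on entries of the same corner.
\<close>

definition nij_op :: "('n::{finite,linorder}) cmat \<Rightarrow> 'n cmat \<Rightarrow> 'n cmat" where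
  "nij_op H A = 2 *\<^sub>R A - H ** (A - cs \<i> (J_op A)) - (A + cs \<i> (J_op A)) ** H"

lemma linear_nij_op: "linear (nij_op H)"
  by (rule linearI)
    (simp_all add: nij_op_def linear_add[OF linear_J_op] linear_cmul[OF linear_J_op] cs_simps mm_distrib algebra_simps)

text \<open>The operator \<open>A - \<i> J A\<close> doubles the strictly upper entries, keeps the
  diagonal and deletes the lower ones; \<open>A + \<i> J A\<close> does the opposite. The vanishing
  for \<open>e > b\<close> confines the sums of \<open>nij_op_nth\<close> to a corner.\<close>

definition weight :: "'n::linorder \<Rightarrow> 'n \<Rightarrow> complex" where
  "weight e b = (if e < b then 2 else if e = b then 1 else 0)"

lemma nij_op_nth:
  "nij_op H A $ a $ b = 2 * A $ a $ b - (\<Sum>e\<in>UNIV. weight e b * H $ a $ e * A $ e $ b)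
     - (\<Sum>e\<in>UNIV. weight e a * A $ a $ e * H $ e $ b)"
proof -
  have "(A - cs \<i> (J_op A)) $ i $ j = weight i j * A $ i $ j" "(A + cs \<i> (J_op A)) $ i $ j = weight j i * A $ i $ j" for i j
    by (auto simp: J_op_nth weight_def)
  then show ?thesis
    by (simp add: nij_op_def matrix_matrix_mult_def mult_ac del: vector_minus_component vector_add_component)
      (simp add: scaleR_conv_of_real)
qed

lemma nij_op_skew:
  assumes "cadj H = H" "cadj A = - A" shows "cadj (nij_op H A) = - nij_op H A"
  using assms by (simp add: nij_op_def cadj_simps J_op_skew cs_simps mm_distrib)

lemma linear_cut: "linear (cut m)"
  by (rule linearI) (simp_all add: vec_eq_iff)

section \<open>Skew-Hermitian matrices supported in a corner\<close>

definition skew :: "nat \<Rightarrow> ('n::{finite,linorder}) cmat set" where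
  "skew m = {A. cadj A = - A \<and> cut m A = A}"

lemma subspace_skew: "subspace (skew m)"
  unfolding skew_def
  by (auto simp: subspace_def cadj_simps linear_add[OF linear_cut] linear_cmul[OF linear_cut] linear_0[OF linear_cut])

lemma skew_entries:
  assumes "A \<in> skew m"
  shows "cnj (A $ i $ j) = - A $ j $ i" "\<not> (pos i < m \<and> pos j < m) \<Longrightarrow> A $ i $ j = 0"
proof -
  have A: "cadj A = - A" "cut m A = A" using assms by (auto simp: skew_def)
  show "cnj (A $ i $ j) = - A $ j $ i" using arg_cong[OF A(1), of "\<lambda>A. A $ j $ i"] by simp
  show "A $ i $ j = 0" if "\<not> (pos i < m \<and> pos j < m)"
    using arg_cong[OF A(2), of "\<lambda>A. A $ i $ j"] that by auto
qed

lemma cut_skew_in: "cadj A = - A \<Longrightarrow> cut m A \<in> skew m"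
  by (simp add: skew_def cadj_cut cut_cut linear_neg[OF linear_cut])

lemma cut_nij_op: "cut m (nij_op H A) = cut m (nij_op H (cut m A))"
proof -
  have *: "nij_op H A $ a $ b = nij_op H (cut m A) $ a $ b" if "pos a < m" "pos b < m" for a b
  proof -
    have w0: "weight e b = 0" "weight e a = 0" if "\<not> pos e < m" for e
    proof -
      have "pos b < pos e" "pos a < pos e" using that \<open>pos a < m\<close> \<open>pos b < m\<close> by linarith+
      then have "b < e" "a < e" by (simp_all add: pos_less_iff)
      then show "weight e b = 0" "weight e a = 0" by (auto simp: weight_def)
    qed
    have "(\<Sum>e\<in>UNIV. weight e b * H $ a $ e * A $ e $ b) = (\<Sum>e\<in>UNIV. weight e b * H $ a $ e * cut m A $ e $ b)"
      "(\<Sum>e\<in>UNIV. weight e a * A $ a $ e * H $ e $ b) = (\<Sum>e\<in>UNIV. weight e a * cut m A $ a $ e * H $ e $ b)"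
      by (intro sum.cong refl; case_tac "pos x < m"; simp add: w0 that)+
    then show ?thesis unfolding nij_op_nth using that by simp
  qed
  show ?thesis unfolding vec_eq_iff cut_nth by (intro allI if_cong refl *) auto
qed

lemma subspace_Int_kernel:
  assumes "subspace T" "linear \<phi>" shows "subspace (T \<inter> {v. \<phi> v = 0})"
  using assms by (auto simp: subspace_def linear_0 linear_add linear_cmul)

lemma dim_generalized_eigenspace_zero:
  fixes T :: "'a::euclidean_space set"
  shows "T \<subseteq> {0} \<Longrightarrow> dim (generalized_eigenspace T f c) = 0"
  unfolding dim_eq_0 generalized_eigenspace_def by blast

text \<open>Taking coefficientwise imaginary parts splits \<open>S\<close> into two copies of the real span of \<open>b\<close>.\<close>

lemma real_form_multiplicity:
  fixes b :: "nat \<Rightarrow> complex^'n"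
  assumes S: "csubspace S" and b: "\<And>j. j < m \<Longrightarrow> b j \<in> S"
    and ort: "\<And>i j. i < m \<Longrightarrow> j < m \<Longrightarrow> cip (b i) (b j) = (if i = j then 1 else 0)"
    and compl: "\<And>y. y \<in> S \<Longrightarrow> y = (\<Sum>j<m. cip (b j) y *s b j)"
    and H: "\<And>y. y \<in> S \<Longrightarrow> H *v y \<in> S"
    and real: "\<And>i j. i < m \<Longrightarrow> j < m \<Longrightarrow> Im (cip (b i) (H *v b j)) = 0"
  defines "f \<equiv> \<lambda>y. 2 *\<^sub>R (y - H *v y)"
  shows "dim (generalized_eigenspace S f c) = 2 * dim (generalized_eigenspace (span (b ` {..<m})) f c)"
proof -
  note sub = csubspace_imp_subspace[OF S]
  define \<phi> where "\<phi> y = (\<Sum>j<m. Im (cip (b j) y) *\<^sub>R b j)" for y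
  have f: "linear f"
    unfolding f_def by (rule linearI) (simp_all add: mv_simps algebra_simps)
  have \<phi>: "linear \<phi>"
    unfolding \<phi>_def by (rule linearI) (simp_all add: algebra_simps sum.distrib scaleR_sum_right)
  have fS: "f y \<in> S" if "y \<in> S" for y
    using that sub H by (simp add: f_def subspace_diff subspace_scale)
  have span_S: "span (b ` {..<m}) \<subseteq> S" using b sub by (intro span_minimal) auto
  have cipH: "cip (b i) (H *v y) = (\<Sum>j<m. cip (b j) y * cip (b i) (H *v b j))" if "y \<in> S" for i y
  proof -
    have "H *v y = (\<Sum>j<m. cip (b j) y *s (H *v b j))"
      using arg_cong[OF compl[OF that], of "\<lambda>y. H *v y"] unfolding mv_simps .
    then show ?thesis by simp
  qed
  have coef: "cip (b i) (\<Sum>j<m. t j *\<^sub>R b j) = of_real (t i)" if "i < m" for t i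
  proof -
    have "cip (b i) (\<Sum>j<m. t j *\<^sub>R b j) = (\<Sum>j<m. if i = j then of_real (t j) else 0)"
      unfolding cip_sum_right by (intro sum.cong refl) (use that ort in \<open>auto simp: of_real_def\<close>)
    then show ?thesis using that by simp
  qed
  have coef_\<phi>: "cip (b i) (\<phi> y) = of_real (Im (cip (b i) y))" if "i < m" for i y
    unfolding \<phi>_def by (rule coef[OF that])
  have span_eq: "span (b ` {..<m}) = S \<inter> {y. \<phi> y = 0}"
  proof
    have ker: "subspace (S \<inter> {y. \<phi> y = 0})"
      by (rule subspace_Int_kernel[OF sub \<phi>])
    have "\<phi> (b i) = 0" if "i < m" for i
      unfolding \<phi>_def using that ort by (intro sum.neutral) auto
    then show "span (b ` {..<m}) \<subseteq> S \<inter> {y. \<phi> y = 0}"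
      using b ker by (intro span_minimal) auto
    show "S \<inter> {y. \<phi> y = 0} \<subseteq> span (b ` {..<m})"
    proof
      fix y assume "y \<in> S \<inter> {y. \<phi> y = 0}"
      then have y: "y \<in> S" "\<phi> y = 0" by auto
      have "Im (cip (b i) y) = 0" if "i < m" for i
      proof -
        have "complex_of_real (Im (cip (b i) y)) = cip (b i) (\<phi> y)"
          unfolding \<phi>_def by (rule coef[OF that, symmetric])
        then show ?thesis using y(2) by simp
      qed
      then have "cip (b j) y *s b j = Re (cip (b j) y) *\<^sub>R b j" if "j < m" for j
        using that by (simp add: scaleR_eq_smult complex_eq_iff)
      then have "(\<Sum>j<m. cip (b j) y *s b j) = (\<Sum>j<m. Re (cip (b j) y) *\<^sub>R b j)"
        by (intro sum.cong) auto
      moreover have "(\<Sum>j<m. Re (cip (b j) y) *\<^sub>R b j) \<in> span (b ` {..<m})"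
        by (intro span_sum span_scale span_base) auto
      ultimately show "y \<in> span (b ` {..<m})" using compl[OF y(1)] by simp
    qed
  qed
  have image: "\<phi> ` S = span (b ` {..<m})"
  proof
    show "\<phi> ` S \<subseteq> span (b ` {..<m})"
      unfolding \<phi>_def by (intro image_subsetI span_sum span_scale span_base imageI)
    have "\<phi> (\<i> *s b i) = b i" if i: "i < m" for i
    proof -
      have "\<phi> (\<i> *s b i) = (\<Sum>j<m. if j = i then b i else 0)"
        unfolding \<phi>_def by (intro sum.cong refl) (use i ort in auto)
      then show ?thesis using i by simp
    qed
    moreover have "\<i> *s b i \<in> S" if "i < m" for i using S b[OF that] by (simp add: csubspace_def)
    ultimately have "b ` {..<m} \<subseteq> \<phi> ` S" by (auto intro!: rev_image_eqI)
    then show "span (b ` {..<m}) \<subseteq> \<phi> ` S"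
      by (rule span_minimal) (rule linear_subspace_image[OF \<phi> sub])
  qed
  \<comment> \<open>The matrix of \<open>H\<close> in the basis \<open>b\<close> has real entries,
    so applying it commutes with taking imaginary parts of coefficients.\<close>
  have comm: "\<phi> (f y) = f (\<phi> y)" if y: "y \<in> S" for y
  proof -
    have "\<phi> y \<in> S" using image span_S y by blast
    have "cip (b i) (H *v \<phi> y) = of_real (Im (cip (b i) (H *v y)))" if i: "i < m" for i
    proof -
      have "cip (b i) (H *v \<phi> y) = (\<Sum>j<m. of_real (Im (cip (b j) y)) * cip (b i) (H *v b j))"
        unfolding cipH[OF \<open>\<phi> y \<in> S\<close>] by (intro sum.cong refl) (simp add: coef_\<phi>)
      also have "\<dots> = (\<Sum>j<m. of_real (Im (cip (b j) y * cip (b i) (H *v b j))))"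
        by (intro sum.cong refl) (use i real in \<open>auto simp: complex_eq_iff\<close>)
      also have "\<dots> = of_real (Im (cip (b i) (H *v y)))"
        unfolding cipH[OF y] by simp
      finally show ?thesis .
    qed
    then have "cip (b i) (f (\<phi> y)) = of_real (Im (cip (b i) (f y)))" if "i < m" for i
      using that by (simp add: f_def coef_\<phi> complex_eq_iff)
    then have "(\<Sum>j<m. cip (b j) (f (\<phi> y)) *s b j) = \<phi> (f y)"
      unfolding \<phi>_def[of "f y"] scaleR_eq_smult by (intro sum.cong) auto
    then show ?thesis using compl[OF fS[OF \<open>\<phi> y \<in> S\<close>]] by simp
  qed
  show ?thesis
    using dim_generalized_eigenspace_add[OF sub f fS \<phi> f comm, of c] unfolding image span_eq[symmetric] by simp
qed

lemma multiplicity_corner_space: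
  fixes H :: "('n::{finite,linorder}) cmat"
  assumes e: "eigenbasis m H v l"
  shows "dim (generalized_eigenspace (corner_space m) (\<lambda>y. 2 *\<^sub>R (y - H *v y)) c) =
    2 * card {j. j < m \<and> 2 * (1 - l j) = c}"
proof -
  let ?f = "\<lambda>y. 2 *\<^sub>R (y - H *v y)"
  have f: "linear ?f" by (rule linearI) (simp_all add: mv_simps algebra_simps)
  have ort: "cip (v i) (v j) = (if i = j then 1 else 0)" if "i \<in> {..<m}" "j \<in> {..<m}" for i j
    using eigenbasisD(3)[OF e] that by simp
  have "dim (generalized_eigenspace (span (cbasis v ` ({..<m} \<times> UNIV))) ?f c) =
      card {p \<in> {..<m} \<times> (UNIV :: bool set). 2 * (1 - l (fst p)) = c}"
  proof (rule dim_generalized_eigenspace_diagonal[OF _ f])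
    show "cbasis v p \<bullet> cbasis v q = (if p = q then 1 else 0)"
      if "p \<in> {..<m} \<times> UNIV" "q \<in> {..<m} \<times> UNIV" for p q
      by (rule cbasis_orthonormal[OF ort that])
    fix p :: "nat \<times> bool" assume "p \<in> {..<m} \<times> UNIV"
    then have "H *v v (fst p) = of_real (l (fst p)) *s v (fst p)"
      using eigenbasisD(2)[OF e] by auto
    then show "?f (cbasis v p) = (2 * (1 - l (fst p))) *\<^sub>R cbasis v p"
      unfolding cbasis_def mv_simps by (simp add: vec_eq_iff) (simp add: scaleR_conv_of_real algebra_simps)
  qed simp
  also have "{p \<in> {..<m} \<times> (UNIV :: bool set). 2 * (1 - l (fst p)) = c} = {j. j < m \<and> 2 * (1 - l j) = c} \<times> UNIV"
    by auto
  finally show ?thesis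
    by (simp add: corner_space_eq_cspan[OF e] span_cbasis card_cartesian_product)
qed

lemma eigenbasis_phase:
  fixes H :: "('n::{finite,linorder}) cmat"
  assumes e: "eigenbasis m H v l" and \<theta>: "\<And>j. cmod (\<theta> j) = 1"
  shows "eigenbasis m H (\<lambda>j. \<theta> j *s v j) l"
proof -
  have \<theta>2: "cnj (\<theta> j) * \<theta> j = 1" "\<theta> j * cnj (\<theta> j) = 1" for j
    using \<theta>[of j] complex_norm_square[of "\<theta> j"] by (auto simp: mult.commute)
  note D = eigenbasisD[OF e]
  show ?thesis
    unfolding eigenbasis_def
  proof (intro conjI allI impI ballI)
    fix i assume i: "i < m"
    show "\<theta> i *s v i \<in> corner_space m"
      using D(1)[OF i] csubspace_corner_space unfolding csubspace_def by blast
    show "H *v (\<theta> i *s v i) = of_real (l i) *s (\<theta> i *s v i)"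
      by (simp add: mv_simps D(2)[OF i] smult_simps mult.commute)
    show "cip (\<theta> i *s v i) (\<theta> j *s v j) = (if i = j then 1 else 0)" if "j < m" for j
      using D(3)[OF i that] \<theta>2 by (simp add: mult.assoc[symmetric])
  next
    fix w :: "(complex, 'n) vec" assume "w \<in> corner_space m"
    then have "w = (\<Sum>j<m. cip (v j) w *s v j)" by (rule D)
    also have "\<dots> = (\<Sum>j<m. cip (\<theta> j *s v j) w *s (\<theta> j *s v j))"
    proof (intro sum.cong refl)
      fix j
      have "cip (\<theta> j *s v j) w *s (\<theta> j *s v j) = ((cnj (\<theta> j) * \<theta> j) * cip (v j) w) *s v j"
        by (simp add: smult_simps mult_ac)
      then show "cip (v j) w *s v j = cip (\<theta> j *s v j) w *s (\<theta> j *s v j)" by (simp add: \<theta>2)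
    qed
    finally show "w = (\<Sum>j<m. cip (\<theta> j *s v j) w *s (\<theta> j *s v j))" .
  qed (rule D(5))
qed

section \<open>The last row and column of a corner\<close>

definition border :: "nat \<Rightarrow> ('n::{finite,linorder}) cmat set" where
  "border m = skew (Suc m) \<inter> {A. cut m A = 0}"

text \<open>An element of \<open>border m\<close> is a column \<open>col A\<close> together with a
  real number \<open>r A\<close> for the last diagonal entry. The operator couples
  \<open>r A\<close> only with the imaginary parts of the coefficients of \<open>col A\<close>, once
  the coefficients of the column \<open>cv\<close> of \<open>H\<close> are real. The real parts then
  see the corner of size \<open>m\<close>, the imaginary parts together with \<open>r A\<close> the
  corner of size \<open>m + 1\<close>.\<close>

lemma border_multiplicity:
  fixes H :: "('n::{finite,linorder}) cmat"
  assumes m: "Suc m \<le> CARD('n)" and H: "cadj H = H"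
    and e0: "eigenbasis m (cut m H) v0 p" and e1: "eigenbasis (Suc m) (cut (Suc m) H) v1 l"
  shows "dim (generalized_eigenspace (border m) (\<lambda>A. cut (Suc m) (nij_op H A)) c) =
    card {j. j < m \<and> 2 * (1 - p j) = c} + card {j. j < Suc m \<and> 2 * (1 - l j) = c}"
proof -
  define z :: 'n where "z = at_pos m"
  have z: "pos z = m" using m by (simp add: z_def)
  then have zD: "pos i = m \<longleftrightarrow> i = z" for i by (metis pos_eq_iff)
  have ltz: "i < z \<longleftrightarrow> pos i < m" for i using pos_less_iff[of i z] z by simp
  have Suc_iff: "pos i < Suc m \<longleftrightarrow> pos i < m \<or> i = z" for i using zD by (auto simp: less_Suc_eq)
  have Hc: "cnj (H $ i $ j) = H $ j $ i" for i j
    using arg_cong[OF H, of "\<lambda>A. A $ j $ i"] by simp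
  define d where "d = Re (H $ z $ z)"
  have d: "H $ z $ z = of_real d" using Hc[of z z] by (simp add: d_def complex_eq_iff)
  define cv :: "(complex, 'n) vec" where "cv = (\<chi> a. if pos a < m then H $ a $ z else 0)"
  have cvC: "cv \<in> corner_space m" by (simp add: cv_def corner_space_def)
  \<comment> \<open>These phases make the coefficients of \<open>cv\<close> in the rotated
    eigenbasis real; where a coefficient is 0, any phase serves.\<close>
  define \<theta> where "\<theta> j = (if cip (v0 j) cv = 0 then 1 else sgn (cip (v0 j) cv))" for j
  define v where "v j = \<theta> j *s v0 j" for j
  have e: "eigenbasis m (cut m H) v p"
    unfolding v_def by (rule eigenbasis_phase[OF e0]) (simp add: \<theta>_def norm_sgn)
  note D = eigenbasisD[OF e]
  define cj where "cj j = Re (cip (v j) cv)" for j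
  have cj: "cip (v j) cv = of_real (cj j)" for j
  proof -
    have "Im (cip (v j) cv) = 0"
      by (simp add: v_def \<theta>_def sgn_div_norm algebra_simps)
    then show ?thesis by (simp add: cj_def complex_eq_iff)
  qed
  have cj': "cip cv (v j) = of_real (cj j)" for j
    using cnj_cip[of "v j" cv] by (simp add: cj)
  define C where "C = cut m H"
  define K where "K = cut (Suc m) H"
  have K_mv: "K *v u = C *v u + (u $ z) *s cv + (cip cv u + of_real d * u $ z) *s axis z 1" for u
  proof (rule vec_eq_iff[THEN iffD2], rule allI)
    fix i
    have "K $ i $ j = C $ i $ j + cv $ i * (if j = z then 1 else 0) + (if i = z then 1 else 0) * cnj (cv $ j)
        + (if i = z then 1 else 0) * (if j = z then of_real d else 0)" for j
      using z d by (auto simp: K_def C_def cv_def Suc_iff Hc)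
    then have "(K *v u) $ i = (\<Sum>j\<in>UNIV. C $ i $ j * u $ j) + cv $ i * (\<Sum>j\<in>UNIV. (if j = z then u $ j else 0))
      + (if i = z then 1 else 0) * (\<Sum>j\<in>UNIV. cnj (cv $ j) * u $ j)
      + (if i = z then 1 else 0) * (\<Sum>j\<in>UNIV. if j = z then of_real d * u $ j else 0)"
      unfolding matrix_vector_mult_def vec_lambda_beta sum_distrib_left sum.distrib[symmetric]
      by (intro sum.cong) (auto simp: algebra_simps)
    then show "(K *v u) $ i = (C *v u + (u $ z) *s cv + (cip cv u + of_real d * u $ z) *s axis z 1) $ i"
      by (simp add: matrix_vector_mult_def cip_def axis_nth)
  qed
  have vz: "v j $ z = 0" if "j < m" for j using D(1)[OF that] z by (simp add: corner_space_def)
  have Kv: "K *v v j = p j *\<^sub>R v j + cj j *\<^sub>R axis z 1" if "j < m" for j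
    using D(2)[OF that] vz[OF that] by (simp add: K_mv C_def cj' scaleR_eq_smult)
  have "C *v axis z 1 = 0"
    using z by (auto simp: C_def vec_eq_iff matrix_vector_mult_def axis_nth intro!: sum.neutral)
  moreover have "cip cv (axis z 1) = 0" using z by (simp add: cip_axis_right cv_def)
  moreover have "cv = (\<Sum>j<m. cj j *\<^sub>R v j)"
    using D(4)[OF cvC] by (simp add: cj scaleR_eq_smult)
  ultimately have Kz: "K *v axis z 1 = (\<Sum>j<m. cj j *\<^sub>R v j) + d *\<^sub>R axis z 1"
    by (simp add: K_mv axis_nth scaleR_eq_smult)
  define b where "b j = (if j < m then v j else axis z 1)" for j
  have spanb: "b ` {..<Suc m} = insert (axis z 1) (v ` {..<m})"
    by (auto simp: b_def lessThan_Suc)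
  let ?f = "\<lambda>A. cut (Suc m) (nij_op H A)"
  let ?f' = "\<lambda>y. 2 *\<^sub>R (y - K *v y)"
  define col where "col A = (\<chi> a. if pos a < m then A $ a $ z else 0)" for A :: "'n cmat"
  define r where "r A = Im (A $ z $ z)" for A :: "'n cmat"
  have colC: "col A \<in> corner_space m" for A by (simp add: col_def corner_space_def)
  have lin_col: "linear col" by (rule linearI) (auto simp: vec_eq_iff col_def)
  have sub_border: "subspace (border m)"
    unfolding border_def by (rule subspace_Int_kernel[OF subspace_skew linear_cut])
  have lin_f: "linear ?f" using linear_compose[OF linear_nij_op linear_cut] by (simp add: o_def)
  have lin_f': "linear ?f'" by (rule linearI) (simp_all add: mv_simps algebra_simps)
  have B0: "A $ i $ j = 0" if "A \<in> border m" "pos i < m" "pos j < m" for A :: "'n cmat" and i j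
  proof -
    have "cut m A = 0" using that by (simp add: border_def)
    from arg_cong[OF this, of "\<lambda>A. A $ i $ j"] show ?thesis using that by simp
  qed
  have Bs: "A \<in> skew (Suc m)" if "A \<in> border m" for A :: "'n cmat" using that by (simp add: border_def)
  have Bz: "A $ z $ z = \<i> * of_real (r A)" if "A \<in> border m" for A :: "'n cmat"
    using skew_entries(1)[OF Bs[OF that], of z z] by (simp add: r_def complex_eq_iff)
  have Bzj: "A $ z $ j = - cnj (A $ j $ z)" if "A \<in> border m" for A :: "'n cmat" and j
    using skew_entries(1)[OF Bs[OF that], of j z] by simp
  have f_border: "?f A \<in> border m" if A: "A \<in> border m" for A
  proof -
    have "cadj (nij_op H A) = - nij_op H A" using Bs[OF A] H by (intro nij_op_skew) (auto simp: skew_def)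
    then have "?f A \<in> skew (Suc m)" by (rule cut_skew_in)
    moreover have "cut m (?f A) = 0"
      using A cut_nij_op[of m H A]
      by (simp add: cut_cut border_def linear_0[OF linear_nij_op] linear_0[OF linear_cut])
    ultimately show ?thesis by (simp add: border_def)
  qed
  have col_f: "col (?f A) = 2 *\<^sub>R (col A - C *v col A) - (\<i> * of_real (r A)) *s cv" if A: "A \<in> border m" for A
  proof (rule vec_eq_iff[THEN iffD2], rule allI)
    fix a
    show "col (?f A) $ a = (2 *\<^sub>R (col A - C *v col A) - (\<i> * of_real (r A)) *s cv) $ a"
    proof (cases "pos a < m")
      case True
      have "(\<Sum>e\<in>UNIV. weight e a * A $ a $ e * H $ e $ z) = 0"
      proof (intro sum.neutral ballI)
        fix e
        have "weight e a = 0 \<or> pos e < m"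
          using True pos_le_iff[of e a] by (auto simp: weight_def split: if_splits)
        then show "weight e a * A $ a $ e * H $ e $ z = 0" using B0[OF A True] by auto
      qed
      moreover have "(\<Sum>e\<in>UNIV. weight e z * H $ a $ e * A $ e $ z) =
          (\<Sum>e\<in>UNIV. 2 * (C $ a $ e * col A $ e) + (if e = z then H $ a $ z * A $ z $ z else 0))"
        using z True by (intro sum.cong refl) (auto simp: weight_def ltz C_def col_def)
      ultimately have "nij_op H A $ a $ z =
          2 * A $ a $ z - 2 * (\<Sum>e\<in>UNIV. C $ a $ e * col A $ e) - H $ a $ z * A $ z $ z"
        unfolding nij_op_nth by (simp add: sum.distrib sum_distrib_left)
      then show ?thesis
        using True z by (simp add: col_def cv_def Bz[OF A] matrix_vector_mult_def algebra_simps scaleR_conv_of_real)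
    next
      case False
      then have "(C *v col A) $ a = 0" by (simp add: C_def matrix_vector_mult_def)
      then show ?thesis using False by (simp add: col_def cv_def)
    qed
  qed
  have r_f: "r (?f A) = 2 * r A - 4 * Im (cip cv (col A)) - 2 * d * r A" if A: "A \<in> border m" for A
  proof -
    have s1: "(\<Sum>e\<in>UNIV. weight e z * H $ z $ e * A $ e $ z) =
        (\<Sum>e\<in>UNIV. 2 * (cnj (cv $ e) * col A $ e) + (if e = z then H $ z $ z * A $ z $ z else 0))"
      using z by (intro sum.cong refl) (auto simp: weight_def ltz cv_def col_def Hc)
    have s2: "(\<Sum>e\<in>UNIV. weight e z * A $ z $ e * H $ e $ z) =
        (\<Sum>e\<in>UNIV. - 2 * cnj (cnj (cv $ e) * col A $ e) + (if e = z then A $ z $ z * H $ z $ z else 0))"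
    proof (intro sum.cong refl)
      fix e
      show "weight e z * A $ z $ e * H $ e $ z =
          - 2 * cnj (cnj (cv $ e) * col A $ e) + (if e = z then A $ z $ z * H $ z $ z else 0)"
      proof (cases "e = z")
        case False
        have "A $ z $ e = - cnj (A $ e $ z)" by (rule Bzj[OF A])
        then show ?thesis using False by (auto simp: weight_def ltz cv_def col_def Hc)
      qed (simp add: weight_def cv_def z)
    qed
    have "nij_op H A $ z $ z = 2 * A $ z $ z - (2 * cip cv (col A) + H $ z $ z * A $ z $ z)
        - (- 2 * cnj (cip cv (col A)) + A $ z $ z * H $ z $ z)"
      unfolding nij_op_nth s1 s2 by (simp add: sum.distrib sum_subtractf cip_def sum_distrib_left[symmetric] sum_negf)
    from arg_cong[OF this, of Im] show ?thesis using z by (simp add: r_def d)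
  qed
  \<comment> \<open>Halving \<open>r A\<close> balances the coupling: \<open>col\<close> receives
    \<open>r A\<close> times \<open>cj j\<close>, while \<open>r A\<close> receives twice the sum of
    the imaginary parts times \<open>2 cj j\<close>. With \<open>r A / 2\<close> both factors are
    equal and the operator is \<open>2 (1 - K)\<close>.\<close>
  define \<psi> where "\<psi> A = (\<Sum>j<m. Im (cip (v j) (col A)) *\<^sub>R v j) + (r A / 2) *\<^sub>R axis z 1" for A
  have lin_\<psi>: "linear \<psi>"
    unfolding \<psi>_def
    by (rule linearI) (simp_all add: linear_add[OF lin_col] linear_cmul[OF lin_col] r_def algebra_simps
        sum.distrib scaleR_sum_right add_divide_distrib)
  have comm: "\<psi> (?f A) = ?f' (\<psi> A)" if A: "A \<in> border m" for A
  proof -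
    define t where "t j = Im (cip (v j) (col A))" for j
    have tf: "Im (cip (v j) (col (?f A))) = 2 * (1 - p j) * t j - r A * cj j" if "j < m" for j
    proof -
      have "cip (v j) (C *v col A) = of_real (p j) * cip (v j) (col A)"
        using D(2)[OF that] H by (simp add: C_def cip_adj cadj_cut)
      then show ?thesis unfolding col_f[OF A] by (simp add: cj t_def algebra_simps)
    qed
    have "cip cv (col A) = (\<Sum>j<m. cip (v j) (col A) * cip cv (v j))"
      using arg_cong[OF D(4)[OF colC[of A]], of "cip cv"] by simp
    then have ic: "Im (cip cv (col A)) = (\<Sum>j<m. t j * cj j)" by (simp add: cj' t_def)
    have "\<psi> (?f A) = (\<Sum>j<m. (2 * (1 - p j) * t j - r A * cj j) *\<^sub>R v j)
        + (r A - 2 * (\<Sum>j<m. t j * cj j) - d * r A) *\<^sub>R axis z 1"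
      unfolding \<psi>_def[of "?f A"] r_f[OF A] ic
      by (intro arg_cong2[of _ _ _ _ "(+)"] sum.cong refl) (simp_all add: tf)
    moreover have "K *v \<psi> A = (\<Sum>j<m. t j *\<^sub>R (p j *\<^sub>R v j + cj j *\<^sub>R axis z 1))
        + (r A / 2) *\<^sub>R ((\<Sum>j<m. cj j *\<^sub>R v j) + d *\<^sub>R axis z 1)"
      unfolding \<psi>_def mv_simps Kz t_def[symmetric]
      by (intro arg_cong2[of _ _ _ _ "(+)"] sum.cong refl) (simp add: Kv)
    ultimately show ?thesis
      by (simp add: \<psi>_def[of A] t_def[symmetric] algebra_simps sum.distrib sum_subtractf scaleR_sum_right
          scaleR_sum_left sum_distrib_left)
  qed
  \<comment> \<open>The element of the border with prescribed column and last diagonal entry, used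
    as witness for surjectivity.\<close>
  define mk where "mk u s = (\<chi> i j. if j = z \<and> pos i < m then u $ i else if i = z \<and> pos j < m then - cnj (u $ j)
      else if i = z \<and> j = z then \<i> * of_real s else 0)" for u :: "(complex, 'n) vec" and s
  have mk: "mk u s \<in> border m" "col (mk u s) = u" "r (mk u s) = s" if u: "u \<in> corner_space m" for u s
  proof -
    show "mk u s \<in> border m"
      using z by (auto simp: border_def skew_def vec_eq_iff mk_def Suc_iff)
    show "col (mk u s) = u" using u by (auto simp: vec_eq_iff col_def mk_def corner_space_def)
    show "r (mk u s) = s" using z by (simp add: r_def mk_def)
  qed
  have t_coef: "cip (v i) ((\<Sum>j<m. t j *\<^sub>R v j) + s *\<^sub>R axis z 1) = of_real (t i)" if "i < m" for i t s
  proof -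
    have "cip (v i) (\<Sum>j<m. t j *\<^sub>R v j) = (\<Sum>j<m. if i = j then of_real (t j) else 0)"
      unfolding cip_sum_right by (intro sum.cong refl) (use that D(3) in \<open>auto simp: of_real_def\<close>)
    then show ?thesis using that vz by (simp add: cip_axis_right)
  qed
  have image: "\<psi> ` border m = span (b ` {..<Suc m})"
  proof
    show "\<psi> ` border m \<subseteq> span (b ` {..<Suc m})"
      unfolding spanb \<psi>_def by (auto intro!: span_add span_sum span_scale intro: span_base)
    have "v i \<in> \<psi> ` border m" if i: "i < m" for i
    proof -
      have "\<i> *s v i \<in> corner_space m"
        using D(1)[OF i] csubspace_corner_space unfolding csubspace_def by blast
      note M = mk[OF this, of 0]
      have "(\<Sum>j<m. Im (cip (v j) (\<i> *s v i)) *\<^sub>R v j) = (\<Sum>j<m. if j = i then v i else 0)"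
        by (intro sum.cong refl) (use i D(3) in auto)
      then have "v i = \<psi> (mk (\<i> *s v i) 0)" unfolding \<psi>_def M using i by simp
      then show ?thesis using M(1) by blast
    qed
    moreover have "axis z 1 \<in> \<psi> ` border m"
    proof -
      have "(0 :: (complex, 'n) vec) \<in> corner_space m" by (simp add: corner_space_def)
      note M = mk[OF this, of 2]
      have "axis z 1 = \<psi> (mk 0 2)" unfolding \<psi>_def M by simp
      then show ?thesis using M(1) by blast
    qed
    ultimately have "b ` {..<Suc m} \<subseteq> \<psi> ` border m" unfolding spanb by auto
    then show "span (b ` {..<Suc m}) \<subseteq> \<psi> ` border m"
      by (rule span_minimal) (rule linear_subspace_image[OF lin_\<psi> sub_border])
  qed
  \<comment> \<open>The complementary half: real coefficients and \<open>r A = 0\<close>.\<close>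
  define A0 where "A0 = border m \<inter> {A. \<psi> A = 0}"
  have A0D: "A \<in> border m" "Im (cip (v j) (col A)) = 0" if "A \<in> A0" "j < m" for A j
  proof -
    show A: "A \<in> border m" using that by (simp add: A0_def)
    have 0: "\<psi> A = 0" using that by (simp add: A0_def)
    have "complex_of_real (Im (cip (v j) (col A))) = cip (v j) (\<psi> A)"
      unfolding \<psi>_def by (rule t_coef[OF that(2), symmetric])
    then show "Im (cip (v j) (col A)) = 0" using 0 by simp
  qed
  have r0: "r A = 0" if "A \<in> A0" for A
  proof -
    have "\<psi> A $ z = of_real (r A / 2)" by (simp add: \<psi>_def vz axis_nth of_real_def)
    then show "r A = 0" using that by (simp add: A0_def)
  qed
  have sub_A0: "subspace A0"
    unfolding A0_def by (rule subspace_Int_kernel[OF sub_border lin_\<psi>])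
  let ?g = "\<lambda>u. 2 *\<^sub>R (u - C *v u)"
  have lin_g: "linear ?g" by (rule linearI) (simp_all add: mv_simps algebra_simps)
  have f_A0: "?f A \<in> A0" if "A \<in> A0" for A
    using that f_border comm by (simp add: A0_def)
  have col_A0: "col ` A0 = span (v ` {..<m})"
  proof
    show "col ` A0 \<subseteq> span (v ` {..<m})"
    proof
      fix u assume "u \<in> col ` A0"
      then obtain A where A: "A \<in> A0" "u = col A" by auto
      have "u = (\<Sum>j<m. cip (v j) u *s v j)" unfolding A(2) by (rule D(4)[OF colC])
      also have "\<dots> = (\<Sum>j<m. Re (cip (v j) u) *\<^sub>R v j)"
      proof (intro sum.cong refl)
        fix j assume "j \<in> {..<m}"
        then have "cip (v j) u = of_real (Re (cip (v j) u))"
          using A0D(2)[OF A(1), of j] A(2) by (simp add: complex_eq_iff)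
        then show "cip (v j) u *s v j = Re (cip (v j) u) *\<^sub>R v j" unfolding scaleR_eq_smult by simp
      qed
      also have "\<dots> \<in> span (v ` {..<m})" by (intro span_sum span_scale span_base) auto
      finally show "u \<in> span (v ` {..<m})" .
    qed
    have "v i \<in> col ` A0" if i: "i < m" for i
    proof -
      note M = mk[OF D(1)[OF i], of 0]
      have "\<psi> (mk (v i) 0) = 0"
        unfolding \<psi>_def M using i D(3) by (auto intro!: sum.neutral)
      then show ?thesis using M by (auto simp: A0_def intro!: rev_image_eqI)
    qed
    then show "span (v ` {..<m}) \<subseteq> col ` A0"
      by (intro span_minimal linear_subspace_image[OF lin_col sub_A0]) auto
  qed
  have ker0: "A0 \<inter> {A. col A = 0} \<subseteq> {0}"
  proof
    fix A assume "A \<in> A0 \<inter> {A. col A = 0}"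
    then have A: "A \<in> A0" "col A = 0" "A \<in> border m" by (auto simp: A0_def)
    have cz: "A $ i $ z = 0" for i
    proof (cases "pos i < m")
      case True
      then show ?thesis using arg_cong[OF A(2), of "\<lambda>u. u $ i"] by (simp add: col_def)
    next
      case False
      then show ?thesis
        using Bz[OF A(3)] r0[OF A(1)] skew_entries(2)[OF Bs[OF A(3)], of i z] Suc_iff[of i] by auto
    qed
    have "A $ i $ j = 0" for i j
    proof (cases "pos i < Suc m \<and> pos j < Suc m")
      case True
      then consider "j = z" | "i = z" | "pos i < m" "pos j < m" using Suc_iff by auto
      then show ?thesis using cz Bzj[OF A(3)] B0[OF A(3)] by cases auto
    qed (rule skew_entries(2)[OF Bs[OF A(3)]])
    then show "A \<in> {0}" by (simp add: vec_eq_iff)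
  qed
  have "dim (generalized_eigenspace (border m) ?f c) =
      dim (generalized_eigenspace A0 ?f c) + dim (generalized_eigenspace (span (b ` {..<Suc m})) ?f' c)"
    using dim_generalized_eigenspace_add[OF sub_border lin_f f_border lin_\<psi> lin_f' comm, of c]
    unfolding image A0_def[symmetric] .
  \<comment> \<open>On \<open>A0\<close> the term with \<open>r A\<close> disappears from
    \<open>col_f\<close>, and \<open>col\<close> is injective there, so the multiplicities are those
    of \<open>2 (1 - C)\<close> on a real span.\<close>
  also have "dim (generalized_eigenspace A0 ?f c) = dim (generalized_eigenspace (span (v ` {..<m})) ?g c)"
  proof -
    have "col (?f A) = ?g (col A)" if "A \<in> A0" for A
      using that col_f[of A] r0[OF that] by (simp add: A0_def)
    from dim_generalized_eigenspace_add[OF sub_A0 lin_f f_A0 lin_col lin_g this, of c]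
    show ?thesis unfolding col_A0 using dim_generalized_eigenspace_zero[OF ker0] by simp
  qed
  also have "\<dots> = card {j \<in> {..<m}. 2 * (1 - p j) = c}"
  proof (rule dim_generalized_eigenspace_diagonal[OF _ lin_g])
    show "v i \<bullet> v j = (if i = j then 1 else 0)" if "i \<in> {..<m}" "j \<in> {..<m}" for i j
      using D(3)[of i j] that by (simp add: inner_eq_Re_cip)
    show "?g (v i) = (2 * (1 - p i)) *\<^sub>R v i" if "i \<in> {..<m}" for i
      using D(2)[of i] that by (simp add: C_def scaleR_eq_smult smult_simps algebra_simps vec_eq_iff)
  qed simp
  also have "{j \<in> {..<m}. 2 * (1 - p j) = c} = {j. j < m \<and> 2 * (1 - p j) = c}" by auto
  also have "dim (generalized_eigenspace (span (b ` {..<Suc m})) ?f' c) = card {j. j < Suc m \<and> 2 * (1 - l j) = c}"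
  proof -
    have bm: "b m = axis z 1" "j < m \<Longrightarrow> b j = v j" for j by (simp_all add: b_def)
    \<comment> \<open>\<open>K\<close> has a real matrix in the basis \<open>b\<close>, so its real
      form carries exactly half of the real multiplicity on
      \<open>corner_space (Suc m)\<close>.\<close>
    have "2 * dim (generalized_eigenspace (span (b ` {..<Suc m})) ?f' c) =
        dim (generalized_eigenspace (corner_space (Suc m)) ?f' c)"
    proof (rule real_form_multiplicity[symmetric])
      show "csubspace (corner_space (Suc m))" by (rule csubspace_corner_space)
      show "b j \<in> corner_space (Suc m)" if "j < Suc m" for j
        using D(1)[of j] corner_space_mono[of m "Suc m"] z by (auto simp: b_def axis_in_corner_space)
      show "cip (b i) (b j) = (if i = j then 1 else 0)" if "i < Suc m" "j < Suc m" for i j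
        using that D(3)[of i j] vz[of i] vz[of j] by (auto simp: b_def cip_axis cip_axis_right axis_nth less_Suc_eq)
      show "K *v y \<in> corner_space (Suc m)" for y unfolding K_def by (rule cut_mv_in)
      show "Im (cip (b i) (K *v b j)) = 0" if "i < Suc m" "j < Suc m" for i j
      proof -
        have 1: "cip (v i) (K *v v j) \<in> \<real>" "cip (axis z 1) (K *v v j) \<in> \<real>" if "i < m" "j < m" for i j
          using that D(3)[OF that] vz by (auto simp: Kv cip_axis_right cip_axis axis_nth simp flip: of_real_def)
        have 2: "cip (v i) (K *v axis z 1) \<in> \<real>" if "i < m" for i
          unfolding Kz t_coef[OF that] by simp
        have 3: "cip (axis z 1) (K *v axis z 1) \<in> \<real>"
          unfolding Kz by (simp add: cip_axis axis_nth vz flip: of_real_def)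
        have 4: "cip (axis z 1) (K *v v j) \<in> \<real>" if "j < m" for j using 1(2)[OF that that] .
        have "cip (b i) (K *v b j) \<in> \<real>"
          using that 1(1) 2 3 4 by (auto simp: b_def less_Suc_eq)
        then show ?thesis by (simp add: complex_is_Real_iff)
      qed
      fix y :: "(complex, 'n) vec" assume y: "y \<in> corner_space (Suc m)"
      define u where "u = y - (y $ z) *s axis z 1"
      have "u \<in> corner_space m"
        using y z by (auto simp: u_def corner_space_def axis_nth Suc_le_eq) (metis Suc_iff not_less not_less_eq)
      then have "u = (\<Sum>j<m. cip (v j) u *s v j)" by (rule D)
      also have "\<dots> = (\<Sum>j<m. cip (v j) y *s v j)"
        by (intro sum.cong refl) (simp add: u_def cip_axis_right vz)
      finally have "y = (\<Sum>j<m. cip (v j) y *s v j) + (y $ z) *s axis z 1" by (simp add: u_def algebra_simps)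
      then show "y = (\<Sum>j<Suc m. cip (b j) y *s b j)" by (simp add: bm cip_axis)
    qed
    also have "\<dots> = 2 * card {j. j < Suc m \<and> 2 * (1 - l j) = c}"
      by (rule multiplicity_corner_space[OF e1[folded K_def]])
    finally show ?thesis by simp
  qed
  finally show ?thesis .
qed

section \<open>Summation over the corners\<close>

definition multiplicity_count :: "(nat \<Rightarrow> nat \<Rightarrow> real) \<Rightarrow> nat \<Rightarrow> real \<Rightarrow> nat" where
  "multiplicity_count ev m c = card {j. j < m \<and> 2 * (1 - ev m j) = c}"

lemma cut_image_skew: "cut m ` skew (Suc m) = (skew m :: ('n::{finite,linorder}) cmat set)"
proof
  show "cut m ` skew (Suc m) \<subseteq> (skew m :: 'n cmat set)"
    using cut_skew_in by (auto simp: skew_def[of "Suc m"])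
  show "(skew m :: 'n cmat set) \<subseteq> cut m ` skew (Suc m)"
  proof
    fix A :: "'n cmat" assume A: "A \<in> skew m"
    then have "cut (Suc m) A = A" using skew_entries(2)[OF A] by (auto simp: vec_eq_iff)
    then show "A \<in> cut m ` skew (Suc m)" using A by (auto simp: skew_def intro!: image_eqI[of A _ A])
  qed
qed

text \<open>The border between sizes \<open>m\<close> and \<open>m + 1\<close> contributes the
  counts of both corners. Every corner smaller than \<open>r\<close> thus occurs in two borders and
  is counted twice, the corner of size \<open>r\<close> once.\<close>

lemma skew_multiplicity:
  fixes H :: "('n::{finite,linorder}) cmat"
  assumes H: "cadj H = H" and ev: "\<And>m. m \<le> CARD('n) \<Longrightarrow> \<exists>v. eigenbasis m (cut m H) v (ev m)"
  shows "r \<le> CARD('n) \<Longrightarrow> dim (generalized_eigenspace (skew r) (\<lambda>A. cut r (nij_op H A)) c) =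
    2 * (\<Sum>m<r. multiplicity_count ev m c) + multiplicity_count ev r c"
proof (induction r)
  case 0
  have "skew 0 \<subseteq> {0 :: 'n cmat}" by (auto simp: vec_eq_iff skew_entries(2)[where m = 0])
  then show ?case by (simp add: dim_generalized_eigenspace_zero multiplicity_count_def)
next
  case (Suc m)
  have lin: "linear (\<lambda>A. cut r (nij_op H A))" for r
    using linear_compose[OF linear_nij_op linear_cut] by (simp add: o_def)
  have inv: "cut (Suc m) (nij_op H A) \<in> skew (Suc m)" if "A \<in> skew (Suc m)" for A
    using that H by (intro cut_skew_in nij_op_skew) (auto simp: skew_def)
  have comm: "cut m (cut (Suc m) (nij_op H A)) = cut m (nij_op H (cut m A))" if "A \<in> skew (Suc m)" for A
    unfolding cut_nij_op[of m H A, symmetric] by (rule cut_cut) simp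
  obtain v0 v1 where e: "eigenbasis m (cut m H) v0 (ev m)" "eigenbasis (Suc m) (cut (Suc m) H) v1 (ev (Suc m))"
    using ev[of m] ev[of "Suc m"] Suc.prems by auto
  have "dim (generalized_eigenspace (border m) (\<lambda>A. cut (Suc m) (nij_op H A)) c) =
      multiplicity_count ev m c + multiplicity_count ev (Suc m) c"
    unfolding multiplicity_count_def by (rule border_multiplicity[OF Suc.prems H e])
  then show ?case
    using dim_generalized_eigenspace_add[OF subspace_skew lin inv linear_cut lin comm, of c]
      Suc.IH Suc.prems unfolding cut_image_skew border_def[symmetric] by simp
qed

text \<open>For \<open>H = 0\<close> the operator is multiplication by 2 and all eigenvalues of
  corners are 0, so the multiplicity of 2 is the whole dimension, namely twice the sum of
  \<open>0, ..., k - 1\<close> plus \<open>k\<close>.\<close>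

lemma dim_skew: "k \<le> CARD('n) \<Longrightarrow> dim (skew k :: ('n::{finite,linorder}) cmat set) = k\<^sup>2"
proof -
  assume k: "k \<le> CARD('n)"
  have H: "cadj (0 :: 'n cmat) = 0" by (simp add: cadj_simps)
  have ev: "\<exists>v. eigenbasis m (cut m (0 :: 'n cmat)) v ((\<lambda>_ _. 0) m)" if m: "m \<le> CARD('n)" for m
  proof -
    obtain v l where e: "eigenbasis m (cut m (0 :: 'n cmat)) v l" using eigenbasis_exists[OF H m] by blast
    have "l i = 0" if i: "i < m" for i
    proof -
      have "cut m (0 :: 'n cmat) *v v i = 0" by (simp add: linear_0[OF linear_cut])
      then have "cip (v i) (of_real (l i) *s v i) = 0" using eigenbasisD(2)[OF e i] by simp
      then show ?thesis using eigenbasisD(3)[OF e i i] by simp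
    qed
    then show ?thesis using eigenbasis_cong[OF e, of "\<lambda>_. 0"] by blast
  qed
  have "cut k (nij_op 0 A) = 2 *\<^sub>R A" if "A \<in> skew k" for A :: "'n cmat"
    using that by (simp add: nij_op_def mm_distrib cs_simps linear_cmul[OF linear_cut] skew_def)
  from generalized_eigenspace_scalar[where T = "skew k" and a = 2 and c = 2, OF subspace_skew this]
  have "generalized_eigenspace (skew k) (\<lambda>A. cut k (nij_op 0 A)) 2 = (skew k :: 'n cmat set)" by simp
  then have "dim (skew k :: 'n cmat set) = 2 * (\<Sum>m<k. m) + k"
    using skew_multiplicity[OF H ev k, of 2] by (simp add: multiplicity_count_def)
  also have "\<dots> = k\<^sup>2" by (induction k) (simp_all add: power2_eq_square)
  finally show ?thesis .
qed

section \<open>Removal of the block diagonal part\<close>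

lemma cut_eq_E: "cut m A = E m ** A ** E m"
  by (simp add: vec_eq_iff E_def diagm_mult)

lemma dim_compressed_skew:
  fixes P :: "('n::{finite,linorder}) cmat"
  assumes P: "projection r P"
  shows "dim {A. cadj A = - A \<and> P ** (A ** P) = A} = r\<^sup>2"
proof -
  obtain g where g: "g \<in> SU" and PE: "P = g ** E r ** cadj g" and r: "r \<le> CARD('n)"
    using projection_unitary_conj[OF P] by blast
  let ?c = "\<lambda>A :: 'n cmat. g ** (A ** cadj g)"
  have lin: "linear ?c" by (rule linearI) (simp_all add: mm_distrib)
  have EAE: "E r ** (A ** E r) = A" "cadj A = - A" if "A \<in> skew r" for A :: "'n cmat"
    using that by (auto simp: skew_def cut_eq_E mm_assoc)
  have Ec: "cadj (E r) = (E r :: 'n cmat)" using projection_E[OF r] by (simp add: projection_def)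
  have "?c ` skew r = {A. cadj A = - A \<and> P ** (A ** P) = A}"
  proof
    show "?c ` skew r \<subseteq> {A. cadj A = - A \<and> P ** (A ** P) = A}"
    proof (rule image_subsetI)
      fix A :: "'n cmat" assume A: "A \<in> skew r"
      have "P ** (?c A ** P) = g ** ((E r ** (A ** E r)) ** cadj g)"
        using g by (simp add: PE mm_assoc SU_D)
      then show "?c A \<in> {A. cadj A = - A \<and> P ** (A ** P) = A}"
        using EAE[OF A] by (simp add: cadj_simps mm_distrib mm_assoc)
    qed
    show "{A. cadj A = - A \<and> P ** (A ** P) = A} \<subseteq> ?c ` skew r"
    proof
      fix B assume "B \<in> {A. cadj A = - A \<and> P ** (A ** P) = A}"
      then have B: "cadj B = - B" "P ** (B ** P) = B" by auto
      let ?A = "cadj g ** (B ** g)"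
      have "E r ** (?A ** E r) = cadj g ** ((P ** (B ** P)) ** g)"
        using g by (simp add: PE mm_assoc SU_D)
      then have "?A \<in> skew r"
        unfolding B(2) using B(1) by (simp add: skew_def cut_eq_E mm_assoc cadj_simps mm_distrib)
      moreover have "B = ?c ?A" using g by (simp add: mm_assoc SU_D)
      ultimately show "B \<in> ?c ` skew r" by blast
    qed
  qed
  moreover have "skew r \<inter> {A. ?c A = 0} \<subseteq> {0}"
  proof
    fix A assume "A \<in> skew r \<inter> {A. ?c A = 0}"
    then have "cadj g ** (?c A ** g) = 0" by (simp add: mm_distrib)
    then show "A \<in> {0}" using g by (simp add: mm_assoc SU_D)
  qed
  then have "dim (skew r \<inter> {A. ?c A = 0}) = 0" unfolding dim_eq_0 .
  ultimately show ?thesis using dim_kernel_image[OF lin subspace_skew, of r] dim_skew[OF r] by simp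
qed

lemma projection_complement:
  fixes P :: "('n::finite) cmat"
  assumes "projection k P" "k \<le> CARD('n)" shows "projection (CARD('n) - k) (mat 1 - P)"
  using assms by (simp add: projection_def cadj_simps mm_distrib trace_simps of_nat_diff)

text \<open>The tangent space in terms of \<open>P\<close>, by \<open>tangent_orbit_eq\<close>: the
  skew-Hermitian matrices without diagonal blocks for the decomposition by \<open>P\<close> and
  \<open>1 - P\<close>.\<close>

definition off_diagonal :: "('n::finite) cmat \<Rightarrow> 'n cmat set" where
  "off_diagonal P = {A. cadj A = - A \<and> P ** (A ** P) = 0 \<and> (mat 1 - P) ** (A ** (mat 1 - P)) = 0}"

text \<open>The block diagonal part \<open>\<phi>\<close> intertwines \<open>nij_op P\<close> with
  an operator that is 0 on the block of \<open>P\<close> and 2 on the block of \<open>1 - P\<close>.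
  These blocks have dimensions \<open>k^2\<close> and \<open>(n - k)^2\<close>, to be taken away
  from the count for all skew-Hermitian matrices. The formulas are additive to avoid subtraction of
  natural numbers.\<close>

lemma off_diagonal_multiplicity:
  fixes P :: "('n::{finite,linorder}) cmat"
  assumes P: "projection k P" and ev: "\<And>m. m \<le> CARD('n) \<Longrightarrow> \<exists>v. eigenbasis m (cut m P) v (ev m)"
  shows "subspace (off_diagonal P)"
    and "\<And>A. A \<in> off_diagonal P \<Longrightarrow> nij_op P A \<in> off_diagonal P"
    and "dim (off_diagonal P) + k\<^sup>2 + (CARD('n) - k)\<^sup>2 = (CARD('n))\<^sup>2"
    and "dim (generalized_eigenspace (off_diagonal P) (nij_op P) c) + (if c = 0 then k\<^sup>2 else 0)
        + (if c = 2 then (CARD('n) - k)\<^sup>2 else 0) =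
      2 * (\<Sum>m<CARD('n). multiplicity_count ev m c) + (if c = 0 then k else 0) + (if c = 2 then CARD('n) - k else 0)"
proof -
  let ?n = "CARD('n)"
  define Q where "Q = mat 1 - P"
  have k: "k \<le> ?n" by (rule projection_unitary_conj(1)[OF P])
  have PQ: "P ** P = P" "P ** Q = 0" "Q ** P = 0" "Q ** Q = Q"
    "P ** (P ** A) = P ** A" "P ** (Q ** A) = 0" "Q ** (P ** A) = 0" "Q ** (Q ** A) = Q ** A" for A
    using P by (simp_all add: Q_def projection_def mm_distrib matrix_mul_assoc)
  have adj: "cadj P = P" "cadj Q = Q" using P by (simp_all add: Q_def projection_def cadj_simps)
  define \<phi> where "\<phi> A = P ** (A ** P) + Q ** (A ** Q)" for A
  define \<phi>2 where "\<phi>2 A = Q ** (A ** Q)" for A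
  define g where "g A = 2 *\<^sub>R (Q ** (A ** Q))" for A
  define g2 where "g2 A = 2 *\<^sub>R A" for A :: "'n cmat"
  have lin: "linear \<phi>" "linear \<phi>2" "linear g" "linear g2"
    unfolding \<phi>_def[abs_def] \<phi>2_def[abs_def] g_def[abs_def] g2_def[abs_def]
    by (rule linearI; simp add: mm_distrib algebra_simps)+
  let ?S = "skew ?n :: 'n cmat set"
  have S: "A \<in> ?S \<longleftrightarrow> cadj A = - A" for A by (simp add: skew_def)
  define D where "D = \<phi> ` ?S"
  let ?UP = "{A. cadj A = - A \<and> P ** (A ** P) = A}" and ?UQ = "{A. cadj A = - A \<and> Q ** (A ** Q) = A}"
  have T: "off_diagonal P = ?S \<inter> {A. \<phi> A = 0}"
  proof -
    have "P ** (A ** P) = 0 \<and> Q ** (A ** Q) = 0" if "\<phi> A = 0" for A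
    proof -
      have "P ** (\<phi> A ** P) = P ** (A ** P)" "Q ** (\<phi> A ** Q) = Q ** (A ** Q)"
        by (simp_all add: \<phi>_def mm_distrib mm_assoc PQ)
      then show ?thesis using that by (simp add: mm_distrib)
    qed
    then show ?thesis by (auto simp: off_diagonal_def S \<phi>_def Q_def[symmetric])
  qed
  have subS: "subspace ?S" by (rule subspace_skew)
  show subT: "subspace (off_diagonal P)" unfolding T by (rule subspace_Int_kernel[OF subS lin(1)])
  have subD: "subspace D" unfolding D_def by (rule linear_subspace_image[OF lin(1) subS])
  have invS: "nij_op P A \<in> ?S" if "A \<in> ?S" for A using that nij_op_skew[OF adj(1)] by (simp add: S)
  have comm: "\<phi> (nij_op P A) = g (\<phi> A)" for A
  proof -
    \<comment> \<open>Between two factors \<open>P\<close> the \<open>J_op\<close> terms cancel and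
      2 - 1 - 1 = 0 remains; between two factors \<open>Q\<close> everything but the leading 2 is
      killed.\<close>
    have "P ** (nij_op P A ** P) = 2 *\<^sub>R (P ** (A ** P)) - P ** (A ** P) - P ** (A ** P)"
      by (simp add: nij_op_def mm_distrib mm_assoc PQ)
    then have "P ** (nij_op P A ** P) = 0" by (simp add: scaleR_2)
    moreover have "Q ** (nij_op P A ** Q) = 2 *\<^sub>R (Q ** (A ** Q))"
      by (simp add: nij_op_def mm_distrib mm_assoc PQ)
    ultimately show ?thesis by (simp add: \<phi>_def g_def mm_distrib mm_assoc PQ)
  qed
  show "nij_op P A \<in> off_diagonal P" if "A \<in> off_diagonal P" for A
    using that invS comm[of A] linear_0[OF lin(3)] by (simp add: T)
  have DD: "\<phi> A = A" "cadj A = - A" if "A \<in> D" for A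
    using that by (auto simp: D_def S \<phi>_def mm_distrib mm_assoc PQ cadj_simps adj)
  have DI: "A \<in> D" if "\<phi> A = A" "cadj A = - A" for A
    using that unfolding D_def by (metis S image_eqI)
  have kerD: "D \<inter> {A. \<phi>2 A = 0} = ?UP"
  proof (intro Set.set_eqI iffI)
    fix A assume "A \<in> D \<inter> {A. \<phi>2 A = 0}"
    then show "A \<in> ?UP" using DD[of A] by (auto simp: \<phi>_def \<phi>2_def)
  next
    fix A assume A: "A \<in> ?UP"
    have "\<phi>2 (P ** (A ** P)) = 0" by (simp add: \<phi>2_def mm_distrib mm_assoc PQ)
    then have "\<phi>2 A = 0" using A by simp
    moreover have "\<phi> A = A" using A calculation by (simp add: \<phi>_def \<phi>2_def)
    ultimately show "A \<in> D \<inter> {A. \<phi>2 A = 0}" using A DI by auto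
  qed
  have imD: "\<phi>2 ` D = ?UQ"
  proof (intro Set.set_eqI iffI)
    fix B assume "B \<in> \<phi>2 ` D"
    then show "B \<in> ?UQ" using DD(2) by (auto simp: \<phi>2_def mm_distrib mm_assoc PQ cadj_simps adj)
  next
    fix B assume B: "B \<in> ?UQ"
    have "P ** ((Q ** (B ** Q)) ** P) = 0" by (simp add: mm_distrib mm_assoc PQ)
    then have "\<phi> B = B" using B by (simp add: \<phi>_def)
    then show "B \<in> \<phi>2 ` D" using B DI[of B] by (auto simp: \<phi>2_def intro!: image_eqI[of B _ B])
  qed
  have gD: "g A \<in> D" if "A \<in> D" for A
  proof -
    have "\<phi> (Q ** (A ** Q)) = Q ** (A ** Q)" by (simp add: \<phi>_def mm_distrib mm_assoc PQ)
    then have "\<phi> (g A) = g A" by (simp add: g_def linear_cmul[OF lin(1)])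
    then show ?thesis using DD(2)[OF that] by (intro DI) (auto simp: g_def cadj_simps adj mm_distrib mm_assoc)
  qed
  have comm2: "\<phi>2 (g A) = g2 (\<phi>2 A)" for A
    by (simp add: \<phi>2_def g_def g2_def mm_distrib mm_assoc PQ)
  have subU: "subspace ?UP" "subspace ?UQ"
    unfolding kerD[symmetric] imD[symmetric]
    by (rule subspace_Int_kernel[OF subD lin(2)], rule linear_subspace_image[OF lin(2) subD])
  have dimU: "dim ?UP = k\<^sup>2" "dim ?UQ = (?n - k)\<^sup>2"
    using dim_compressed_skew[OF P] dim_compressed_skew[OF projection_complement[OF P k]] by (simp_all add: Q_def)
  have g0: "g A = 0 *\<^sub>R A" if "A \<in> ?UP" for A
  proof -
    have "A \<in> D \<inter> {A. \<phi>2 A = 0}" using that unfolding kerD .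
    then show ?thesis by (simp add: g_def \<phi>2_def)
  qed
  have "dim (generalized_eigenspace ?UP g c) = (if c = 0 then k\<^sup>2 else 0)"
    using generalized_eigenspace_scalar[where T = ?UP and f = g and a = 0, OF subU(1) g0, of c] dimU by simp
  moreover have "dim (generalized_eigenspace ?UQ g2 c) = (if c = 2 then (?n - k)\<^sup>2 else 0)"
    using generalized_eigenspace_scalar[where T = ?UQ and f = g2 and a = 2, OF subU(2) g2_def, of c] dimU by simp
  ultimately have genD: "dim (generalized_eigenspace D g c) =
      (if c = 0 then k\<^sup>2 else 0) + (if c = 2 then (?n - k)\<^sup>2 else 0)"
    using dim_generalized_eigenspace_add[OF subD lin(3) gD lin(2) lin(4) comm2, of c] unfolding kerD imD by simp
  have genS: "dim (generalized_eigenspace ?S (nij_op P) c) =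
      dim (generalized_eigenspace (off_diagonal P) (nij_op P) c) + dim (generalized_eigenspace D g c)"
    using dim_generalized_eigenspace_add[OF subS linear_nij_op invS lin(1) lin(3) comm, of c]
    unfolding T[symmetric] D_def[symmetric] .
  obtain v where "eigenbasis ?n (cut ?n P) v (ev ?n)" using ev[of ?n] by blast
  then have e: "eigenbasis ?n P v (ev ?n)" by simp
  note evn = projection_eigenvalues(2)[OF P e]
  \<comment> \<open>The corner of full size is \<open>P\<close> itself: its eigenvalue 1, taken
    \<open>k\<close> times, gives 0, and its eigenvalue 0 gives 2.\<close>
  have "{j. j < ?n \<and> 2 * (1 - ev ?n j) = c} = (if c = 0 then {?n - k..<?n} else {}) \<union> (if c = 2 then {..<?n - k} else {})"
    using evn by (auto split: if_splits)
  then have "multiplicity_count ev ?n c = (if c = 0 then k else 0) + (if c = 2 then ?n - k else 0)"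
    unfolding multiplicity_count_def using k by auto
  then show "dim (generalized_eigenspace (off_diagonal P) (nij_op P) c) + (if c = 0 then k\<^sup>2 else 0)
        + (if c = 2 then (?n - k)\<^sup>2 else 0) =
      2 * (\<Sum>m<?n. multiplicity_count ev m c) + (if c = 0 then k else 0) + (if c = 2 then ?n - k else 0)"
    using skew_multiplicity[OF adj(1) ev, of ?n c] genS genD by simp
  have "dim ?S = dim (off_diagonal P) + dim D"
    using dim_kernel_image[OF lin(1) subS] unfolding T[symmetric] D_def[symmetric] .
  moreover have "dim D = k\<^sup>2 + (?n - k)\<^sup>2"
    using dim_kernel_image[OF lin(2) subD] dimU unfolding kerD imD by simp
  ultimately show "dim (off_diagonal P) + k\<^sup>2 + (?n - k)\<^sup>2 = ?n\<^sup>2"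
    using dim_skew[of ?n, where 'n = 'n] by simp
qed

text \<open>Tangent vectors satisfy \<open>P A + A P = A\<close>, which reduces the summand
  \<open>2 A\<close> of \<open>nij_op\<close> to \<open>A\<close>; what remains is the bracket of
  \<open>x\<close> with \<open>J_op A\<close>.\<close>

lemma tangent_orbit_eq:
  fixes P :: "('n::{finite,linorder}) cmat"
  assumes P: "projection k P" and x: "x = cs \<i> (P - cs a (mat 1))" and xs: "cadj x = - x"
  shows "tangent_orbit x = off_diagonal P"
    and "A \<in> off_diagonal P \<Longrightarrow> A + lie_bracket x (J_op A) = nij_op P A"
proof -
  have PP: "P ** P = P" "P ** (P ** A) = P ** A" for A
    using P by (auto simp: projection_def matrix_mul_assoc)
  have br: "lie_bracket x A = cs \<i> (P ** A - A ** P)" "lie_bracket A x = cs \<i> (A ** P - P ** A)" for A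
    by (simp_all add: x lie_bracket_def mm_distrib cs_simps)
  have off: "A ** P + P ** A = A" "P ** (A ** P) = 0" "cadj A = - A" if "A \<in> off_diagonal P" for A
  proof -
    show 0: "P ** (A ** P) = 0" "cadj A = - A" using that by (auto simp: off_diagonal_def)
    have "(mat 1 - P) ** (A ** (mat 1 - P)) = 0" using that by (simp add: off_diagonal_def)
    then show "A ** P + P ** A = A" using 0 by (simp add: mm_distrib algebra_simps)
  qed
  show "tangent_orbit x = off_diagonal P"
  proof
    show "tangent_orbit x \<subseteq> off_diagonal P"
    proof
      fix A assume A: "A \<in> tangent_orbit x"
      then obtain Z where Z: "A = lie_bracket Z x" by (auto simp: tangent_orbit_def)
      have "cadj A = - A" using tangent_orbit_su[OF xs] A su_D(1) by blast
      then show "A \<in> off_diagonal P"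
        by (simp add: off_diagonal_def Z br mm_distrib cs_simps PP mm_assoc)
    qed
    show "off_diagonal P \<subseteq> tangent_orbit x"
    proof
      fix A assume A: "A \<in> off_diagonal P"
      have "lie_bracket (lie_bracket x A) x = A ** P + P ** A"
        unfolding br by (simp add: mm_distrib cs_simps PP mm_assoc off(2)[OF A])
      then have "A = lie_bracket (lie_bracket x A) x" using off(1)[OF A] by simp
      moreover have "lie_bracket x A \<in> su" by (rule lie_bracket_skew[OF xs off(3)[OF A]])
      ultimately show "A \<in> tangent_orbit x" unfolding tangent_orbit_def by blast
    qed
  qed
  assume A: "A \<in> off_diagonal P"
  have "nij_op P A = 2 *\<^sub>R A - (A ** P + P ** A) + cs \<i> (P ** J_op A - J_op A ** P)"
    by (simp add: nij_op_def mm_distrib cs_simps)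
  then show "A + lie_bracket x (J_op A) = nij_op P A"
    unfolding off(1)[OF A] br by (simp add: scaleR_2)
qed

section \<open>Rational functions along a curve\<close>

text \<open>A continuous function that is rational in cleared form. The condition at 1 keeps the
  denominator from being the zero polynomial and transfers nonvanishing at 1 to the numerator; zeros
  of \<open>q\<close> elsewhere in \<open>X\<close> are allowed.\<close>

definition rfun :: "real set \<Rightarrow> (real \<Rightarrow> complex) \<Rightarrow> bool" where
  "rfun X \<phi> \<longleftrightarrow> continuous_on X \<phi> \<and> (\<exists>p q. poly q 1 \<noteq> 0 \<and>
     (\<forall>t\<in>X. poly q (complex_of_real t) * \<phi> t = poly p (complex_of_real t)))"

lemma rfunI:
  assumes "continuous_on X \<phi>" "poly q 1 \<noteq> 0"
    "\<And>t. t \<in> X \<Longrightarrow> poly q (complex_of_real t) * \<phi> t = poly p (complex_of_real t)"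
  shows "rfun X \<phi>"
  using assms unfolding rfun_def by blast

lemma rfunE:
  assumes "rfun X \<phi>"
  obtains p q where "continuous_on X \<phi>" "poly q 1 \<noteq> 0"
    "\<And>t. t \<in> X \<Longrightarrow> poly q (complex_of_real t) * \<phi> t = poly p (complex_of_real t)"
  using assms unfolding rfun_def by blast

lemma rfun_const: "rfun X (\<lambda>_. c)"
  by (rule rfunI[where q = 1 and p = "[:c:]"]) auto

lemma rfun_of_real: "rfun X (\<lambda>t. complex_of_real t)"
  by (rule rfunI[where q = 1 and p = "[:0, 1:]"]) (auto intro!: continuous_intros)

lemma rfun_add:
  assumes "rfun X \<phi>" "rfun X \<psi>" shows "rfun X (\<lambda>t. \<phi> t + \<psi> t)"
proof -
  from assms(1) obtain p q where 1: "continuous_on X \<phi>" "poly q 1 \<noteq> 0"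
    "\<And>t. t \<in> X \<Longrightarrow> poly q (complex_of_real t) * \<phi> t = poly p (complex_of_real t)" by (rule rfunE) blast
  from assms(2) obtain p' q' where 2: "continuous_on X \<psi>" "poly q' 1 \<noteq> 0"
    "\<And>t. t \<in> X \<Longrightarrow> poly q' (complex_of_real t) * \<psi> t = poly p' (complex_of_real t)" by (rule rfunE) blast
  show ?thesis
  proof (rule rfunI[where q = "q * q'" and p = "p * q' + p' * q"])
    show "continuous_on X (\<lambda>t. \<phi> t + \<psi> t)" using 1 2 by (intro continuous_on_add)
    fix t assume t: "t \<in> X"
    show "poly (q * q') (complex_of_real t) * (\<phi> t + \<psi> t) = poly (p * q' + p' * q) (complex_of_real t)"
      by (simp add: 1(3)[OF t, symmetric] 2(3)[OF t, symmetric] algebra_simps)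
  qed (use 1 2 in simp)
qed

lemma rfun_mult:
  assumes "rfun X \<phi>" "rfun X \<psi>" shows "rfun X (\<lambda>t. \<phi> t * \<psi> t)"
proof -
  from assms(1) obtain p q where 1: "continuous_on X \<phi>" "poly q 1 \<noteq> 0"
    "\<And>t. t \<in> X \<Longrightarrow> poly q (complex_of_real t) * \<phi> t = poly p (complex_of_real t)" by (rule rfunE) blast
  from assms(2) obtain p' q' where 2: "continuous_on X \<psi>" "poly q' 1 \<noteq> 0"
    "\<And>t. t \<in> X \<Longrightarrow> poly q' (complex_of_real t) * \<psi> t = poly p' (complex_of_real t)" by (rule rfunE) blast
  show ?thesis
  proof (rule rfunI[where q = "q * q'" and p = "p * p'"])
    show "continuous_on X (\<lambda>t. \<phi> t * \<psi> t)" using 1 2 by (intro continuous_on_mult)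
    fix t assume t: "t \<in> X"
    show "poly (q * q') (complex_of_real t) * (\<phi> t * \<psi> t) = poly (p * p') (complex_of_real t)"
      by (simp add: 1(3)[OF t, symmetric] 2(3)[OF t, symmetric] algebra_simps)
  qed (use 1 2 in simp)
qed

lemma rfun_inverse:
  assumes "rfun X \<phi>" "1 \<in> X" "\<And>t. t \<in> X \<Longrightarrow> \<phi> t \<noteq> 0" shows "rfun X (\<lambda>t. inverse (\<phi> t))"
proof -
  from assms(1) obtain p q where 1: "continuous_on X \<phi>" "poly q 1 \<noteq> 0"
    "\<And>t. t \<in> X \<Longrightarrow> poly q (complex_of_real t) * \<phi> t = poly p (complex_of_real t)" by (rule rfunE) blast
  show ?thesis
  proof (rule rfunI[where q = p and p = q])
    show "continuous_on X (\<lambda>t. inverse (\<phi> t))" using 1 assms by (intro continuous_on_inverse) auto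
    show "poly p 1 \<noteq> 0" using 1(3)[OF assms(2)] 1(2) assms(3)[OF assms(2)] by auto
    fix t assume t: "t \<in> X"
    show "poly p (complex_of_real t) * inverse (\<phi> t) = poly q (complex_of_real t)"
      using assms(3)[OF t] by (simp add: 1(3)[OF t, symmetric])
  qed
qed

lemma rfun_sum: "(\<And>i. i \<in> I \<Longrightarrow> rfun X (\<phi> i)) \<Longrightarrow> rfun X (\<lambda>t. \<Sum>i\<in>I. \<phi> i t)"
  by (induction I rule: infinite_finite_induct) (auto intro!: rfun_const rfun_add)

lemma rfun_prod: "(\<And>i. i \<in> I \<Longrightarrow> rfun X (\<phi> i)) \<Longrightarrow> rfun X (\<lambda>t. \<Prod>i\<in>I. \<phi> i t)"
  by (induction I rule: infinite_finite_induct) (auto intro!: rfun_const rfun_mult)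

lemma rfun_diff:
  assumes "rfun X \<phi>" "rfun X \<psi>" shows "rfun X (\<lambda>t. \<phi> t - \<psi> t)"
  using rfun_add[OF assms(1) rfun_mult[OF rfun_const[of X "-1"] assms(2)]] by simp

lemma rfun_if: "rfun X \<phi> \<Longrightarrow> rfun X \<psi> \<Longrightarrow> rfun X (\<lambda>t. if b then \<phi> t else \<psi> t)"
  by (cases b) simp_all

lemma rfun_det:
  fixes A :: "real \<Rightarrow> complex^'n^'n"
  assumes "\<And>i j. rfun X (\<lambda>t. A t $ i $ j)" shows "rfun X (\<lambda>t. det (A t))"
  unfolding det_def by (intro rfun_sum rfun_mult rfun_const rfun_prod assms)

lemma rfun_mm:
  fixes A B :: "real \<Rightarrow> ('n::finite) cmat"
  assumes "\<And>i j. rfun X (\<lambda>t. A t $ i $ j)" "\<And>i j. rfun X (\<lambda>t. B t $ i $ j)"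
  shows "rfun X (\<lambda>t. (A t ** B t) $ i $ j)"
  unfolding matrix_matrix_mult_def vec_lambda_beta by (intro rfun_sum rfun_mult assms)

text \<open>Nonvanishing at 1 makes the numerator a nonzero polynomial. It has finitely many zeros,
  so every interval next to 0 contains points where the function does not vanish.\<close>

lemma rfun_nonzero_near_0:
  assumes X: "open X" "0 \<in> X" "1 \<in> X" and \<phi>: "rfun X \<phi>" "\<phi> 1 \<noteq> 0" and e: "e > 0"
  obtains t where "t \<in> X" "\<bar>t\<bar> < e" "\<phi> t \<noteq> 0"
proof -
  from \<phi>(1) obtain p q where pq: "continuous_on X \<phi>" "poly q 1 \<noteq> 0"
    "\<And>t. t \<in> X \<Longrightarrow> poly q (complex_of_real t) * \<phi> t = poly p (complex_of_real t)" by (rule rfunE) blast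
  have "poly p 1 \<noteq> 0" using pq(3)[OF X(3)] pq(2) \<phi>(2) by auto
  then have "p \<noteq> 0" by auto
  then have "finite {z. poly p z = 0}" by (rule poly_roots_finite)
  then have fin: "finite (complex_of_real -` {z. poly p z = 0})"
    by (rule finite_vimageI) (simp add: inj_of_real)
  obtain d where d: "d > 0" "ball 0 d \<subseteq> X" using X open_contains_ball by blast
  have "infinite {0<..<min d e}" using d e by simp
  then obtain t where t: "t \<in> {0<..<min d e}" "t \<notin> complex_of_real -` {z. poly p z = 0}"
    using fin by (meson finite_subset subsetI)
  then have "t \<in> X" "\<bar>t\<bar> < e" using d by (auto simp: dist_real_def)
  moreover have "\<phi> t \<noteq> 0" using t(2) pq(3)[OF \<open>t \<in> X\<close>] by auto
  ultimately show thesis using that by blast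
qed

section \<open>A rational curve of projections\<close>

text \<open>The inverse by Cramer's rule, which keeps its entries rational in
  \<open>t\<close>.\<close>

definition cofactor_inverse :: "('n::finite) cmat \<Rightarrow> 'n cmat" where
  "cofactor_inverse G = (\<chi> i j. det (\<chi> a b. if b = i then (if a = j then 1 else 0) else G $ a $ b) * inverse (det G))"

lemma cofactor_inverse:
  fixes G :: "('n::finite) cmat"
  assumes "det G \<noteq> 0"
  shows "G ** cofactor_inverse G = mat 1" "cofactor_inverse G ** G = mat 1"
proof -
  show "G ** cofactor_inverse G = mat 1"
  proof -
    have "(G ** cofactor_inverse G) $ a $ j = mat 1 $ a $ j" for a j
    proof -
      define b :: "complex^'n" where "b = (\<chi> a. if a = j then 1 else 0)"
      have "G *v (\<chi> k. det (\<chi> i l. if l = k then b $ i else G $ i $ l) / det G) = b"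
        using cramer[OF assms] by blast
      moreover have "(G ** cofactor_inverse G) $ a $ j =
          (G *v (\<chi> k. det (\<chi> i l. if l = k then b $ i else G $ i $ l) / det G)) $ a"
        unfolding matrix_matrix_mult_def matrix_vector_mult_def cofactor_inverse_def b_def divide_inverse
          vec_lambda_beta ..
      ultimately show ?thesis by (simp add: b_def mat_def)
    qed
    then show ?thesis by (simp add: vec_eq_iff)
  qed
  then show "cofactor_inverse G ** G = mat 1" using matrix_left_right_inverse by blast
qed

text \<open>
  The projection onto the range of the first \<open>k\<close> columns of \<open>(1 - t) g + t h\<close>, written with the
  Gram matrix of these columns; it is a rational function of \<open>t\<close>.
\<close>

lemma projection_curve:
  fixes g h :: "('n::{finite,linorder}) cmat"
  assumes k: "k \<le> CARD('n)" and g: "g \<in> SU" and h: "h \<in> SU"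
  obtains X P where "open X" "0 \<in> X" "1 \<in> X" "\<forall>t\<in>X. projection k (P t)"
    "P 0 = g ** E k ** cadj g" "P 1 = h ** E k ** cadj h" "\<forall>i j. rfun X (\<lambda>t. P t $ i $ j)"
proof -
  define S where "S t = ((1 - t) *\<^sub>R g + t *\<^sub>R h) ** E k" for t
  \<comment> \<open>\<open>S t\<close> has only its first \<open>k\<close> columns. Adding
    \<open>F\<close> puts an identity block into the empty part of the Gram matrix, so that it can
    be inverted at full size; the added block is annihilated by \<open>S t\<close>.\<close>
  define F where "F = mat 1 - (E k :: 'n cmat)"
  define G where "G t = cadj (S t) ** S t + F" for t
  define X where "X = {t. det (G t) \<noteq> 0}"
  define A where "A t = cofactor_inverse (G t)" for t
  define P where "P t = S t ** (A t ** cadj (S t))" for t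
  have E: "cadj (E k) = (E k :: 'n cmat)" "E k ** E k = (E k :: 'n cmat)" "trace (E k :: 'n cmat) = of_nat k"
    using projection_E[OF k] by (auto simp: projection_def)
  have E2: "E k ** (E k ** B) = E k ** B" for B :: "'n cmat" using E(2) by (simp add: matrix_mul_assoc)
  have SF: "S t ** F = 0" "F ** cadj (S t) = 0" for t
    by (simp_all add: S_def F_def mm_distrib cadj_simps E mm_assoc E2)
  have SF2: "S t ** (F ** B) = 0" for t B using SF(1)[of t] by (simp add: matrix_mul_assoc mm_distrib)
  have FF: "F ** F = F" "cadj F = F" by (simp_all add: F_def mm_distrib cadj_simps E)
  have Gadj: "cadj (G t) = G t" for t by (simp add: G_def cadj_simps FF)
  have GF: "G t ** F = F" for t by (simp add: G_def mm_distrib mm_assoc SF FF)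
  \<comment> \<open>At both ends the columns are orthonormal, so the Gram matrix is the identity and
    both endpoints lie in \<open>X\<close>.\<close>
  have SE: "S 0 = g ** E k" "S 1 = h ** E k" by (simp_all add: S_def)
  have GE: "G 0 = mat 1" "G 1 = mat 1"
    using g h by (simp_all add: G_def SE cadj_simps E mm_assoc SU_D F_def)
  have X01: "0 \<in> X" "1 \<in> X" by (simp_all add: X_def GE)
  have A: "G t ** A t = mat 1" "A t ** G t = mat 1" if "t \<in> X" for t
    using that cofactor_inverse[of "G t"] by (simp_all add: X_def A_def)
  have A01: "A 0 = mat 1" "A 1 = mat 1" using A[OF X01(1)] A[OF X01(2)] by (simp_all add: GE)
  have P01: "P 0 = g ** E k ** cadj g" "P 1 = h ** E k ** cadj h"
    by (simp_all add: P_def A01 SE cadj_simps E mm_assoc E2)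
  have S_nth: "S t $ i $ j = (complex_of_real (1 - t) * g $ i $ j + of_real t * h $ i $ j) * (if pos j < k then 1 else 0)" for t i j
    unfolding S_def E_def diagm_mult by simp (simp add: scaleR_conv_of_real)
  have rS: "rfun Y (\<lambda>t. S t $ i $ j)" for Y i j
    unfolding S_nth of_real_diff of_real_1
    by (intro rfun_mult rfun_add rfun_diff rfun_const rfun_of_real)
  have cS_nth: "cadj (S t) $ i $ j = (complex_of_real (1 - t) * cnj (g $ j $ i) + of_real t * cnj (h $ j $ i)) * (if pos i < k then 1 else 0)" for t i j
    by (simp add: S_nth)
  have rcS: "rfun Y (\<lambda>t. cadj (S t) $ i $ j)" for Y i j
    unfolding cS_nth of_real_diff of_real_1
    by (intro rfun_mult rfun_add rfun_diff rfun_const rfun_of_real)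
  have rG: "rfun Y (\<lambda>t. G t $ i $ j)" for Y i j
    unfolding G_def vector_add_component by (intro rfun_add rfun_const rfun_mm rS rcS)
  have rdG: "rfun Y (\<lambda>t. det (G t))" for Y by (intro rfun_det rG)
  have "open X"
  proof -
    have "continuous_on UNIV (\<lambda>t. det (G t))" using rdG[of UNIV] by (simp add: rfun_def)
    then have "open ((\<lambda>t. det (G t)) -` (- {0}))" by (intro open_vimage) auto
    then show ?thesis by (simp add: X_def vimage_def)
  qed
  moreover have "rfun X (\<lambda>t. A t $ i $ j)" for i j
    unfolding A_def cofactor_inverse_def vec_lambda_beta
    by (intro rfun_mult rfun_det rfun_inverse rdG) (auto simp: X_def GE intro!: rfun_const rG rfun_if)
  then have "rfun X (\<lambda>t. P t $ i $ j)" for i j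
    unfolding P_def by (intro rfun_mm rS rcS)
  moreover have "projection k (P t)" if t: "t \<in> X" for t
  proof -
    note A = A[OF t]
    have "cadj (A t) ** G t = mat 1"
      using arg_cong[OF A(1), of cadj] by (simp add: cadj_simps Gadj)
    then have "cadj (A t) ** (G t ** A t) = A t" by (simp add: matrix_mul_assoc)
    then have cA: "cadj (A t) = A t" by (simp add: A)
    have "A t ** (G t ** F) = F" by (simp only: matrix_mul_assoc A matrix_mul_lid)
    then have AF: "A t ** F = F" by (simp add: GF)
    have AF2: "A t ** (F ** B) = F ** B" for B using AF by (simp add: matrix_mul_assoc)
    have AG2: "A t ** (G t ** B) = B" for B by (simp add: matrix_mul_assoc A)
    have SS: "cadj (S t) ** S t = G t - F" by (simp add: G_def)
    have SS2: "cadj (S t) ** (S t ** B) = G t ** B - F ** B" for B :: "'n cmat"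
      by (simp add: matrix_mul_assoc SS mm_distrib)
    have "P t ** P t = P t"
      by (simp add: P_def mm_assoc SS2 mm_distrib AG2 AF2 SF2)
    moreover have "cadj (P t) = P t" by (simp add: P_def cadj_simps cA mm_assoc)
    moreover have "trace (P t) = of_nat k"
    proof -
      have "trace (P t) = trace ((A t ** cadj (S t)) ** S t)" unfolding P_def by (rule trace_mul_sym)
      also have "\<dots> = trace (mat 1 - F)" by (simp add: mm_assoc SS mm_distrib A AF)
      finally show ?thesis by (simp add: F_def E)
    qed
    ultimately show ?thesis by (simp add: projection_def)
  qed
  ultimately show thesis using that[of X P] X01 P01 by blast
qed

section \<open>Hankel determinants of power sums\<close>

text \<open>The matrix factors as a Vandermonde matrix transposed times itself. A kernel vector is
  the coefficient list of a polynomial of degree below \<open>r\<close> that vanishes at all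
  \<open>y p\<close>, and a nonzero one exists exactly when there are fewer than \<open>r\<close>
  distinct values.\<close>

lemma hankel_det_nonzero_iff:
  fixes y :: "'a \<Rightarrow> real"
  assumes F: "finite F" and r: "card F = r"
  shows "Determinant.det (Matrix.mat r r (\<lambda>(a,b). \<Sum>p\<in>F. complex_of_real (y p) ^ (a + b))) \<noteq> 0 \<longleftrightarrow> inj_on y F"
proof -
  let ?H = "Matrix.mat r r (\<lambda>(a,b). \<Sum>p\<in>F. complex_of_real (y p) ^ (a + b))"
  have H: "?H \<in> carrier_mat r r" by simp
  define w where "w v p = (\<Sum>b<r. Matrix.vec_index v b * complex_of_real (y p) ^ b)" for v p
  have Hv: "Matrix.vec_index (?H *\<^sub>v v) a = (\<Sum>p\<in>F. complex_of_real (y p) ^ a * w v p)"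
    if v: "v \<in> carrier_vec r" and a: "a < r" for v a
  proof -
    have "Matrix.vec_index (?H *\<^sub>v v) a = (\<Sum>b<r. (\<Sum>p\<in>F. complex_of_real (y p) ^ (a + b)) * Matrix.vec_index v b)"
      using v a by (simp add: scalar_prod_def atLeast0LessThan)
    also have "\<dots> = (\<Sum>b<r. \<Sum>p\<in>F. complex_of_real (y p) ^ a * (Matrix.vec_index v b * complex_of_real (y p) ^ b))"
      unfolding sum_distrib_right by (intro sum.cong refl) (simp add: power_add mult_ac)
    also have "\<dots> = (\<Sum>p\<in>F. complex_of_real (y p) ^ a * w v p)"
      by (subst sum.swap) (simp add: w_def sum_distrib_left)
    finally show ?thesis .
  qed
  show ?thesis
  proof
    assume inj: "inj_on y F"
    show "Determinant.det ?H \<noteq> 0"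
    proof
      assume "Determinant.det ?H = 0"
      then obtain v where v: "v \<in> carrier_vec r" "v \<noteq> 0\<^sub>v r" "?H *\<^sub>v v = 0\<^sub>v r"
        using det_0_iff_vec_prod_zero_field[OF H] by blast
      \<comment> \<open>Pairing with the conjugate of \<open>v\<close> gives a sum of squared
        moduli, because the \<open>y p\<close> are real.\<close>
      have "0 = (\<Sum>a<r. cnj (Matrix.vec_index v a) * Matrix.vec_index (?H *\<^sub>v v) a)" by (simp add: v(3))
      also have "\<dots> = (\<Sum>a<r. \<Sum>p\<in>F. (cnj (Matrix.vec_index v a) * complex_of_real (y p) ^ a) * w v p)"
        by (intro sum.cong refl) (simp add: Hv[OF v(1)] sum_distrib_left mult_ac del: index_mult_mat_vec)
      also have "\<dots> = (\<Sum>p\<in>F. cnj (w v p) * w v p)"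
        by (subst sum.swap) (simp add: w_def sum_distrib_right)
      also have "\<dots> = of_real (\<Sum>p\<in>F. (cmod (w v p))\<^sup>2)"
        unfolding of_real_sum complex_norm_square by (simp add: mult.commute)
      finally have "(\<Sum>p\<in>F. (cmod (w v p))\<^sup>2) = 0" by (metis of_real_eq_0_iff)
      then have w0: "w v p = 0" if "p \<in> F" for p
        using that F by (simp add: sum_nonneg_eq_0_iff)
      define q where "q = (\<Sum>b<r. monom (Matrix.vec_index v b) b)"
      have cq: "coeff q b = (if b < r then Matrix.vec_index v b else 0)" for b
        by (simp add: q_def coeff_sum)
      have "q \<noteq> 0"
      proof
        assume "q = 0"
        then have "Matrix.vec_index v b = 0" if "b < r" for b using cq[of b] that by simp
        then have "v = 0\<^sub>v r" using v(1) by (intro eq_vecI) auto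
        then show False using v(2) by simp
      qed
      have "(\<lambda>p. complex_of_real (y p)) ` F \<subseteq> {z. poly q z = 0}"
        using w0 by (auto simp: q_def poly_sum poly_monom w_def)
      then have "card ((\<lambda>p. complex_of_real (y p)) ` F) \<le> card {z. poly q z = 0}"
        by (intro card_mono poly_roots_finite \<open>q \<noteq> 0\<close>)
      also have "\<dots> \<le> degree q" by (rule card_poly_roots_bound[OF \<open>q \<noteq> 0\<close>])
      also have "degree q < r"
      proof (rule ccontr)
        assume "\<not> degree q < r"
        then have "lead_coeff q = 0" by (simp add: cq)
        then show False using \<open>q \<noteq> 0\<close> by simp
      qed
      finally show False using inj r by (simp add: card_image inj_on_def)
    qed
  next
    assume "Determinant.det ?H \<noteq> 0"
    show "inj_on y F"
    proof (rule ccontr)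
      assume "\<not> inj_on y F"
      then have less: "card (y ` F) < r"
        using F r card_image_le[OF F, of y] eq_card_imp_inj_on[OF F, of y] by linarith
      define q where "q = (\<Prod>c\<in>y ` F. [:- complex_of_real c, 1:])"
      have q0: "q \<noteq> 0" using F by (simp add: q_def)
      have dq: "degree q < r"
        using F less unfolding q_def by (subst degree_prod_eq_sum_degree) auto
      define v where "v = Matrix.vec r (coeff q)"
      have vC: "v \<in> carrier_vec r" by (simp add: v_def)
      have "Matrix.vec_index v (degree q) \<noteq> 0" using dq q0 by (simp add: v_def)
      then have "v \<noteq> 0\<^sub>v r" using dq by auto
      moreover have "w v p = 0" if p: "p \<in> F" for p
      proof -
        have "w v p = (\<Sum>b<r. coeff q b * complex_of_real (y p) ^ b)"
          unfolding w_def by (intro sum.cong refl) (simp add: v_def)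
        also have "\<dots> = (\<Sum>b\<le>degree q. coeff q b * complex_of_real (y p) ^ b)"
          using dq by (intro sum.mono_neutral_right) (auto simp: coeff_eq_0)
        also have "\<dots> = poly q (complex_of_real (y p))" by (simp add: poly_altdef)
        also have "\<dots> = 0" using p F by (auto simp: q_def poly_prod)
        finally show ?thesis .
      qed
      then have "?H *\<^sub>v v = 0\<^sub>v r" by (intro eq_vecI) (simp_all add: Hv[OF vC] del: index_mult_mat_vec)
      ultimately have "Determinant.det ?H = 0" using det_0_iff_vec_prod_zero_field[OF H] vC by blast
      then show False using \<open>Determinant.det ?H \<noteq> 0\<close> by simp
    qed
  qed
qed

section \<open>Power sums of eigenvalues as traces\<close>

text \<open>The iteration starts from \<open>E m\<close>, the identity of the padded corner, so that
  exponent 0 gives \<open>m\<close> and not the full size.\<close>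

definition power_trace :: "nat \<Rightarrow> ('n::{finite,linorder}) cmat \<Rightarrow> nat \<Rightarrow> complex" where
  "power_trace m P e = trace (((**) (2 *\<^sub>R (E m - cut m P)) ^^ e) (E m))"

lemma power_trace_eq:
  fixes P :: "('n::{finite,linorder}) cmat"
  assumes e: "eigenbasis m (cut m P) v l"
  shows "power_trace m P k = (\<Sum>j<m. complex_of_real (2 * (1 - l j)) ^ k)"
proof -
  \<comment> \<open>The spectral form of the powers, proved by induction.\<close>
  define R where "R k = (\<chi> a b. \<Sum>j<m. complex_of_real (2 * (1 - l j)) ^ k * (v j $ a * cnj (v j $ b)))" for k
  let ?B = "2 *\<^sub>R (E m - cut m P)"
  have v0: "v j $ b = 0" if "j < m" "\<not> pos b < m" for j b
    using eigenbasisD(1)[OF e that(1)] that(2) by (simp add: corner_space_def)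
  have Ev: "E m *v v j = v j" if "j < m" for j
  proof -
    have "(E m *v v j) $ a = (\<Sum>b\<in>UNIV. if a = b then v j $ b else 0)" for a
      unfolding matrix_vector_mult_def vec_lambda_beta E_nth
      by (intro sum.cong refl) (use v0[OF that] in auto)
    then show ?thesis by (simp add: vec_eq_iff)
  qed
  have Bv: "?B *v v j = complex_of_real (2 * (1 - l j)) *s v j" if "j < m" for j
  proof -
    have "?B *v v j = 2 *\<^sub>R (E m *v v j - cut m P *v v j)"
      unfolding matrix_vector_diff[symmetric]
      by (simp add: vec_eq_iff matrix_vector_mult_def scaleR_sum_right)
    then show ?thesis
      using Ev[OF that] eigenbasisD(2)[OF e that]
      by (simp add: vec_eq_iff) (simp add: scaleR_conv_of_real algebra_simps)
  qed
  have "((**) ?B ^^ k) (E m) = R k" for k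
  proof (induction k)
    case 0
    have "E m $ a $ b = R 0 $ a $ b" for a b
    proof (cases "pos b < m")
      case True
      then show ?thesis using eigenbasis_resolution(1)[OF e True, of a] by (auto simp: R_def E_nth)
    next
      case False
      then show ?thesis by (auto simp: R_def E_nth v0)
    qed
    then show ?case by (simp add: vec_eq_iff)
  next
    case (Suc k)
    have "(?B ** R k) $ a $ b = R (Suc k) $ a $ b" for a b
    proof -
      have "(?B ** R k) $ a $ b = (\<Sum>c\<in>UNIV. \<Sum>j<m. complex_of_real (2 * (1 - l j)) ^ k * cnj (v j $ b) * (?B $ a $ c * v j $ c))"
        unfolding matrix_matrix_mult_def vec_lambda_beta R_def sum_distrib_left by (simp only: mult_ac)
      also have "\<dots> = (\<Sum>j<m. complex_of_real (2 * (1 - l j)) ^ k * cnj (v j $ b) * (?B *v v j) $ a)"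
        by (subst sum.swap) (simp only: matrix_vector_mult_def vec_lambda_beta sum_distrib_left)
      also have "\<dots> = R (Suc k) $ a $ b"
        unfolding R_def vec_lambda_beta by (intro sum.cong refl) (simp only: lessThan_iff Bv, simp add: algebra_simps)
      finally show ?thesis .
    qed
    then have "?B ** R k = R (Suc k)" unfolding vec_eq_iff by blast
    then show ?case using Suc by simp
  qed
  then have "power_trace m P k = trace (R k)" by (simp add: power_trace_def)
  also have "\<dots> = (\<Sum>j<m. complex_of_real (2 * (1 - l j)) ^ k * cip (v j) (v j))"
    unfolding trace_def R_def vec_lambda_beta
    by (subst sum.swap) (simp add: cip_def sum_distrib_left sum_distrib_right mult_ac)
  also have "\<dots> = (\<Sum>j<m. complex_of_real (2 * (1 - l j)) ^ k)"
    by (intro sum.cong refl) (simp add: eigenbasisD(3)[OF e])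
  finally show ?thesis .
qed

lemma rfun_power_trace:
  fixes P :: "real \<Rightarrow> ('n::{finite,linorder}) cmat"
  assumes P: "\<And>i j. rfun X (\<lambda>t. P t $ i $ j)"
  shows "rfun X (\<lambda>t. power_trace m (P t) e)"
proof -
  have B: "rfun X (\<lambda>t. (2 *\<^sub>R (E m - cut m (P t))) $ i $ j)" for i j
  proof -
    have "(\<lambda>t. (2 *\<^sub>R (E m - cut m (P t))) $ i $ j) =
        (\<lambda>t. 2 * (E m $ i $ j - (if pos i < m \<and> pos j < m then P t $ i $ j else 0)))"
      by (simp add: scaleR_conv_of_real fun_eq_iff)
    then show ?thesis by (simp only:) (intro rfun_mult rfun_diff rfun_const rfun_if P)
  qed
  have "rfun X (\<lambda>t. (((**) (2 *\<^sub>R (E m - cut m (P t))) ^^ e) (E m)) $ i $ j)" for i j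
  proof (induction e arbitrary: i j)
    case (Suc e)
    show ?case unfolding funpow.simps comp_apply by (rule rfun_mm[OF B Suc])
  qed (simp add: rfun_const)
  then show ?thesis unfolding power_trace_def trace_def by (intro rfun_sum)
qed

lemma rfun_jnf_det:
  assumes "\<And>a b. rfun X (\<lambda>t. f t a b)"
  shows "rfun X (\<lambda>t. Determinant.det (Matrix.mat r r (\<lambda>(a,b). f t a b)))"
proof -
  have "Determinant.det (Matrix.mat r r (\<lambda>(a,b). f t a b)) =
      (\<Sum>p\<in>{p. p permutes {0..<r}}. signof p * (\<Prod>i\<in>{0..<r}. f t i (p i)))" for t
  proof -
    let ?M = "Matrix.mat r r (\<lambda>(a,b). f t a b)"
    have *: "(\<Prod>i\<in>{0..<r}. ?M $$ (i, p i)) = (\<Prod>i\<in>{0..<r}. f t i (p i))" if "p permutes {0..<r}" for p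
      by (intro prod.cong refl) (use permutes_in_image[OF that] in auto)
    have "Determinant.det ?M = (\<Sum>p\<in>{p. p permutes {0..<r}}. signof p * (\<Prod>i\<in>{0..<r}. ?M $$ (i, p i)))"
      by (rule det_def') simp
    also have "\<dots> = (\<Sum>p\<in>{p. p permutes {0..<r}}. signof p * (\<Prod>i\<in>{0..<r}. f t i (p i)))"
      by (intro sum.cong refl) (simp only: * mem_Collect_eq)
    finally show ?thesis .
  qed
  then show ?thesis by (simp only:) (intro rfun_sum rfun_mult rfun_const rfun_prod assms)
qed

section \<open>Eigenvalues in terms of Gelfand-Tsetlin patterns\<close>

text \<open>The eigenvalues of the corner of size \<open>m\<close> of the projection; adding
  \<open>k/n\<close> undoes the trace normalization of \<open>x\<close>.\<close>

definition gt_eigenvalue :: "nat \<Rightarrow> ('n::{finite,linorder}) cmat \<Rightarrow> nat \<Rightarrow> nat \<Rightarrow> real" where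
  "gt_eigenvalue k x m j = gt (CARD('n) - m) (Suc j) x + real k / real CARD('n)"

lemma gt_eigenvalue_eigenbasis:
  fixes P x :: "('n::{finite,linorder}) cmat"
  assumes P: "projection k P" and x: "x = cs \<i> (P - cs (of_nat k / of_nat CARD('n)) (mat 1))"
    and m: "m \<le> CARD('n)"
  shows "\<exists>v. eigenbasis m (cut m P) v (gt_eigenvalue k x m)"
proof -
  let ?c = "real k / real CARD('n)"
  have hx: "herm x = P - cs (of_real ?c) (mat 1)" by (simp add: x herm_Gr)
  have xs: "cadj x = - x" unfolding x by (rule skew_Gr[OF P])
  obtain v l where e: "eigenbasis m (cut m (herm x)) v l"
    using eigenbasis_exists[OF cadj_herm[OF xs] m] by blast
  then have "eigenbasis m (cut m P) v (\<lambda>j. l j + ?c)"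
    unfolding hx using eigenbasis_shift[OF m] by blast
  moreover have "l j + ?c = gt_eigenvalue k x m j" if "j < m" for j
    using gt_eq[of "CARD('n) - m" x v l "Suc j"] e m that by (simp add: gt_eigenvalue_def)
  ultimately show ?thesis using eigenbasis_cong by blast
qed

lemma gt_pattern_eigenvalue:
  fixes x :: "('n::{finite,linorder}) cmat"
  assumes k: "k \<le> CARD('n)" and m: "m \<le> CARD('n)" "j < m"
  shows "gt_pattern k x (CARD('n) - m, m - j) = 2 * (1 - gt_eigenvalue k x m j)"
proof -
  have "CARD('n) - (CARD('n) - m) + 1 - (m - j) = Suc j" using m by simp
  moreover have "real (CARD('n) - k) / real CARD('n) = 1 - real k / real CARD('n)"
    using k by (simp add: field_simps of_nat_diff)
  ultimately show ?thesis unfolding gt_pattern_def gt_eigenvalue_def by simp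
qed

text \<open>Translation between the positions \<open>(s,i)\<close> and pairs of corner size and
  eigenvalue index counted from 0. The bound \<open>m < n\<close> leaves out the full matrix, as
  \<open>s \<ge> 1\<close> does.\<close>

lemma sum_levels: "(\<Sum>p\<in>levels n. f p) = (\<Sum>m<n. \<Sum>j<m. f (n - m, m - j))"
proof -
  have "(\<Sum>m<n. \<Sum>j<m. f (n - m, m - j)) = (\<Sum>(m,j)\<in>Sigma {..<n} (\<lambda>m. {..<m}). f (n - m, m - j))"
    by (rule sum.Sigma) auto
  also have "\<dots> = (\<Sum>p\<in>levels n. f p)"
    by (rule sum.reindex_bij_witness[where i = "\<lambda>(s,i). (n - s, n - s - i)" and j = "\<lambda>(m,j). (n - m, m - j)"])
      (auto simp: levels_def)
  finally show ?thesis by simp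
qed

lemma finite_levels [simp]: "finite (levels n)"
  by (rule finite_subset[of _ "{..n} \<times> {..n}"]) (auto simp: levels_def)

lemma card_levels: "2 * card (levels n) + n = n\<^sup>2"
proof -
  have "card (levels n) = (\<Sum>m<n. m)" using sum_levels[of "\<lambda>_. 1 :: nat" n] by simp
  moreover have "2 * (\<Sum>m<n. m) + n = n\<^sup>2" by (induction n) (simp_all add: power2_eq_square)
  ultimately show ?thesis by simp
qed

section \<open>Forced and free positions\<close>

text \<open>The positions not forced by the top row: those with \<open>i + s \<le> k\<close> are
  forced to 0, those with \<open>k < i\<close> to 2.\<close>

definition free_levels :: "nat \<Rightarrow> nat \<Rightarrow> (nat \<times> nat) set" where
  "free_levels n k = {(s,i) \<in> levels n. i \<le> k \<and> k < i + s}"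

definition low_levels :: "nat \<Rightarrow> nat \<Rightarrow> (nat \<times> nat) set" where
  "low_levels n k = {(s,i) \<in> levels n. i + s \<le> k}"

definition high_levels :: "nat \<Rightarrow> nat \<Rightarrow> (nat \<times> nat) set" where
  "high_levels n k = {(s,i) \<in> levels n. k < i}"

lemma levels_split:
  "levels n = free_levels n k \<union> (low_levels n k \<union> high_levels n k)"
  "free_levels n k \<inter> (low_levels n k \<union> high_levels n k) = {}" "low_levels n k \<inter> high_levels n k = {}"
  by (auto simp: free_levels_def low_levels_def high_levels_def)

lemma finite_free_levels [simp]: "finite (free_levels n k)" "finite (low_levels n k)" "finite (high_levels n k)"
  by (rule finite_subset[OF _ finite_levels[of n]]; auto simp: free_levels_def low_levels_def high_levels_def)+

text \<open>In the coordinates \<open>i\<close> and \<open>i + s\<close> the free positions form a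
  rectangle with sides \<open>k\<close> and \<open>n - k\<close>, half the dimension of the
  Grassmannian.\<close>

lemma card_free_levels: "k \<le> n \<Longrightarrow> card (free_levels n k) = k * (n - k)"
proof -
  assume k: "k \<le> n"
  have "bij_betw (\<lambda>(s,i). (i, i + s)) (free_levels n k) ({1..k} \<times> {k+1..n})"
    by (rule bij_betw_byWitness[where f' = "\<lambda>(i,q). (q - i, i)"]) (auto simp: free_levels_def levels_def)
  then show ?thesis by (simp add: bij_betw_same_card card_cartesian_product)
qed

lemma card_low_levels: "k \<le> n \<Longrightarrow> 2 * card (low_levels n k) + k = k\<^sup>2"
proof -
  assume "k \<le> n"
  then have "low_levels n k = levels k" by (auto simp: low_levels_def levels_def)
  then show ?thesis using card_levels by simp
qed

text \<open>The forced positions form two triangles, here that of a top row of length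
  \<open>n - k\<close>. The shape of the equation matches the terms \<open>k^2\<close>,
  \<open>k\<close> and their analogues in \<open>off_diagonal_multiplicity\<close>.\<close>

lemma card_high_levels: "k \<le> n \<Longrightarrow> 2 * card (high_levels n k) + (n - k) = (n - k)\<^sup>2"
proof -
  assume k: "k \<le> n"
  have "bij_betw (\<lambda>(s,i). (s, i - k)) (high_levels n k) (levels (n - k))"
    by (rule bij_betw_byWitness[where f' = "\<lambda>(s,i). (s, i + k)"]) (auto simp: high_levels_def levels_def)
  then show ?thesis using card_levels[of "n - k"] by (simp add: bij_betw_same_card)
qed

abbreviation (input) gc_top :: "nat \<Rightarrow> nat \<Rightarrow> real" where
  "gc_top k \<equiv> (\<lambda>i. if i \<le> k then 0 else 2)"

text \<open>Induction on the level: a forced entry is squeezed between two entries of the level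
  above that are forced to the same value.\<close>

lemma gc_pattern_forced:
  assumes y: "y \<in> gc_patterns n (gc_top k)"
  shows "s < n \<Longrightarrow> 1 \<le> i \<Longrightarrow> i \<le> n - s \<Longrightarrow>
    (i + s \<le> k \<longrightarrow> y (s,i) = 0) \<and> (k < i \<longrightarrow> y (s,i) = 2)"
proof (induction s arbitrary: i)
  case 0
  have "\<forall>i\<in>{1..n}. y (0,i) = gc_top k i" using y by (simp add: gc_patterns_def)
  moreover have "i \<in> {1..n}" using 0 by simp
  ultimately have "y (0,i) = gc_top k i" by (rule bspec)
  then show ?case by simp
next
  case (Suc s)
  have "(Suc s, i) \<in> levels n" using Suc.prems by (auto simp: levels_def)
  then have le: "y (s,i) \<le> y (Suc s, i)" "y (Suc s, i) \<le> y (s, i + 1)"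
    using y by (auto simp: gc_patterns_def)
  show ?case using Suc.IH[of i] Suc.IH[of "i + 1"] Suc.prems le by auto
qed

section \<open>Explicit patterns\<close>

text \<open>With \<open>q = i + s\<close> the two interlacing inequalities become monotonicity in
  \<open>q\<close> and in \<open>i\<close>, so any doubly monotone \<open>w\<close> with values
  between 0 and 2 fills the free positions.\<close>

definition monotone_pattern :: "(nat \<Rightarrow> nat \<Rightarrow> real) \<Rightarrow> nat \<Rightarrow> nat \<times> nat \<Rightarrow> real" where
  "monotone_pattern w k = (\<lambda>(s,i). if i + s \<le> k then 0 else if k < i then 2 else w i (i + s))"

lemma monotone_pattern_in_gc_patterns:
  assumes "\<And>i q. i \<le> n \<Longrightarrow> q \<le> n \<Longrightarrow> 0 \<le> w i q \<and> w i q \<le> 2"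
    and "\<And>i q. w i q \<le> w (Suc i) q" "\<And>i q. w i q \<le> w i (Suc q)"
  shows "monotone_pattern w k \<in> gc_patterns n (gc_top k)"
proof -
  have "monotone_pattern w k (s,i) \<le> monotone_pattern w k (Suc s, i) \<and>
      monotone_pattern w k (Suc s, i) \<le> monotone_pattern w k (s, i + 1)" if "(Suc s, i) \<in> levels n" for s i
  proof -
    have "i \<le> n" "i + s \<le> n" "Suc (i + s) \<le> n" "Suc i \<le> n" using that by (auto simp: levels_def)
    then show ?thesis using assms(1)[of i "i + s"] assms(1)[of i "Suc (i + s)"] assms(1)[of "Suc i" "Suc (i + s)"]
      assms(2)[of i "Suc (i + s)"] assms(3)[of i "i + s"] by (auto simp: monotone_pattern_def)
  qed
  then show ?thesis by (auto simp: gc_patterns_def monotone_pattern_def)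
qed

text \<open>The pair \<open>(i, q)\<close> read as a number in base \<open>n + 1\<close>, hence
  injective, and scaled into the interval from 0 to 2.\<close>

definition generic_weight :: "nat \<Rightarrow> nat \<Rightarrow> nat \<Rightarrow> real" where
  "generic_weight n i q = 2 * real (i * (n + 1) + q) / real ((n + 2)\<^sup>2)"

lemma generic_pattern: "monotone_pattern (generic_weight n) k \<in> gc_patterns n (gc_top k)"
proof (rule monotone_pattern_in_gc_patterns)
  show "0 \<le> generic_weight n i q \<and> generic_weight n i q \<le> 2" if "i \<le> n" "q \<le> n" for i q
  proof -
    have "i * (n + 1) + q \<le> n * (n + 1) + n" using that by (intro add_mono mult_right_mono) auto
    also have "\<dots> \<le> (n + 2)\<^sup>2" by (simp add: power2_eq_square)
    finally have le: "real (i * (n + 1) + q) \<le> real ((n + 2)\<^sup>2)" by (simp only: of_nat_le_iff)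
    have gen: "0 \<le> 2 * X / N \<and> 2 * X / N \<le> 2" if "0 \<le> X" "X \<le> N" "0 < N" for X N :: real
      using that by (simp add: divide_le_eq)
    show ?thesis unfolding generic_weight_def by (rule gen[OF _ le]) simp_all
  qed
qed (auto simp: generic_weight_def simp del: of_nat_power intro!: divide_right_mono)

lemma generic_pattern_inj: "inj_on (monotone_pattern (generic_weight n) k) (free_levels n k)"
proof (rule inj_onI)
  fix p p' assume p: "p \<in> free_levels n k" "p' \<in> free_levels n k"
    and eq: "monotone_pattern (generic_weight n) k p = monotone_pattern (generic_weight n) k p'"
  obtain s i s' i' where si: "p = (s,i)" "p' = (s',i')" by (cases p; cases p')
  have "generic_weight n i (i + s) = generic_weight n i' (i' + s')"
    using eq p by (auto simp: si monotone_pattern_def free_levels_def)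
  then have "real (i * (n + 1) + (i + s)) = real (i' * (n + 1) + (i' + s'))"
    by (simp add: generic_weight_def del: of_nat_power of_nat_add of_nat_mult)
  then have nat: "i * (n + 1) + (i + s) = i' * (n + 1) + (i' + s')" by (simp only: of_nat_eq_iff)
  have b: "i + s < n + 1" "i' + s' < n + 1" using p by (auto simp: si free_levels_def levels_def)
  have div: "(j * (n + 1) + r) div (n + 1) = j" if "r < n + 1" for j r :: nat
    by (rule div_nat_eqI) (use that in \<open>simp_all add: algebra_simps\<close>)
  have "i = (i * (n + 1) + (i + s)) div (n + 1)" by (rule div[OF b(1), symmetric])
  also have "\<dots> = i'" unfolding nat by (rule div[OF b(2)])
  finally have "i = i'" .
  then show "p = p'" using nat by (simp add: si)
qed

text \<open>At a free position the pattern with weight 0 and the generic pattern differ; at the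
  other positions the value is forced.\<close>

lemma gc_free_eq: "k \<le> n \<Longrightarrow> gc_free n (gc_top k) = free_levels n k"
proof -
  have zero: "monotone_pattern (\<lambda>_ _. 0) k \<in> gc_patterns n (gc_top k)"
    by (rule monotone_pattern_in_gc_patterns) auto
  have "(\<lambda>y. y (s,i)) constant_on gc_patterns n (gc_top k) \<longleftrightarrow> (s,i) \<notin> free_levels n k"
    if si: "(s,i) \<in> levels n" for s i
  proof
    assume c: "(\<lambda>y. y (s,i)) constant_on gc_patterns n (gc_top k)"
    show "(s,i) \<notin> free_levels n k"
    proof
      assume f: "(s,i) \<in> free_levels n k"
      have "monotone_pattern (\<lambda>_ _. 0) k (s,i) = monotone_pattern (generic_weight n) k (s,i)"
        using c zero generic_pattern unfolding constant_on_def by metis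
      moreover have "0 < generic_weight n i (i + s)"
      proof -
        have "0 < i * (n + 1) + (i + s)" using si by (auto simp: levels_def)
        then have "0 < real (i * (n + 1) + (i + s))" by (simp only: of_nat_0_less_iff)
        moreover have "0 < real ((n + 2)\<^sup>2)" by simp
        ultimately show ?thesis unfolding generic_weight_def by (intro divide_pos_pos mult_pos_pos) simp_all
      qed
      ultimately show False using f by (auto simp: monotone_pattern_def free_levels_def)
    qed
  next
    assume "(s,i) \<notin> free_levels n k"
    then have "i + s \<le> k \<or> k < i" using si by (auto simp: free_levels_def)
    moreover have "s < n" "1 \<le> i" "i \<le> n - s" using si by (auto simp: levels_def)
    ultimately show "(\<lambda>y. y (s,i)) constant_on gc_patterns n (gc_top k)"
      unfolding constant_on_def using gc_pattern_forced[of _ n k s i] by metis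
  qed
  then show ?thesis by (auto simp: gc_free_def free_levels_def)
qed

lemma gt_pattern_forced:
  fixes x :: "('n::{finite,linorder}) cmat"
  assumes k: "k \<le> CARD('n)" and x: "x \<in> Gr k"
  shows "p \<in> low_levels CARD('n) k \<Longrightarrow> gt_pattern k x p = 0" "p \<in> high_levels CARD('n) k \<Longrightarrow> gt_pattern k x p = 2"
  using gc_pattern_forced[OF gt_pattern_in_gc_patterns[OF k x], of "fst p" "snd p"]
  by (auto simp: low_levels_def high_levels_def levels_def)

lemma gt_pattern_realized:
  assumes k: "k \<le> CARD('n::{finite,linorder})" and y: "y \<in> gc_patterns CARD('n) (gc_top k)"
  shows "\<exists>x\<in>(Gr k :: 'n cmat set). \<forall>p\<in>levels CARD('n). gt_pattern k x p = y p"
proof -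
  obtain x :: "'n cmat" where x: "x \<in> Gr k"
    "\<forall>s i. s < CARD('n) \<longrightarrow> 1 \<le> i \<longrightarrow> i \<le> CARD('n) - s \<longrightarrow> gt_pattern k x (s,i) = y (s,i)"
    using gc_pattern_realized[OF k y] by blast
  have "gt_pattern k x p = y p" if "p \<in> levels CARD('n)" for p
  proof -
    obtain s i where p: "p = (s,i)" by (cases p)
    then have "s < CARD('n)" "1 \<le> i" "i \<le> CARD('n) - s" using that by (auto simp: levels_def)
    then show ?thesis using x(2) p by simp
  qed
  then show ?thesis using x(1) by blast
qed

section \<open>Transfer to the Grassmannian\<close>

text \<open>On the levels the maps \<open>gt_pattern k x\<close> run through all patterns and
  nothing else, so constancy on the Grassmannian is constancy on the patterns.\<close>

lemma gt_pattern_constant_iff: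
  assumes k: "k \<le> CARD('n::{finite,linorder})" and p: "p \<in> levels CARD('n)"
  shows "(\<lambda>x. gt_pattern k x p) constant_on (Gr k :: 'n cmat set) \<longleftrightarrow> p \<notin> free_levels CARD('n) k"
proof -
  have "(\<lambda>x. gt_pattern k x p) constant_on (Gr k :: 'n cmat set) \<longleftrightarrow>
      (\<lambda>y. y p) constant_on gc_patterns CARD('n) (gc_top k)"
  proof
    assume "(\<lambda>x. gt_pattern k x p) constant_on (Gr k :: 'n cmat set)"
    then obtain c where "\<forall>x\<in>(Gr k :: 'n cmat set). gt_pattern k x p = c" by (auto simp: constant_on_def)
    then show "(\<lambda>y. y p) constant_on gc_patterns CARD('n) (gc_top k)"
      using gt_pattern_realized[OF k] p unfolding constant_on_def by metis
  next
    assume "(\<lambda>y. y p) constant_on gc_patterns CARD('n) (gc_top k)"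
    then show "(\<lambda>x. gt_pattern k x p) constant_on (Gr k :: 'n cmat set)"
      using gt_pattern_in_gc_patterns[OF k] unfolding constant_on_def by metis
  qed
  then show ?thesis using gc_free_eq[OF k] p by (auto simp: gc_free_def)
qed

lemma increasing_index_Gr:
  assumes k: "k \<le> CARD('n::{finite,linorder})"
  shows "increasing_index (Gr k :: 'n cmat set) = free_levels CARD('n) k"
proof -
  let ?n = "CARD('n)"
  have "(s, ?n - s + 1 - i) \<in> gt_index (Gr k :: 'n cmat set) \<longleftrightarrow> (s,i) \<in> free_levels ?n k"
    if si: "(s,i) \<in> levels ?n" for s i
  proof -
    have "(s, ?n - s + 1 - i) \<in> levels ?n" using si by (auto simp: levels_def)
    moreover have "gt s (?n - s + 1 - i) constant_on (Gr k :: 'n cmat set) \<longleftrightarrow>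
        (\<lambda>x. gt_pattern k x (s,i)) constant_on (Gr k :: 'n cmat set)"
    proof
      assume "gt s (?n - s + 1 - i) constant_on (Gr k :: 'n cmat set)"
      then show "(\<lambda>x. gt_pattern k x (s,i)) constant_on (Gr k :: 'n cmat set)"
        unfolding constant_on_def gt_pattern_def prod.case by metis
    next
      assume "(\<lambda>x. gt_pattern k x (s,i)) constant_on (Gr k :: 'n cmat set)"
      then obtain c where "\<forall>x\<in>(Gr k :: 'n cmat set). gt_pattern k x (s,i) = c" by (auto simp: constant_on_def)
      have solve: "a = b - d / 2" if "-2 * (a - b) = d" for a b d :: real using that by simp
      have "\<forall>x\<in>(Gr k :: 'n cmat set). gt s (?n - s + 1 - i) x = real (?n - k) / real ?n - c / 2"
      proof (intro ballI)
        fix x :: "'n cmat" assume "x \<in> Gr k"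
        then have "-2 * (gt s (?n - s + 1 - i) x - real (?n - k) / real ?n) = c"
          using \<open>\<forall>x\<in>(Gr k :: 'n cmat set). gt_pattern k x (s,i) = c\<close> unfolding gt_pattern_def prod.case by blast
        then show "gt s (?n - s + 1 - i) x = real (?n - k) / real ?n - c / 2" by (rule solve)
      qed
      then show "gt s (?n - s + 1 - i) constant_on (Gr k :: 'n cmat set)" unfolding constant_on_def by blast
    qed
    ultimately show ?thesis using gt_pattern_constant_iff[OF k si] by (simp add: gt_index_def)
  qed
  then show ?thesis by (auto simp: increasing_index_def free_levels_def)
qed

text \<open>Twice the number of low positions plus \<open>k\<close> is \<open>k^2\<close>, and
  similarly for the high ones. The forced positions and the full corner thus cancel against the
  block diagonal part, and twice the count over the free positions remains.\<close>

lemma Gr_multiplicity: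
  fixes x :: "('n::{finite,linorder}) cmat"
  assumes k: "k \<le> CARD('n)" and x: "x \<in> Gr k"
  shows "dim (generalized_eigenspace (tangent_orbit x) (nijenhuis k x) c) =
      2 * card {p \<in> free_levels CARD('n) k. gt_pattern k x p = c}"
    and "dim (tangent_orbit x) = 2 * card (free_levels CARD('n) k)"
    and "eigenvalues_on (tangent_orbit x) (nijenhuis k x) = gt_pattern k x ` free_levels CARD('n) k"
proof -
  let ?n = "CARD('n)"
  let ?y = "gt_pattern k x"
  obtain P where P: "projection k P" and xP: "x = cs \<i> (P - cs (of_nat k / of_nat ?n) (mat 1))"
    using x Gr_iff[OF k] by blast
  note xs = Gr_skew[OF k x]
  note T = tangent_orbit_eq[OF P xP xs]
  note M = off_diagonal_multiplicity[OF P gt_eigenvalue_eigenbasis[OF P xP], folded T(1)]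
  have N: "nijenhuis k x v = nij_op P v" if "v \<in> tangent_orbit x" for v
    using nijenhuis_eq[OF k x that] T(2)[of v] that unfolding T(1) by simp
  have count: "card {p \<in> levels ?n. ?y p = c} = (\<Sum>m<?n. multiplicity_count (gt_eigenvalue k x) m c)" for c
  proof -
    have "card {p \<in> levels ?n. ?y p = c} = (\<Sum>p\<in>levels ?n. if ?y p = c then 1 else 0)"
      by (simp add: sum.If_cases Int_def)
    also have "\<dots> = (\<Sum>m<?n. \<Sum>j<m. if 2 * (1 - gt_eigenvalue k x m j) = c then 1 else 0)"
      unfolding sum_levels by (intro sum.cong refl) (simp add: gt_pattern_eigenvalue[OF k])
    also have "\<dots> = (\<Sum>m<?n. multiplicity_count (gt_eigenvalue k x) m c)"
      by (intro sum.cong refl) (simp add: multiplicity_count_def sum.If_cases Int_def)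
    finally show ?thesis .
  qed
  have split: "card {p \<in> levels ?n. ?y p = c} = card {p \<in> free_levels ?n k. ?y p = c}
      + ((if c = 0 then card (low_levels ?n k) else 0) + (if c = 2 then card (high_levels ?n k) else 0))" for c
  proof -
    have L: "{p \<in> low_levels ?n k. ?y p = c} = (if c = 0 then low_levels ?n k else {})"
      "{p \<in> high_levels ?n k. ?y p = c} = (if c = 2 then high_levels ?n k else {})"
      using gt_pattern_forced[OF k x] by auto
    have "{p \<in> levels ?n. ?y p = c} = {p \<in> free_levels ?n k. ?y p = c} \<union>
        ({p \<in> low_levels ?n k. ?y p = c} \<union> {p \<in> high_levels ?n k. ?y p = c})"
      using levels_split(1)[of ?n k] by blast
    also have "card \<dots> = card {p \<in> free_levels ?n k. ?y p = c} +
        card ({p \<in> low_levels ?n k. ?y p = c} \<union> {p \<in> high_levels ?n k. ?y p = c})"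
      using levels_split(2)[of ?n k] by (intro card_Un_disjoint) auto
    also have "card ({p \<in> low_levels ?n k. ?y p = c} \<union> {p \<in> high_levels ?n k. ?y p = c}) =
        card {p \<in> low_levels ?n k. ?y p = c} + card {p \<in> high_levels ?n k. ?y p = c}"
      using levels_split(3)[of ?n k] by (intro card_Un_disjoint) auto
    finally show ?thesis unfolding L by (simp add: if_distrib[of card])
  qed
  have gen: "dim (generalized_eigenspace (tangent_orbit x) (nij_op P) c) =
      2 * card {p \<in> free_levels ?n k. ?y p = c}" for c
    using M(4)[of c] count[of c] split[of c] card_low_levels[OF k] card_high_levels[OF k] by (auto split: if_splits)
  have "nijenhuis k x v \<in> tangent_orbit x" if "v \<in> tangent_orbit x" for v using N M(2) that by metis
  then have "generalized_eigenspace (tangent_orbit x) (nijenhuis k x) c =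
      generalized_eigenspace (tangent_orbit x) (nij_op P) c"
    by (intro generalized_eigenspace_cong N M(1))
  then show "dim (generalized_eigenspace (tangent_orbit x) (nijenhuis k x) c) =
      2 * card {p \<in> free_levels ?n k. ?y p = c}" using gen by simp
  have "?n = k + (?n - k)" using k by simp
  then have "?n\<^sup>2 = k\<^sup>2 + 2 * (k * (?n - k)) + (?n - k)\<^sup>2"
    by (metis (no_types, lifting) power2_sum mult.assoc add.assoc add.commute)
  then show "dim (tangent_orbit x) = 2 * card (free_levels ?n k)"
    using M(3) card_free_levels[OF k] by simp
  have "eigenvalues_on (tangent_orbit x) (nijenhuis k x) = eigenvalues_on (tangent_orbit x) (nij_op P)"
    unfolding eigenvalues_on_def using N by (intro Collect_cong bex_cong) auto
  also have "\<dots> = ?y ` free_levels ?n k"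
  proof (rule Set.set_eqI)
    fix c
    have "c \<in> eigenvalues_on (tangent_orbit x) (nij_op P) \<longleftrightarrow> card {p \<in> free_levels ?n k. ?y p = c} \<noteq> 0"
      using eigenvalues_on_iff_generalized[OF linear_nij_op M(1,2), of c] gen[of c] by simp
    also have "\<dots> \<longleftrightarrow> {p \<in> free_levels ?n k. ?y p = c} \<noteq> {}" by (simp del: Collect_empty_eq)
    also have "\<dots> \<longleftrightarrow> c \<in> ?y ` free_levels ?n k" by blast
    finally show "c \<in> eigenvalues_on (tangent_orbit x) (nij_op P) \<longleftrightarrow> c \<in> ?y ` free_levels ?n k" .
  qed
  finally show "eigenvalues_on (tangent_orbit x) (nijenhuis k x) = ?y ` free_levels ?n k" .
qed

section \<open>Maximal rank\<close>

text \<open>A function of \<open>P\<close> through traces only: the power sums over all proper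
  corners minus the contribution of the forced values 0 and 2. The term with base 0 matters for
  exponent 0, where it counts the low positions.\<close>

definition hankel_det :: "nat \<Rightarrow> ('n::{finite,linorder}) cmat \<Rightarrow> complex" where
  "hankel_det k P = (let n = CARD('n); r = card (free_levels n k) in
     Determinant.det (Matrix.mat r r (\<lambda>(a,b). (\<Sum>m<n. power_trace m P (a + b))
       - (\<Sum>p\<in>low_levels n k. 0 ^ (a + b)) - (\<Sum>p\<in>high_levels n k. 2 ^ (a + b)))))"

lemma hankel_det_nonzero:
  fixes P x :: "('n::{finite,linorder}) cmat"
  assumes k: "k \<le> CARD('n)" and P: "projection k P" and xP: "x = cs \<i> (P - cs (of_nat k / of_nat CARD('n)) (mat 1))"
  shows "hankel_det k P \<noteq> 0 \<longleftrightarrow> inj_on (gt_pattern k x) (free_levels CARD('n) k)"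
proof -
  let ?n = "CARD('n)" and ?y = "gt_pattern k x"
  have x: "x \<in> Gr k" using P xP Gr_iff[OF k] by blast
  have "(\<Sum>m<?n. power_trace m P e) - (\<Sum>p\<in>low_levels ?n k. 0 ^ e) - (\<Sum>p\<in>high_levels ?n k. 2 ^ e) =
      (\<Sum>p\<in>free_levels ?n k. complex_of_real (?y p) ^ e)" for e
  proof -
    have "power_trace m P e = (\<Sum>j<m. complex_of_real (?y (?n - m, m - j)) ^ e)" if "m < ?n" for m
    proof -
      have "m \<le> ?n" using that by simp
      then obtain v where "eigenbasis m (cut m P) v (gt_eigenvalue k x m)"
        using gt_eigenvalue_eigenbasis[OF P xP] by blast
      from power_trace_eq[OF this, of e] show ?thesis
        using that by (simp add: gt_pattern_eigenvalue[OF k])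
    qed
    then have "(\<Sum>m<?n. power_trace m P e) = (\<Sum>p\<in>levels ?n. complex_of_real (?y p) ^ e)"
      unfolding sum_levels by (intro sum.cong refl) simp
    also have "\<dots> = (\<Sum>p\<in>free_levels ?n k. complex_of_real (?y p) ^ e) +
        ((\<Sum>p\<in>low_levels ?n k. complex_of_real (?y p) ^ e) + (\<Sum>p\<in>high_levels ?n k. complex_of_real (?y p) ^ e))"
      using levels_split[of ?n k] by (simp add: sum.union_disjoint)
    also have "(\<Sum>p\<in>low_levels ?n k. complex_of_real (?y p) ^ e) = (\<Sum>p\<in>low_levels ?n k. 0 ^ e)"
      by (intro sum.cong refl) (simp add: gt_pattern_forced(1)[OF k x])
    also have "(\<Sum>p\<in>high_levels ?n k. complex_of_real (?y p) ^ e) = (\<Sum>p\<in>high_levels ?n k. 2 ^ e)"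
      by (intro sum.cong refl) (simp add: gt_pattern_forced(2)[OF k x])
    finally show ?thesis by simp
  qed
  then show ?thesis
    unfolding hankel_det_def Let_def by (simp only:) (rule hankel_det_nonzero_iff[OF finite_free_levels(1) refl])
qed

lemma generic_points_dense:
  fixes x :: "('n::{finite,linorder}) cmat"
  assumes k: "k \<le> CARD('n)" and x: "x \<in> Gr k"
  shows "x \<in> closure {x \<in> Gr k. inj_on (gt_pattern k x) (free_levels CARD('n) k)}"
proof -
  let ?n = "CARD('n)"
  let ?x = "\<lambda>P :: 'n cmat. cs \<i> (P - cs (of_nat k / of_nat ?n) (mat 1))"
  \<comment> \<open>A point with distinct free eigenvalues, obtained by realizing the generic
    pattern; the curve from \<open>x\<close> ends there at \<open>t = 1\<close>.\<close>
  obtain x1 :: "'n cmat" where x1: "x1 \<in> Gr k"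
    "\<forall>p\<in>levels ?n. gt_pattern k x1 p = monotone_pattern (generic_weight ?n) k p"
    using gt_pattern_realized[OF k generic_pattern] by blast
  have inj1: "inj_on (gt_pattern k x1) (free_levels ?n k)"
    using generic_pattern_inj[of ?n k] x1(2) levels_split(1)[of ?n k] by (auto simp: inj_on_def)
  obtain P0 P1 where P0: "projection k P0" "x = ?x P0" and P1: "projection k P1" "x1 = ?x P1"
    using x x1(1) Gr_iff[OF k] by meson
  obtain g h where g: "g \<in> SU" "P0 = g ** E k ** cadj g" and h: "h \<in> SU" "P1 = h ** E k ** cadj h"
    using projection_unitary_conj(2)[OF P0(1)] projection_unitary_conj(2)[OF P1(1)] by blast
  obtain X P where X: "open X" "0 \<in> X" "1 \<in> X" and P: "\<forall>t\<in>X. projection k (P t)"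
    and P01: "P 0 = g ** E k ** cadj g" "P 1 = h ** E k ** cadj h" and r: "\<forall>i j. rfun X (\<lambda>t. P t $ i $ j)"
    by (rule projection_curve[OF k g(1) h(1)])
  have rP: "rfun X (\<lambda>t. P t $ i $ j)" for i j using r by blast
  have rh: "rfun X (\<lambda>t. hankel_det k (P t))"
    unfolding hankel_det_def Let_def
    by (intro rfun_jnf_det rfun_diff rfun_sum rfun_power_trace rP rfun_const)
  have h1: "hankel_det k (P 1) \<noteq> 0"
    using hankel_det_nonzero[OF k P1] inj1 by (simp add: P01 h(2)[symmetric])
  have "continuous_on X (\<lambda>t. ?x (P t))"
    unfolding cs_def
  proof (intro continuous_on_vec_lambda)
    fix i j
    have "continuous_on X (\<lambda>t. P t $ i $ j)" using rP[of i j] by (simp add: rfun_def)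
    then show "continuous_on X (\<lambda>t. \<i> * (P t - (\<chi> i j. of_nat k / of_nat ?n * mat 1 $ i $ j)) $ i $ j)"
      by (simp add: continuous_on_mult_left continuous_on_diff)
  qed
  then have cont: "isCont (\<lambda>t. ?x (P t)) 0" using X by (simp add: continuous_on_eq_continuous_at)
  show ?thesis
    unfolding closure_approachable
  proof (intro allI impI)
    fix e :: real assume "e > 0"
    then obtain d where d: "d > 0" "\<And>t. dist t 0 < d \<Longrightarrow> dist (?x (P t)) (?x (P 0)) < e"
      using cont unfolding continuous_at_eps_delta by blast
    obtain t where t: "t \<in> X" "\<bar>t\<bar> < d" "hankel_det k (P t) \<noteq> 0"
      by (rule rfun_nonzero_near_0[OF X rh h1 d(1)])
    have "inj_on (gt_pattern k (?x (P t))) (free_levels ?n k)"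
      using hankel_det_nonzero[OF k P[rule_format, OF t(1)] refl] t(3) by blast
    moreover have "?x (P t) \<in> Gr k" using P t(1) Gr_iff[OF k] by blast
    moreover have "dist (?x (P t)) x < e" using d(2)[of t] t(2) by (simp add: P0(2) P01 g(2))
    ultimately show "\<exists>y\<in>{x \<in> Gr k. inj_on (gt_pattern k x) (free_levels ?n k)}. dist y x < e" by blast
  qed
qed

lemma continuous_on_gt_pattern:
  assumes k: "k \<le> CARD('n::{finite,linorder})" and p: "p \<in> levels CARD('n)"
  shows "continuous_on (Gr k :: 'n cmat set) (\<lambda>x. gt_pattern k x p)"
proof -
  obtain K where K: "\<And>(x :: 'n cmat) y s j. cadj x = - x \<Longrightarrow> cadj y = - y \<Longrightarrow> 1 \<le> j \<Longrightarrow>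
      j \<le> CARD('n) - s \<Longrightarrow> \<bar>gt s j x - gt s j y\<bar> \<le> K * norm (x - y)"
    using gt_lipschitz[where 'n = 'n] by blast
  obtain s i where si: "p = (s,i)" by (cases p)
  let ?j = "CARD('n) - s + 1 - i"
  have j: "1 \<le> ?j" "?j \<le> CARD('n) - s" using p by (auto simp: si levels_def)
  have "continuous_on (Gr k :: 'n cmat set) (gt s ?j)"
    unfolding continuous_on_iff
  proof (intro ballI allI impI)
    fix x :: "'n cmat" and e :: real assume x: "x \<in> Gr k" and e: "e > 0"
    \<comment> \<open>The positive constant \<open>\<bar>K\<bar> + 1\<close> replaces
      \<open>K\<close>, whose sign is unknown.\<close>
    have "dist (gt s ?j y) (gt s ?j x) < e" if y: "y \<in> Gr k" "dist y x < e / (\<bar>K\<bar> + 1)" for y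
    proof -
      have "\<bar>gt s ?j y - gt s ?j x\<bar> \<le> K * norm (y - x)"
        by (rule K[OF Gr_skew[OF k y(1)] Gr_skew[OF k x] j])
      also have "\<dots> \<le> (\<bar>K\<bar> + 1) * norm (y - x)" by (intro mult_right_mono) auto
      also have "\<dots> < e" using y(2) by (simp add: dist_norm pos_less_divide_eq mult.commute)
      finally show ?thesis by (simp add: dist_real_def)
    qed
    then show "\<exists>d>0. \<forall>y\<in>Gr k. dist y x < d \<longrightarrow> dist (gt s ?j y) (gt s ?j x) < e"
      using e by (intro exI[of _ "e / (\<bar>K\<bar> + 1)"]) auto
  qed
  then show ?thesis unfolding gt_pattern_def si prod.case by (intro continuous_intros)
qed

lemma generic_points_open:
  assumes k: "k \<le> CARD('n::{finite,linorder})"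
  shows "openin (top_of_set (Gr k)) {x \<in> (Gr k :: 'n cmat set). inj_on (gt_pattern k x) (free_levels CARD('n) k)}"
proof -
  let ?F = "free_levels CARD('n) k"
  \<comment> \<open>A product of differences, nonzero exactly where the free entries are distinct
    and continuous because each entry is.\<close>
  define D where "D x = (\<Prod>p\<in>?F. \<Prod>p'\<in>?F - {p}. gt_pattern k x p - gt_pattern k x p')" for x :: "'n cmat"
  have F: "p \<in> levels CARD('n)" if "p \<in> ?F" for p using that levels_split(1)[of "CARD('n)" k] by blast
  have "continuous_on (Gr k) D"
    unfolding D_def by (intro continuous_on_prod continuous_on_diff continuous_on_gt_pattern k F) auto
  then have "openin (top_of_set (Gr k)) (Gr k \<inter> D -` (- {0}))"
    by (rule continuous_openin_preimage_gen) auto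
  moreover have "D x \<noteq> 0 \<longleftrightarrow> inj_on (gt_pattern k x) ?F" for x
    by (auto simp: D_def inj_on_def)
  ultimately show ?thesis by (simp add: Int_def vimage_def)
qed

theorem theorem7p2:
  fixes k :: nat and lam :: "nat \<Rightarrow> nat \<Rightarrow> ('n::{finite,linorder}) cmat \<Rightarrow> real"
    and M :: "('n cmat) set"
  assumes k: "1 \<le> k" "k \<le> CARD('n) - 1"
    and M: "M = Gr k"
    and lam: "\<And>s j x. lam s j x = -2 * (gt s j x - real (CARD('n) - k) / real CARD('n))"
  shows "maximal_rank M tangent_orbit (nijenhuis k) \<and>
    (\<forall>x\<in>M. eigenvalues_on (tangent_orbit x) (nijenhuis k x) = {lam s j x | s j. (s,j) \<in> gt_index M}) \<and>
    bihamiltonian_moment_map M tangent_orbit (nijenhuis k)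
      (increasing_index M) (increasing_enumeration M lam) \<and>
    increasing_enumeration M lam ` M = gc_polytope CARD('n) (\<lambda>i. if i \<le> k then 0 else 2)"
proof -
  let ?n = "CARD('n)" and ?F = "free_levels CARD('n) k"
  have kn: "k \<le> ?n" using k by linarith
  have I: "increasing_index M = ?F" unfolding M by (rule increasing_index_Gr[OF kn])
  have pat: "lam s (?n - s + 1 - i) x = gt_pattern k x (s,i)" for s i x
    by (simp add: lam gt_pattern_def)
  have enum: "increasing_enumeration M lam x = restrict (gt_pattern k x) ?F" for x
    unfolding increasing_enumeration_def I
  proof (rule restrict_ext)
    fix p assume "p \<in> ?F"
    obtain s i where p: "p = (s,i)" by (cases p)
    show "(case p of (s,i) \<Rightarrow> lam s (?n - s + 1 - i) x) = gt_pattern k x p"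
      unfolding p prod.case by (rule pat)
  qed
  have image: "increasing_enumeration M lam x ` ?F = gt_pattern k x ` ?F" for x
    unfolding enum by (intro image_cong) auto
  have eigs: "{lam s j x | s j. (s,j) \<in> gt_index M} = gt_pattern k x ` ?F" for x
  proof (intro Set.set_eqI iffI)
    fix c assume "c \<in> {lam s j x | s j. (s,j) \<in> gt_index M}"
    then obtain s j where sj: "c = lam s j x" "(s,j) \<in> gt_index M" by blast
    then have l: "(s,j) \<in> levels ?n" by (auto simp: gt_index_def)
    define i where "i = ?n - s + 1 - j"
    have i: "?n - s + 1 - i = j" "(s,i) \<in> levels ?n" using l by (auto simp: i_def levels_def)
    then have "(s,i) \<in> ?F" using sj(2) unfolding I[symmetric] by (simp add: increasing_index_def)
    then show "c \<in> gt_pattern k x ` ?F" using pat[of s i x] sj(1) i(1) by force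
  next
    fix c assume "c \<in> gt_pattern k x ` ?F"
    then obtain s i where si: "(s,i) \<in> ?F" "c = gt_pattern k x (s,i)" by auto
    then have "(s, ?n - s + 1 - i) \<in> gt_index M" unfolding I[symmetric] by (simp add: increasing_index_def)
    then show "c \<in> {lam s j x | s j. (s,j) \<in> gt_index M}" using si(2) pat by (metis (mono_tags, lifting) mem_Collect_eq)
  qed
  note mult = Gr_multiplicity[OF kn]
  have "maximal_rank M tangent_orbit (nijenhuis k)"
    unfolding maximal_rank_def
  proof (intro exI conjI ballI)
    let ?U = "{x \<in> Gr k. inj_on (gt_pattern k x) ?F} :: 'n cmat set"
    show "openin (top_of_set M) ?U" unfolding M by (rule generic_points_open[OF kn])
    show "M \<subseteq> closure ?U" unfolding M using generic_points_dense[OF kn] by blast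
    fix x assume x: "x \<in> ?U"
    then show "finite (eigenvalues_on (tangent_orbit x) (nijenhuis k x))"
      using mult(3)[of x] by simp
    \<comment> \<open>Injectivity on the free positions makes the eigenvalues as numerous as the
      positions, whose number is half the dimension.\<close>
    show "2 * card (eigenvalues_on (tangent_orbit x) (nijenhuis k x)) = dim (tangent_orbit x)"
      using mult(2,3)[of x] x by (simp add: card_image)
  qed
  moreover have "\<forall>x\<in>M. eigenvalues_on (tangent_orbit x) (nijenhuis k x) = {lam s j x | s j. (s,j) \<in> gt_index M}"
    unfolding eigs using mult(3) by (simp add: M)
  moreover have "bihamiltonian_moment_map M tangent_orbit (nijenhuis k) (increasing_index M) (increasing_enumeration M lam)"
    unfolding bihamiltonian_moment_map_def I
  proof (intro conjI ballI allI)
    fix x c assume x: "x \<in> M"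
    then have xG: "x \<in> Gr k" by (simp add: M)
    show "2 * card ?F = dim (tangent_orbit x)" using mult(2)[OF xG] by simp
    show "increasing_enumeration M lam x ` ?F = eigenvalues_on (tangent_orbit x) (nijenhuis k x)"
      unfolding image mult(3)[OF xG] ..
    have "{i \<in> ?F. increasing_enumeration M lam x i = c} = {p \<in> ?F. gt_pattern k x p = c}"
      unfolding enum by auto
    then show "dim (generalized_eigenspace (tangent_orbit x) (nijenhuis k x) c) =
        2 * card {i \<in> ?F. increasing_enumeration M lam x i = c}"
      using mult(1)[OF xG, of c] by simp
  qed simp
  moreover have "increasing_enumeration M lam ` M = gc_polytope ?n (gc_top k)"
  proof
    show "increasing_enumeration M lam ` M \<subseteq> gc_polytope ?n (gc_top k)"
    proof (rule image_subsetI)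
      fix x assume "x \<in> M"
      then have "gt_pattern k x \<in> gc_patterns ?n (gc_top k)"
        unfolding M by (rule gt_pattern_in_gc_patterns[OF kn])
      then show "increasing_enumeration M lam x \<in> gc_polytope ?n (gc_top k)"
        unfolding gc_polytope_def gc_free_eq[OF kn] enum by (rule imageI)
    qed
    show "gc_polytope ?n (gc_top k) \<subseteq> increasing_enumeration M lam ` M"
    proof
      fix z assume "z \<in> gc_polytope ?n (gc_top k)"
      then obtain y where y: "y \<in> gc_patterns ?n (gc_top k)" "z = restrict y ?F"
        unfolding gc_polytope_def gc_free_eq[OF kn] by blast
      obtain x :: "'n cmat" where x: "x \<in> Gr k" "\<forall>p\<in>levels ?n. gt_pattern k x p = y p"
        using gt_pattern_realized[OF kn y(1)] by blast
      \<comment> \<open>The realizing point agrees with \<open>y\<close> on every level from 1 on,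
        in particular at the free positions, which are all that the restriction retains.\<close>
      have "z = increasing_enumeration M lam x"
        unfolding enum y(2) using x(2) levels_split(1)[of ?n k] by (intro restrict_ext) auto
      then show "z \<in> increasing_enumeration M lam ` M" using x(1) M by blast
    qed
  qed
  ultimately show ?thesis by blast
qed

end
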